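(* Let $\mathcal L(x,y)=f(x)+\Phi(x,y)-h(y)$ satisfy the standing assumptions given in the context, and let $\mathbf D_{\mathcal X},\mathbf D_{\mathcal Y}$ be the Bregman distances. Let $\{x_k,y_k\}_{k\ge 0}$ be generated by the algorithm APD (described in the context) from $(x_0,y_0)\in\mathrm{dom} f\times\mathrm{dom} h$ and $\tau_0,\sigma_0>0$. Then the step-size update rule of APD implies $$\theta_{k+1}=\frac{1}{\sqrt{1+\mu\tau_k}},\qquad \tau_{k+1}=\theta_{k+1}\tau_k,\qquad \sigma_{k+1}=\sigma_k/\theta_{k+1},\qquad \forall k\ge 0.$$ Suppose that $$\Big(\frac{1-\delta}{\tau_0}-L_{xx}\Big)\frac1{\sigma_0}\ge\frac{L_{yx}^2}{c_\alpha},\qquad 1-(\delta+c_\alpha+c_\beta)\ge\frac{L_{yy}^2}{c_\beta}\sigma_0^2$$ for some $\delta,c_\alpha,c_\beta\in\mathbb R_+$ with $c_\alpha+c_\beta+\delta\le 1$, where $c_\alpha,c_\beta>0$ when $L_{yy}>0$, and $c_\alpha>0$, $c_\beta=0$ when $L_{yy}=0$ (with the convention $0^2/0=0$). Put $$\Delta(x,y)=\frac1{\tau_0}\mathbf D_{\mathcal X}(x,x_0)+\frac1{\sigma_0}\mathbf D_{\mathcal Y}(y,y_0).$$ Then for any $(x,y)\in\mathcal X\times\mathcal Y$ and all $K\ge1$, $$\mathcal L(\bar x_K,y)-\mathcal L(x,\bar y_K)\le\frac1{T_K}\Delta(x,y),\qquad(\ast)$$ where $T_K=\sum_{k=0}^{K-1}t_k$,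 $\bar x_K=\frac1{T_K}\sum_{k=0}^{K-1}t_kx_{k+1}$, $\bar y_K=\frac1{T_K}\sum_{k=0}^{K-1}t_ky_{k+1}$, for positive $\{t_k\}$ as follows. (Part I) Suppose $\mu=0$. Then $\tau_k=\tau_0$, $\sigma_k=\sigma_0$, $\theta_k=1$ for all $k\ge0$, and $(\ast)$ holds with $t_k=1$ for $k\ge0$; hence $T_K=K$. If a saddle point of $\mathcal L$ exists and $\delta>0$, then $\{(x_k,y_k)\}_{k\ge0}$ converges to a saddle point $(x^*,y^* )$ such that $0\le\mathcal L(\bar x_K,y^* )-\mathcal L(x^*,\bar y_K)\le\mathcal O(1/K)$ and $$\gamma_0\mathbf D_{\mathcal X}(x^*,x_K)+[1-(c_\alpha+c_\beta)]\,\mathbf D_{\mathcal Y}(y^*,y_K)\le\sigma_0\Delta(x^*,y^* ).$$ (Part II) Suppose $\mu>0$ and $L_{yy}=0$; in this setting $\|x\|_{\mathcal X}=\sqrt{\langle x,x\rangle}$ and $\mathbf D_{\mathcal X}(x,\bar x)=\frac12\|x-\bar x\|_{\mathcal X}^2$. Then $(\ast)$ holds with $t_k=\sigma_k/\sigma_0$ for $k\ge0$, and $T_K=\Theta(K^2)$. If a saddle point of $\mathcal L$ exists (all saddle points then share the same $x$-coordinate $x^*$), then $\{x_k\}$ converges to $x^*$ and $\{y_k\}$ has a limit point. Moreover, if $\delta>0$, then any limit point $(x^*,y^* )$ of $\{(x_k,y_k)\}$ is a saddle point, and $0\le\mathcal L(\bar x_K,y^* )-\mathcal L(x^*,\bar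 y_K)\le\mathcal O(1/K^2)$ and $$\gamma_K\mathbf D_{\mathcal X}(x^*,x_K)+(1-c_\alpha)\mathbf D_{\mathcal Y}(y^*,y_K)\le\sigma_0\Delta(x^*,y^* )$$ hold with $\gamma_K=\Omega(K^2)$, which implies $\mathbf D_{\mathcal X}(x^*,x_K)=\mathcal O(1/K^2)$.
   Context: Setting. $(\mathcal X,\|\cdot\|_{\mathcal X})$ and $(\mathcal Y,\|\cdot\|_{\mathcal Y})$ are finite-dimensional real normed spaces, with dual norms $\|\cdot\|_{\mathcal X^*},\|\cdot\|_{\mathcal Y^*}$. $\mathcal L(x,y)=f(x)+\Phi(x,y)-h(y)$ with $f:\mathcal X\to\mathbb R\cup\{+\infty\}$, $h:\mathcal Y\to\mathbb R\cup\{+\infty\}$, $\Phi:\mathcal X\times\mathcal Y\to\mathbb R$. A saddle point is $(x^*,y^* )$ with $\mathcal L(x^*,y)\le\mathcal L(x^*,y^* )\le\mathcal L(x,y^* )$ for all $(x,y)\in\mathcal X\times\mathcal Y$. Bregman distances. $\varphi_{\mathcal X}:\mathcal X\to\mathbb R$ and $\varphi_{\mathcal Y}:\mathcal Y\to\mathbb R$ are differentiable on open sets containing $\mathrm{dom} f$ and $\mathrm{dom} h$, have closed domains, and are $1$-strongly convex with respect to $\|\cdot\|_{\mathcal X}$, $\|\cdot\|_{\mathcal Y}$. $\mathbf D_{\mathcal X}(x,\bar x)=\varphi_{\mathcal X}(x)-\varphi_{\mathcal X}(\bar x)-\langle\nabla\varphi_{\mathcal X}(\bar x),x-\bar x\rangle$,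 and $\mathbf D_{\mathcal Y}$ is defined likewise from $\varphi_{\mathcal Y}$. Standing assumptions. $f$ and $h$ are closed convex; $f$ has convexity modulus $\mu\ge0$: $f(x)\ge f(\bar x)+\langle g,x-\bar x\rangle+\frac\mu2\|x-\bar x\|_{\mathcal X}^2$ for all $x,\bar x\in\mathrm{dom} f$, $g\in\partial f(\bar x)$. If $\mu>0$, one fixes $\|x\|_{\mathcal X}=\sqrt{\langle x,x\rangle}$ and $\mathbf D_{\mathcal X}(x,\bar x)=\frac12\|x-\bar x\|_{\mathcal X}^2$. $\Phi$ is continuous and: (i) for any $y\in\mathrm{dom} h$, $\Phi(\cdot,y)$ is convex and differentiable, and for some $L_{xx}\ge0$, $\|\nabla_x\Phi(x,y)-\nabla_x\Phi(\bar x,y)\|_{\mathcal X^*}\le L_{xx}\|x-\bar x\|_{\mathcal X}$ for all $x,\bar x\in\mathrm{dom} f$; (ii) for any $x\in\mathrm{dom} f$, $\Phi(x,\cdot)$ is concave and differentiable, and there exist $L_{yx}>0$, $L_{yy}\ge0$ with $\|\nabla_y\Phi(x,y)-\nabla_y\Phi(\bar x,\bar y)\|_{\mathcal Y^*}\le L_{yy}\|y-\bar y\|_{\mathcal Y}+L_{yx}\|x-\bar x\|_{\mathcal X}$ for all $x,\bar x\in\mathrm{dom} f$, $y,\bar y\in\mathrm{dom} h$. Algorithm APD. Input $\mu$, $\tau_0,\sigma_0>0$, $(x_0,y_0)$. Set $(x_{-1},y_{-1})=(x_0,y_0)$, $\sigma_{-1}=\sigma_0$, $\gamma_0=\sigma_0/\tau_0$.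 For $k=0,1,2,\dots$: set $\sigma_k=\gamma_k\tau_k$, $\theta_k=\sigma_{k-1}/\sigma_k$; $s_k=(1+\theta_k)\nabla_y\Phi(x_k,y_k)-\theta_k\nabla_y\Phi(x_{k-1},y_{k-1})$; $y_{k+1}=\arg\min_{y\in\mathcal Y}\,h(y)-\langle s_k,y\rangle+\frac1{\sigma_k}\mathbf D_{\mathcal Y}(y,y_k)$; $x_{k+1}=\arg\min_{x\in\mathcal X}\,f(x)+\langle\nabla_x\Phi(x_k,y_{k+1}),x\rangle+\frac1{\tau_k}\mathbf D_{\mathcal X}(x,x_k)$; $\gamma_{k+1}=\gamma_k(1+\mu\tau_k)$, $\tau_{k+1}=\tau_k\sqrt{\gamma_k/\gamma_{k+1}}$. Asymptotic notation ($\mathcal O,\Omega,\Theta$) is as $K\to\infty$, with constants independent of $K$; $\Theta$ means both $\mathcal O$ and $\Omega$. *)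

theory Defs
  imports "HOL-Analysis.Analysis" "HOL-Library.Landau_Symbols"
begin

text \<open>
  The norms of the two spaces are the class norms of two types of sort
  \<^class>\<open>real_normed_vector\<close>. The dual space is the type of bounded linear functionals, whose
  norm is the dual norm, and \<open>\<langle>g, x\<rangle>\<close> is \<^term>\<open>blinfun_apply g x\<close>.
  Extended-valued functions take values in \<^typ>\<open>ereal\<close>.
\<close>

definition edom :: "('a \<Rightarrow> ereal) \<Rightarrow> 'a set" where
  "edom f = {x. f x < \<infinity>}"

definition epi :: "('a \<Rightarrow> ereal) \<Rightarrow> ('a \<times> real) set" where
  "epi f = {(x, r). f x \<le> ereal r}"

definition closed_convex_fun :: "('a::real_normed_vector \<Rightarrow> ereal) \<Rightarrow> bool" where
  "closed_convex_fun f \<longleftrightarrow> closed (epi f) \<and> convex (epi f)"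

definition subdiff :: "('a::real_normed_vector \<Rightarrow> ereal) \<Rightarrow> 'a \<Rightarrow> ('a \<Rightarrow>\<^sub>L real) set" where
  "subdiff f xb = {g. \<forall>x. f x \<ge> f xb + ereal (blinfun_apply g (x - xb))}"

definition convexity_modulus :: "('a::real_normed_vector \<Rightarrow> ereal) \<Rightarrow> real \<Rightarrow> bool" where
  "convexity_modulus f \<mu> \<longleftrightarrow>
     (\<forall>x\<in>edom f. \<forall>xb\<in>edom f. \<forall>g\<in>subdiff f xb.
        f x \<ge> f xb + ereal (blinfun_apply g (x - xb)) + ereal (\<mu> / 2 * (norm (x - xb))\<^sup>2))"

text \<open>Only meaningful at points where the function is differentiable.\<close>

definition grad :: "('a::real_normed_vector \<Rightarrow> real) \<Rightarrow> 'a \<Rightarrow> ('a \<Rightarrow>\<^sub>L real)" where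
  "grad F x = Blinfun (frechet_derivative F (at x))"

definition grad_x ::
  "('a::real_normed_vector \<Rightarrow> 'b \<Rightarrow> real) \<Rightarrow> 'a \<Rightarrow> 'b \<Rightarrow> ('a \<Rightarrow>\<^sub>L real)" where
  "grad_x \<Phi> x y = grad (\<lambda>u. \<Phi> u y) x"

definition grad_y ::
  "('a \<Rightarrow> 'b::real_normed_vector \<Rightarrow> real) \<Rightarrow> 'a \<Rightarrow> 'b \<Rightarrow> ('b \<Rightarrow>\<^sub>L real)" where
  "grad_y \<Phi> x y = grad (\<lambda>v. \<Phi> x v) y"

definition strongly_convex_fun :: "real \<Rightarrow> ('a::real_normed_vector \<Rightarrow> ereal) \<Rightarrow> bool" where
  "strongly_convex_fun m \<phi> \<longleftrightarrow>
     (\<forall>x z t. 0 \<le> t \<and> t \<le> 1 \<longrightarrow>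
        \<phi> (t *\<^sub>R x + (1 - t) *\<^sub>R z) + ereal (m / 2 * t * (1 - t) * (norm (x - z))\<^sup>2)
          \<le> ereal t * \<phi> x + ereal (1 - t) * \<phi> z)"

text \<open>
  A distance generating function for a set \<open>S\<close> may be infinite outside a closed domain; an
  everywhere finite one is the special case in which this domain is the whole space.
\<close>

definition distance_generating :: "('a::real_normed_vector \<Rightarrow> ereal) \<Rightarrow> 'a set \<Rightarrow> bool" where
  "distance_generating \<phi> S \<longleftrightarrow>
     (\<forall>x. \<phi> x \<noteq> -\<infinity>) \<and> closed (edom \<phi>) \<and> strongly_convex_fun 1 \<phi> \<and>
     (\<exists>U. open U \<and> S \<subseteq> U \<and> U \<subseteq> edom \<phi> \<and>
          (\<forall>x\<in>U. (\<lambda>u. real_of_ereal (\<phi> u)) differentiable (at x)))"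

definition bregman :: "('a::real_normed_vector \<Rightarrow> ereal) \<Rightarrow> 'a \<Rightarrow> 'a \<Rightarrow> ereal" where
  "bregman \<phi> x xb =
     \<phi> x - \<phi> xb - ereal (blinfun_apply (grad (\<lambda>u. real_of_ereal (\<phi> u)) xb) (x - xb))"

definition inner_product :: "('a::real_vector \<Rightarrow> 'a \<Rightarrow> real) \<Rightarrow> bool" where
  "inner_product ip \<longleftrightarrow>
     bilinear ip \<and> (\<forall>u v. ip u v = ip v u) \<and> (\<forall>u. u \<noteq> 0 \<longrightarrow> 0 < ip u u)"

locale saddle_setting =
  fixes f :: "'a::real_normed_vector \<Rightarrow> ereal"
    and h :: "'b::real_normed_vector \<Rightarrow> ereal"
    and \<Phi> :: "'a \<Rightarrow> 'b \<Rightarrow> real"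
    and \<phi>X :: "'a \<Rightarrow> ereal" and \<phi>Y :: "'b \<Rightarrow> ereal"
    and \<mu> Lxx Lyx Lyy :: real
  assumes finite_dim_X: "\<exists>B::'a set. finite B \<and> span B = UNIV"
    and finite_dim_Y: "\<exists>B::'b set. finite B \<and> span B = UNIV"
    and f_not_MInf: "\<And>x. f x \<noteq> -\<infinity>"
    and h_not_MInf: "\<And>y. h y \<noteq> -\<infinity>"
    and f_closed_convex: "closed_convex_fun f"
    and h_closed_convex: "closed_convex_fun h"
    and phiX: "distance_generating \<phi>X (edom f)"
    and phiY: "distance_generating \<phi>Y (edom h)"
    and mu_nonneg: "\<mu> \<ge> 0"
    and f_modulus: "convexity_modulus f \<mu>"
    and norm_X_if_mu_pos:
      "\<mu> > 0 \<Longrightarrow> \<exists>ip. inner_product ip \<and> (\<forall>x::'a. norm x = sqrt (ip x x))"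
    and bregman_X_if_mu_pos:
      "\<And>x xb. \<mu> > 0 \<Longrightarrow> bregman \<phi>X x xb = ereal ((norm (x - xb))\<^sup>2 / 2)"
    and Phi_continuous: "continuous_on UNIV (\<lambda>(x, y). \<Phi> x y)"
    and Lxx_nonneg: "Lxx \<ge> 0" and Lyx_pos: "Lyx > 0" and Lyy_nonneg: "Lyy \<ge> 0"
    and Phi_x_convex: "\<And>y. y \<in> edom h \<Longrightarrow> convex_on UNIV (\<lambda>x. \<Phi> x y)"
    and Phi_x_diff: "\<And>x y. y \<in> edom h \<Longrightarrow> (\<lambda>u. \<Phi> u y) differentiable (at x)"
    and Phi_x_Lipschitz:
      "\<And>x xb y. \<lbrakk>x \<in> edom f; xb \<in> edom f; y \<in> edom h\<rbrakk> \<Longrightarrow>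
         norm (grad_x \<Phi> x y - grad_x \<Phi> xb y) \<le> Lxx * norm (x - xb)"
    and Phi_y_concave: "\<And>x. x \<in> edom f \<Longrightarrow> concave_on UNIV (\<lambda>y. \<Phi> x y)"
    and Phi_y_diff: "\<And>x y. x \<in> edom f \<Longrightarrow> (\<lambda>v. \<Phi> x v) differentiable (at y)"
    and Phi_y_Lipschitz:
      "\<And>x xb y yb. \<lbrakk>x \<in> edom f; xb \<in> edom f; y \<in> edom h; yb \<in> edom h\<rbrakk> \<Longrightarrow>
         norm (grad_y \<Phi> x y - grad_y \<Phi> xb yb) \<le> Lyy * norm (y - yb) + Lyx * norm (x - xb)"

text \<open>
  Outside \<open>dom f \<times> dom h\<close>, the undefined \<open>\<infinity> - \<infinity>\<close> is \<open>\<infinity>\<close> (the convention of \<^typ>\<open>ereal\<close>). When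
  \<open>dom f\<close> and \<open>dom h\<close> are nonempty, a saddle point necessarily lies in \<open>dom f \<times> dom h\<close>.
\<close>

definition lagrangian ::
  "('a \<Rightarrow> ereal) \<Rightarrow> ('a \<Rightarrow> 'b \<Rightarrow> real) \<Rightarrow> ('b \<Rightarrow> ereal) \<Rightarrow> 'a \<Rightarrow> 'b \<Rightarrow> ereal" where
  "lagrangian f \<Phi> h x y = f x + ereal (\<Phi> x y) - h y"

definition saddle_point :: "('a \<Rightarrow> 'b \<Rightarrow> ereal) \<Rightarrow> 'a \<Rightarrow> 'b \<Rightarrow> bool" where
  "saddle_point L xs ys \<longleftrightarrow> (\<forall>x y. L xs y \<le> L xs ys \<and> L xs ys \<le> L x ys)"

text \<open>
  The initial values are \<open>x 0\<close>, \<open>y 0\<close>, \<open>\<tau> 0\<close> and \<open>\<sigma> 0\<close>. Truncated subtraction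
  \<open>0 - 1 = 0\<close> on \<^typ>\<open>nat\<close> encodes \<open>x\<^sub>-\<^sub>1 = x\<^sub>0\<close>, \<open>y\<^sub>-\<^sub>1 = y\<^sub>0\<close> and \<open>\<sigma>\<^sub>-\<^sub>1 = \<sigma>\<^sub>0\<close>.
\<close>

definition apd_step_sizes ::
  "real \<Rightarrow> (nat \<Rightarrow> real) \<Rightarrow> (nat \<Rightarrow> real) \<Rightarrow> (nat \<Rightarrow> real) \<Rightarrow> (nat \<Rightarrow> real) \<Rightarrow> bool" where
  "apd_step_sizes \<mu> \<tau> \<sigma> \<gamma> \<theta> \<longleftrightarrow>
     \<gamma> 0 = \<sigma> 0 / \<tau> 0 \<and>
     (\<forall>k. \<sigma> k = \<gamma> k * \<tau> k \<and>
          \<theta> k = \<sigma> (k - 1) / \<sigma> k \<and>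
          \<gamma> (Suc k) = \<gamma> k * (1 + \<mu> * \<tau> k) \<and>
          \<tau> (Suc k) = \<tau> k * sqrt (\<gamma> k / \<gamma> (Suc k)))"

definition apd_s ::
  "('a \<Rightarrow> 'b::real_normed_vector \<Rightarrow> real) \<Rightarrow> (nat \<Rightarrow> real) \<Rightarrow> (nat \<Rightarrow> 'a) \<Rightarrow> (nat \<Rightarrow> 'b) \<Rightarrow>
     nat \<Rightarrow> ('b \<Rightarrow>\<^sub>L real)" where
  "apd_s \<Phi> \<theta> x y k =
     (1 + \<theta> k) *\<^sub>R grad_y \<Phi> (x k) (y k) - \<theta> k *\<^sub>R grad_y \<Phi> (x (k - 1)) (y (k - 1))"

definition apd ::
  "('a::real_normed_vector \<Rightarrow> ereal) \<Rightarrow> ('b::real_normed_vector \<Rightarrow> ereal) \<Rightarrow> ('a \<Rightarrow> 'b \<Rightarrow> real) \<Rightarrow>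
     ('a \<Rightarrow> ereal) \<Rightarrow> ('b \<Rightarrow> ereal) \<Rightarrow> real \<Rightarrow>
     (nat \<Rightarrow> real) \<Rightarrow> (nat \<Rightarrow> real) \<Rightarrow> (nat \<Rightarrow> real) \<Rightarrow> (nat \<Rightarrow> real) \<Rightarrow>
     (nat \<Rightarrow> 'a) \<Rightarrow> (nat \<Rightarrow> 'b) \<Rightarrow> bool" where
  "apd f h \<Phi> \<phi>X \<phi>Y \<mu> \<tau> \<sigma> \<gamma> \<theta> x y \<longleftrightarrow>
     apd_step_sizes \<mu> \<tau> \<sigma> \<gamma> \<theta> \<and>
     (\<forall>k. is_arg_min
            (\<lambda>v. h v - ereal (blinfun_apply (apd_s \<Phi> \<theta> x y k) v)
                 + ereal (1 / \<sigma> k) * bregman \<phi>Y v (y k))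
            (\<lambda>_. True) (y (Suc k)) \<and>
          is_arg_min
            (\<lambda>u. f u + ereal (blinfun_apply (grad_x \<Phi> (x k) (y (Suc k))) u)
                 + ereal (1 / \<tau> k) * bregman \<phi>X u (x k))
            (\<lambda>_. True) (x (Suc k)))"

definition weight_sum :: "(nat \<Rightarrow> real) \<Rightarrow> nat \<Rightarrow> real" where
  "weight_sum t K = (\<Sum>k<K. t k)"

definition weighted_avg :: "(nat \<Rightarrow> real) \<Rightarrow> (nat \<Rightarrow> 'a::real_vector) \<Rightarrow> nat \<Rightarrow> 'a" where
  "weighted_avg t z K = (1 / weight_sum t K) *\<^sub>R (\<Sum>k<K. t k *\<^sub>R z (Suc k))"

text \<open>The difference \<open>L(x\<^sub>K, y) - L(x, y\<^sub>K)\<close> at the weighted averages of the iterates.\<close>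

definition gap ::
  "('a::real_vector \<Rightarrow> 'b::real_vector \<Rightarrow> ereal) \<Rightarrow> (nat \<Rightarrow> real) \<Rightarrow> (nat \<Rightarrow> 'a) \<Rightarrow> (nat \<Rightarrow> 'b) \<Rightarrow>
     nat \<Rightarrow> 'a \<Rightarrow> 'b \<Rightarrow> ereal" where
  "gap L t xseq yseq K x y =
     L (weighted_avg t xseq K) y - L x (weighted_avg t yseq K)"

definition initial_dist ::
  "('a::real_normed_vector \<Rightarrow> ereal) \<Rightarrow> ('b::real_normed_vector \<Rightarrow> ereal) \<Rightarrow> real \<Rightarrow> real \<Rightarrow>
     'a \<Rightarrow> 'b \<Rightarrow> 'a \<Rightarrow> 'b \<Rightarrow> ereal" where
  "initial_dist \<phi>X \<phi>Y \<tau>0 \<sigma>0 x0 y0 x y =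
     ereal (1 / \<tau>0) * bregman \<phi>X x x0 + ereal (1 / \<sigma>0) * bregman \<phi>Y y y0"

definition seq_limit_point :: "(nat \<Rightarrow> 'a::topological_space) \<Rightarrow> 'a \<Rightarrow> bool" where
  "seq_limit_point z l \<longleftrightarrow> (\<exists>r. strict_mono r \<and> (z \<circ> r) \<longlonglongrightarrow> l)"

text \<open>The case \<open>L\<^sub>y\<^sub>y = 0\<close> forces \<open>c\<beta> = 0\<close>, where division by zero yields \<open>0\<^sup>2 / 0 = 0\<close>.\<close>

definition step_condition ::
  "real \<Rightarrow> real \<Rightarrow> real \<Rightarrow> real \<Rightarrow> real \<Rightarrow> real \<Rightarrow> real \<Rightarrow> real \<Rightarrow> bool" where
  "step_condition Lxx Lyx Lyy \<tau>0 \<sigma>0 \<delta> c\<alpha> c\<beta> \<longleftrightarrow>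
     \<delta> \<ge> 0 \<and> c\<alpha> \<ge> 0 \<and> c\<beta> \<ge> 0 \<and> c\<alpha> + c\<beta> + \<delta> \<le> 1 \<and>
     (Lyy > 0 \<longrightarrow> c\<alpha> > 0 \<and> c\<beta> > 0) \<and>
     (Lyy = 0 \<longrightarrow> c\<alpha> > 0 \<and> c\<beta> = 0) \<and>
     ((1 - \<delta>) / \<tau>0 - Lxx) * (1 / \<sigma>0) \<ge> Lyx\<^sup>2 / c\<alpha> \<and>
     1 - (\<delta> + c\<alpha> + c\<beta>) \<ge> Lyy\<^sup>2 / c\<beta> * \<sigma>0\<^sup>2"

end

theory Submission
  imports Defs
begin

text \<open>
  The proof compares the run with an arbitrary reference point \<open>(u, v) \<in> dom f \<times> dom h\<close>. Each
  proximal step produces a subgradient of \<open>f\<close> or \<open>h\<close> at the new iterate, and the three-point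
  identity of Bregman distances rewrites its error term as
  \<open>D(u, x\<^sub>k) - D(u, x\<^sub>k\<^sub>+\<^sub>1) - D(x\<^sub>k\<^sub>+\<^sub>1, x\<^sub>k)\<close>. Together with convexity, concavity and the
  Lipschitz gradient of \<open>\<Phi>\<close> in \<open>x\<close> this bounds \<open>L(x\<^sub>k\<^sub>+\<^sub>1, v) - L(u, y\<^sub>k\<^sub>+\<^sub>1)\<close> (\<open>one_step\<close>). The
  price of an explicit step in \<open>y\<close> is the mismatch between \<open>s\<^sub>k\<close> and the gradient at the new
  point. With \<open>q\<^sub>k = \<nabla>\<^sub>y\<Phi>(x\<^sub>k, y\<^sub>k) - \<nabla>\<^sub>y\<Phi>(x\<^sub>k\<^sub>-\<^sub>1, y\<^sub>k\<^sub>-\<^sub>1)\<close> it is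
  \<open>\<langle>q\<^sub>k\<^sub>+\<^sub>1, v - y\<^sub>k\<^sub>+\<^sub>1\<rangle> - \<theta>\<^sub>k \<langle>q\<^sub>k, v - y\<^sub>k\<rangle> + \<theta>\<^sub>k \<langle>q\<^sub>k, y\<^sub>k\<^sub>+\<^sub>1 - y\<^sub>k\<rangle>\<close>.
  The extrapolation weight \<open>\<theta>\<^sub>k\<close> is chosen so that \<open>t\<^sub>k \<theta>\<^sub>k = t\<^sub>k\<^sub>-\<^sub>1\<close> for \<open>t\<^sub>k = \<sigma>\<^sub>k / \<sigma>\<^sub>0\<close>: after
  multiplication with \<open>t\<^sub>k\<close> the first two terms telescope, and Young's inequality splits the third
  into multiples of \<open>\<parallel>x\<^sub>k - x\<^sub>k\<^sub>-\<^sub>1\<parallel>\<^sup>2\<close>, \<open>\<parallel>y\<^sub>k - y\<^sub>k\<^sub>-\<^sub>1\<parallel>\<^sup>2\<close> and \<open>\<parallel>y\<^sub>k\<^sub>+\<^sub>1 - y\<^sub>k\<parallel>\<^sup>2\<close>. The step-size condition,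
  which persists for all \<open>k\<close> because \<open>\<sigma>\<^sub>k \<tau>\<^sub>k\<close> is constant, \<open>\<sigma>\<^sub>k\<close> nondecreasing, and even constant
  unless \<open>Lyy = 0\<close>, says that the
  Bregman terms dominate these with a margin \<open>\<delta>\<close>. Hence an energy \<open>V\<^sub>k(u, v)\<close> satisfies
  \<open>t\<^sub>k (L(x\<^sub>k\<^sub>+\<^sub>1, v) - L(u, y\<^sub>k\<^sub>+\<^sub>1)) + V\<^sub>k\<^sub>+\<^sub>1 + (\<delta> / 2) (squared steps) \<le> V\<^sub>k\<close> (\<open>V_step\<close>). Summing and
  Jensen's inequality give the bound on the ergodic gap, since \<open>V\<^sub>0\<close> is the initial distance.

  At a saddle point the gap terms are nonnegative. So \<open>V\<^sub>k\<close> decreases, which gives the final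
  distance estimates, and for \<open>\<delta> > 0\<close> the squared steps are summable. Then \<open>one_step\<close> can be passed
  to the limit along a convergent subsequence of the iterates (\<open>limit_point_saddle\<close>): lower
  semicontinuity of \<open>f\<close> and \<open>h\<close>, continuity of \<open>\<Phi>\<close>, and continuity of a Bregman distance in its
  second argument suffice, and the limit is a saddle point. Finite dimension is used to extract
  such a subsequence.

  For \<open>\<mu> = 0\<close> the step sizes are constant. Taking the limit point itself as reference point, \<open>V\<^sub>k\<close>
  tends to \<open>0\<close> along the subsequence, hence along the whole sequence by monotonicity, which forces
  convergence of all iterates. For \<open>\<mu> > 0\<close> the recursion reads
  \<open>\<sigma>\<^sub>k\<^sub>+\<^sub>1\<^sup>2 = \<sigma>\<^sub>k\<^sup>2 + \<mu> \<sigma>\<^sub>0 \<tau>\<^sub>0 \<sigma>\<^sub>k\<close>, so \<open>\<sigma>\<^sub>k\<close> grows linearly and both \<open>\<gamma>\<^sub>k = \<sigma>\<^sub>k\<^sup>2 / (\<sigma>\<^sub>0 \<tau>\<^sub>0)\<close> and the sum of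
  the weights grow quadratically; since \<open>\<gamma>\<^sub>k D(x\<^sup>*, x\<^sub>k)\<close> is bounded at every saddle point, \<open>x\<^sub>k\<close>
  converges to \<open>x\<^sup>*\<close>, and \<open>x\<^sup>*\<close> is the same for all saddle points.
\<close>

section \<open>Convergent subsequences in finite dimension\<close>

text \<open>
  Induction on the spanning set. A new vector \<open>b\<close> outside the span of \<open>B\<close> has positive distance from
  that span, because by the induction hypothesis the span is closed. Hence the coefficients of
  \<open>b\<close> in a bounded sequence are bounded, and the remaining components are bounded as well.
\<close>
lemma finite_span_convergent_subsequence:
  fixes z :: "nat \<Rightarrow> 'a::real_normed_vector"
  assumes "finite B" "range z \<subseteq> span B" "bounded (range z)"
  shows "\<exists>l\<in>span B. \<exists>r. strict_mono r \<and> (z \<circ> r) \<longlonglongrightarrow> l"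
  using assms
proof (induction B arbitrary: z rule: finite_induct)
  case empty
  then have "z = (\<lambda>_. 0)" by auto
  then show ?case by (auto intro!: exI[of _ id] simp: strict_mono_def)
next
  case (insert b B)
  show ?case
  proof (cases "b \<in> span B")
    case True
    then show ?thesis using insert.IH[of z] insert.prems by (simp add: span_redundant)
  next
    case False
    have "\<exists>d>0. \<forall>s\<in>span B. d \<le> norm (b - s)"
    proof (rule ccontr)
      assume neg: "\<not> ?thesis"
      have "\<exists>s\<in>span B. norm (b - s) < inverse (real (Suc n))" for n
        using neg by (metis inverse_positive_iff_positive linorder_not_le of_nat_0_less_iff zero_less_Suc)
      then obtain s where s: "\<And>n. s n \<in> span B" "\<And>n. norm (b - s n) < inverse (real (Suc n))"
        by metis
      have "(\<lambda>n. b - s n) \<longlonglongrightarrow> 0"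
        by (rule Lim_null_comparison[OF _ LIMSEQ_inverse_real_of_nat])
           (use s(2) less_imp_le in \<open>auto intro!: always_eventually\<close>)
      then have lim: "s \<longlonglongrightarrow> b"
        using tendsto_diff[OF tendsto_const[of b], of "\<lambda>n. b - s n" 0] by simp
      then have "bounded (range s)" by (rule convergent_imp_bounded)
      moreover have "range s \<subseteq> span B" using s(1) by blast
      ultimately obtain l r where "l \<in> span B" "strict_mono r" "(s \<circ> r) \<longlonglongrightarrow> l"
        using insert.IH[of s] by blast
      moreover have "(s \<circ> r) \<longlonglongrightarrow> b"
        using lim \<open>strict_mono r\<close> by (rule LIMSEQ_subseq_LIMSEQ)
      ultimately show False using False LIMSEQ_unique by blast
    qed
    \<comment> \<open>\<open>z\<^sub>n = s + t\<^sub>n b\<close> with \<open>s\<close> in the span of \<open>B\<close> has norm at least \<open>\<bar>t\<^sub>n\<bar> d\<close>.\<close>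
    then obtain d where d: "d > 0" "\<And>s. s \<in> span B \<Longrightarrow> d \<le> norm (b - s)" by auto
    have "\<exists>k. z n - k *\<^sub>R b \<in> span B" for n
      using insert.prems(1) by (metis rangeI span_breakdown_eq subsetD)
    then obtain t where t: "\<And>n. z n - t n *\<^sub>R b \<in> span B" by metis
    obtain M where M: "\<And>n. norm (z n) \<le> M" using insert.prems(2) by (auto simp: bounded_iff)
    have tb: "\<bar>t n\<bar> \<le> M / d" for n
    proof (cases "t n = 0")
      case True
      then show ?thesis using M[of n] d(1) norm_ge_zero[of "z n"]
        by (simp add: order_trans[OF norm_ge_zero M])
    next
      case nz: False
      have "d \<le> norm (b - (- (1 / t n)) *\<^sub>R (z n - t n *\<^sub>R b))"
        by (rule d(2)) (use t span_scale in blast)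
      also have "b - (- (1 / t n)) *\<^sub>R (z n - t n *\<^sub>R b) = (1 / t n) *\<^sub>R z n"
        using nz by (simp add: algebra_simps)
      finally have "d * \<bar>t n\<bar> \<le> norm (z n)" using nz by (simp add: field_simps)
      then show ?thesis using M[of n] d(1) by (simp add: field_simps)
    qed
    then have "bounded (range t)" by (auto simp: bounded_iff)
    then obtain t0 r1 where r1: "strict_mono r1" "(t \<circ> r1) \<longlonglongrightarrow> t0"
      using bounded_imp_convergent_subsequence by blast
    define s where "s n = z (r1 n) - t (r1 n) *\<^sub>R b" for n
    have "norm (s n) \<le> M + M / d * norm b" for n
    proof -
      have "norm (s n) \<le> norm (z (r1 n)) + \<bar>t (r1 n)\<bar> * norm b"
        unfolding s_def by (metis norm_scaleR norm_triangle_ineq4)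
      then show ?thesis using M[of "r1 n"] mult_right_mono[OF tb[of "r1 n"] norm_ge_zero[of b]]
        by linarith
    qed
    then have "bounded (range s)" by (auto simp: bounded_iff)
    moreover have "range s \<subseteq> span B" using t by (auto simp: s_def)
    ultimately obtain l r2 where r2: "l \<in> span B" "strict_mono r2" "(s \<circ> r2) \<longlonglongrightarrow> l"
      using insert.IH[of s] by blast
    have "(\<lambda>n. (s \<circ> r2) n + ((t \<circ> r1) \<circ> r2) n *\<^sub>R b) \<longlonglongrightarrow> l + t0 *\<^sub>R b"
      by (intro tendsto_intros r2 LIMSEQ_subseq_LIMSEQ[OF r1(2)])
    then have "(z \<circ> (r1 \<circ> r2)) \<longlonglongrightarrow> l + t0 *\<^sub>R b" by (simp add: s_def o_def)
    moreover have "l + t0 *\<^sub>R b \<in> span (insert b B)"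
      by (intro span_add span_scale) (use r2 span_mono[of B "insert b B"] in \<open>auto intro: span_base\<close>)
    ultimately show ?thesis using r1 r2 strict_mono_o by blast
  qed
qed

section \<open>Gradients, convexity and Bregman distances\<close>

lemma tendsto_zero_of_square:
  fixes a :: "nat \<Rightarrow> real"
  assumes "(\<lambda>n. (a n)\<^sup>2) \<longlonglongrightarrow> 0"
  shows "a \<longlonglongrightarrow> 0"
proof -
  have "(\<lambda>n. \<bar>a n\<bar>) \<longlonglongrightarrow> 0" using tendsto_real_sqrt[OF assms] by simp
  then show ?thesis by (simp add: tendsto_rabs_zero_iff)
qed

lemma tendsto_zero_dominated:
  fixes a g :: "nat \<Rightarrow> real"
  assumes "\<And>n. \<bar>a n\<bar> \<le> g n" "g \<longlonglongrightarrow> 0"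
  shows "a \<longlonglongrightarrow> 0"
  using assms(1) by (intro Lim_null_comparison[OF _ assms(2)] always_eventually) simp

lemma norm_le_of_half_square_le:
  fixes z :: "'c::real_normed_vector"
  assumes "(norm z)\<^sup>2 / 2 \<le> c"
  shows "norm z \<le> sqrt (2 * c)"
  using assms by (intro real_le_rsqrt) simp

lemma has_derivative_grad:
  assumes "F differentiable (at z)"
  shows "(F has_derivative blinfun_apply (grad F z)) (at z)"
proof -
  have *: "(F has_derivative frechet_derivative F (at z)) (at z)"
    using assms frechet_derivative_works by blast
  then show ?thesis unfolding grad_def
    by (simp add: bounded_linear_Blinfun_apply has_derivative_bounded_linear)
qed

lemma has_derivative_difference_quotient:
  fixes F :: "'a::real_normed_vector \<Rightarrow> real"
  assumes "(F has_derivative G) (at z)"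
  shows "((\<lambda>t. (F (z + t *\<^sub>R d) - F z) / t) \<longlongrightarrow> G d) (at_right 0)"
proof -
  have "((\<lambda>t. F (z + t *\<^sub>R d)) has_derivative (\<lambda>t. G (t *\<^sub>R d))) (at 0)"
    by (rule has_derivative_compose[where g=F]) (use assms in \<open>auto intro!: derivative_eq_intros\<close>)
  moreover have "(\<lambda>t. G (t *\<^sub>R d)) = (*) (G d)"
    using has_derivative_linear[OF assms] by (auto simp: linear_scale)
  ultimately have "((\<lambda>t. F (z + t *\<^sub>R d)) has_field_derivative G d) (at 0)"
    by (simp add: has_field_derivative_def)
  then show ?thesis
    unfolding has_field_derivative_iff by (auto intro: tendsto_mono[OF at_le])
qed

text \<open>
  The first-order consequences of convexity rest on this fact: convexity, strong convexity and the
  optimality of a proximal point all bound a function along a segment by a linear term plus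
  a quadratic one, and the quadratic one does not affect the derivative.
\<close>
lemma derivative_le_of_quadratic_bound:
  fixes F :: "'a::real_normed_vector \<Rightarrow> real"
  assumes "(F has_derivative G) (at z)"
    and "\<And>t. \<lbrakk>0 < t; t \<le> 1\<rbrakk> \<Longrightarrow> F (z + t *\<^sub>R d) \<le> F z + t * a + t\<^sup>2 * b"
  shows "G d \<le> a"
proof -
  have "((\<lambda>t. (F (z + t *\<^sub>R d) - F z) / t) \<longlongrightarrow> G d) (at_right 0)"
    by (rule has_derivative_difference_quotient[OF assms(1)])
  moreover have "((\<lambda>t. a + t * b) \<longlongrightarrow> a + 0 * b) (at_right 0)"
    by (intro tendsto_intros)
  moreover have "\<forall>\<^sub>F t in at_right 0. (F (z + t *\<^sub>R d) - F z) / t \<le> a + t * b"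
  proof -
    have "(F (z + t *\<^sub>R d) - F z) / t \<le> a + t * b" if "0 < t" "t < 1" for t
      using assms(2)[of t] that by (simp add: field_simps power2_eq_square)
    then show ?thesis using eventually_at_right_real[of 0 1] by (auto elim!: eventually_mono)
  qed
  ultimately show ?thesis
    using tendsto_le[OF trivial_limit_at_right_real] by fastforce
qed

lemma convex_on_grad_le:
  assumes "convex_on S F" "z \<in> S" "u \<in> S" "F differentiable (at z)"
  shows "F z + grad F z (u - z) \<le> F u"
proof -
  have "grad F z (u - z) \<le> F u - F z"
  proof (rule derivative_le_of_quadratic_bound[OF has_derivative_grad[OF assms(4)], where b=0])
    fix t :: real assume t: "0 < t" "t \<le> 1"
    have "F ((1 - t) *\<^sub>R z + t *\<^sub>R u) \<le> (1 - t) * F z + t * F u"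
      using assms t by (intro convex_onD) auto
    then show "F (z + t *\<^sub>R (u - z)) \<le> F z + t * (F u - F z) + t\<^sup>2 * 0"
      by (simp add: algebra_simps)
  qed
  then show ?thesis by simp
qed

text \<open>
  The descent lemma on a convex set. The difference of the two sides, as a function of the position
  on the segment from \<open>z\<close> to \<open>u\<close>, has nonpositive derivative.
\<close>
lemma Lipschitz_grad_quadratic_upper_bound:
  fixes F :: "'a::real_normed_vector \<Rightarrow> real"
  assumes S: "convex S" "z \<in> S" "u \<in> S"
    and diff: "\<And>w. w \<in> S \<Longrightarrow> F differentiable (at w)"
    and Lip: "\<And>w. w \<in> S \<Longrightarrow> norm (grad F w - grad F z) \<le> C * norm (w - z)"
  shows "F u \<le> F z + grad F z (u - z) + C / 2 * (norm (u - z))\<^sup>2"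
proof -
  define d where "d = u - z"
  define \<psi> where "\<psi> t = F (z + t *\<^sub>R d) - t * grad F z d - C / 2 * (norm d)\<^sup>2 * t\<^sup>2" for t
  have "\<psi> 1 \<le> \<psi> 0"
  proof (rule DERIV_nonpos_imp_nonincreasing[of 0 1 \<psi>])
    fix t :: real assume t: "0 \<le> t" "t \<le> 1"
    define w where "w = z + t *\<^sub>R d"
    have w: "w \<in> S" using convexD_alt[OF S t] by (simp add: w_def d_def algebra_simps)
    have "((\<lambda>t. F (z + t *\<^sub>R d)) has_derivative (\<lambda>s. grad F w (s *\<^sub>R d))) (at t)"
      by (rule has_derivative_compose[where g=F])
         (use has_derivative_grad[OF diff[OF w]] in \<open>auto intro!: derivative_eq_intros simp: w_def\<close>)
    moreover have "(\<lambda>s. grad F w (s *\<^sub>R d)) = (*) (grad F w d)" by (auto simp: blinfun.scaleR_right)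
    ultimately have "((\<lambda>t. F (z + t *\<^sub>R d)) has_field_derivative grad F w d) (at t)"
      by (simp add: has_field_derivative_def)
    then have "(\<psi> has_field_derivative (grad F w d - grad F z d - C * (norm d)\<^sup>2 * t)) (at t)"
      unfolding \<psi>_def by (auto intro!: derivative_eq_intros)
    moreover have "grad F w d - grad F z d \<le> C * (norm d)\<^sup>2 * t"
    proof -
      have "(grad F w - grad F z) d \<le> norm (grad F w - grad F z) * norm d"
        using norm_blinfun[of "grad F w - grad F z" d] by auto
      also have "\<dots> \<le> (C * norm (w - z)) * norm d" by (intro mult_right_mono Lip w) auto
      also have "\<dots> = C * (norm d)\<^sup>2 * t" using t by (simp add: w_def power2_eq_square)
      finally show ?thesis by (simp add: blinfun.diff_left)
    qed
    ultimately show "\<exists>D. (\<psi> has_real_derivative D) (at t) \<and> D \<le> 0" by (intro exI conjI) auto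
  qed simp
  then show ?thesis by (simp add: \<psi>_def d_def)
qed

text \<open>
  Between points at which \<open>\<phi>\<close> is finite, \<open>bregman \<phi>\<close> takes the value of \<open>breg\<close> at the real part of \<open>\<phi>\<close>.
\<close>
definition breg :: "('a::real_normed_vector \<Rightarrow> real) \<Rightarrow> 'a \<Rightarrow> 'a \<Rightarrow> real" where
  "breg F u z = F u - F z - grad F z (u - z)"

lemma breg_three_point:
  "breg F u z - breg F u p - breg F p z = (grad F p - grad F z) (u - p)"
  by (simp add: breg_def blinfun.diff_left blinfun.diff_right)

text \<open>
  The gradient of a differentiable convex function is continuous in the following weak sense,
  which holds in any normed space. For a fixed direction \<open>e\<close>, the derivative at \<open>w\<^sub>n\<close> is at most
  a difference quotient with fixed increment \<open>s\<close>, which converges as \<open>n \<rightarrow> \<infinity>\<close> and is close to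
  the derivative at \<open>z\<close> if \<open>s\<close> is small; the direction \<open>- e\<close> gives the lower bound. The
  increment \<open>z - w\<^sub>n\<close> tends to zero, and it is harmless because the gradients near \<open>z\<close> are bounded.
\<close>
lemma tendsto_breg:
  fixes F :: "'a::real_normed_vector \<Rightarrow> real"
  assumes cvx: "convex_on S F" and U: "open U" "U \<subseteq> S"
    and diff: "\<And>w. w \<in> U \<Longrightarrow> F differentiable (at w)"
    and z: "z \<in> U" and lim: "w \<longlonglongrightarrow> z"
  shows "(\<lambda>n. breg F u (w n)) \<longlonglongrightarrow> breg F u z"
proof -
  have wU: "\<forall>\<^sub>F n in sequentially. w n \<in> U" using lim U(1) z by (rule topological_tendstoD)
  have cont: "isCont F v" if "v \<in> U" for v
    using differentiable_imp_continuous_within[OF diff[OF that]] by simp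
  have Fw: "(\<lambda>n. F (w n)) \<longlonglongrightarrow> F z" using isCont_tendsto_compose[OF cont[OF z] lim] .
  have secant: "grad F v e \<le> (F (v + s *\<^sub>R e) - F v) / s"
    if "s > 0" "v \<in> U" "v + s *\<^sub>R e \<in> U" for v e s
    using convex_on_grad_le[OF cvx, of v "v + s *\<^sub>R e"] that U diff
    by (auto simp: blinfun.scaleR_right field_simps)
  have small: "\<forall>\<^sub>F s in at_right 0. z + s *\<^sub>R e \<in> U" for e
  proof -
    have "((\<lambda>s. z + s *\<^sub>R e) \<longlongrightarrow> z + 0 *\<^sub>R e) (at_right 0)" by (intro tendsto_intros)
    then show ?thesis using U(1) z by (auto dest: topological_tendstoD)
  qed
  have upper: "\<forall>\<^sub>F n in sequentially. grad F (w n) e < grad F z e + \<epsilon>" if "\<epsilon> > 0" for e \<epsilon>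
  proof -
    have "((\<lambda>s. (F (z + s *\<^sub>R e) - F z) / s) \<longlongrightarrow> grad F z e) (at_right 0)"
      by (rule has_derivative_difference_quotient[OF has_derivative_grad[OF diff[OF z]]])
    then have "\<forall>\<^sub>F s in at_right 0. (F (z + s *\<^sub>R e) - F z) / s < grad F z e + \<epsilon>"
      by (rule order_tendstoD) (use that in simp)
    with small[of e] have "\<forall>\<^sub>F s in at_right (0::real). z + s *\<^sub>R e \<in> U
        \<and> (F (z + s *\<^sub>R e) - F z) / s < grad F z e + \<epsilon> \<and> 0 < s"
      by (intro eventually_conj eventually_at_right_less)
    then obtain s where s: "0 < s" "z + s *\<^sub>R e \<in> U" "(F (z + s *\<^sub>R e) - F z) / s < grad F z e + \<epsilon>"
      using eventually_happens'[OF trivial_limit_at_right_real[of 0]] by blast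
    have lim': "(\<lambda>n. w n + s *\<^sub>R e) \<longlonglongrightarrow> z + s *\<^sub>R e" by (intro tendsto_intros lim)
    have "(\<lambda>n. (F (w n + s *\<^sub>R e) - F (w n)) / s) \<longlonglongrightarrow> (F (z + s *\<^sub>R e) - F z) / s"
      using s(1) by (intro tendsto_intros Fw isCont_tendsto_compose[OF cont[OF s(2)] lim']) auto
    then have "\<forall>\<^sub>F n in sequentially. (F (w n + s *\<^sub>R e) - F (w n)) / s < grad F z e + \<epsilon>"
      using s(3) by (rule order_tendstoD)
    moreover have "\<forall>\<^sub>F n in sequentially. w n + s *\<^sub>R e \<in> U"
      using lim' U(1) s(2) by (rule topological_tendstoD)
    ultimately show ?thesis using wU
      by eventually_elim (use secant[OF s(1)] in fastforce)
  qed
  have pointwise: "(\<lambda>n. grad F (w n) e) \<longlonglongrightarrow> grad F z e" for e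
  proof (rule order_tendstoI)
    fix a assume "a < grad F z e"
    then show "\<forall>\<^sub>F n in sequentially. a < grad F (w n) e"
      using upper[of "grad F z e - a" "- e"] by (simp add: blinfun.minus_right)
  next
    fix a assume "grad F z e < a"
    then show "\<forall>\<^sub>F n in sequentially. grad F (w n) e < a"
      using upper[of "a - grad F z e" e] by simp
  qed
  \<comment> \<open>On a ball where \<open>F\<close> varies by at most \<open>2\<close>, gradients in the half ball have norm at most \<open>4 / r\<close>.\<close>
  obtain r where r: "r > 0" "cball z r \<subseteq> U" "\<And>v. v \<in> cball z r \<Longrightarrow> \<bar>F v - F z\<bar> < 1"
  proof -
    obtain r1 where r1: "r1 > 0" "cball z r1 \<subseteq> U" using U(1) z open_contains_cball by blast
    obtain r2 where r2: "r2 > 0" "\<And>v. dist v z < r2 \<Longrightarrow> dist (F v) (F z) < 1"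
      using cont[OF z] unfolding continuous_at_eps_delta by (metis zero_less_one)
    show ?thesis
    proof (rule that[of "min r1 (r2 / 2)"])
      show "min r1 (r2 / 2) > 0" using r1 r2 by simp
      show "cball z (min r1 (r2 / 2)) \<subseteq> U" using r1 by auto
      show "\<bar>F v - F z\<bar> < 1" if "v \<in> cball z (min r1 (r2 / 2))" for v
        using r2(2)[of v] that r2(1) by (auto simp: dist_commute dist_real_def)
    qed
  qed
  have bound: "\<bar>grad F v e\<bar> \<le> 4 / r * norm e" if v: "v \<in> cball z (r / 2)" for v e
  proof (cases "e = 0")
    case False
    have le: "grad F v e' \<le> 4 / r * norm e'" if "e' \<noteq> 0" for e'
    proof -
      define s where "s = r / 2 / norm e'"
      have s: "s > 0" "s * norm e' = r / 2" using r(1) that by (auto simp: s_def)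
      have "dist z (v + s *\<^sub>R e') \<le> dist z v + norm (s *\<^sub>R e')"
        by (metis add_diff_cancel_left' dist_commute dist_norm dist_triangle)
      then have in1: "v + s *\<^sub>R e' \<in> cball z r" using s v by auto
      have in2: "v \<in> cball z r" using v r(1) by auto
      have "grad F v e' \<le> (F (v + s *\<^sub>R e') - F v) / s"
        using secant s(1) in1 in2 r(2) by blast
      also have "\<dots> \<le> 2 / s"
        using r(3)[OF in1] r(3)[OF in2] s(1) by (intro divide_right_mono) auto
      also have "2 / s = 4 / r * norm e'" using that by (simp add: s_def)
      finally show ?thesis .
    qed
    show ?thesis using le[of e] le[of "- e"] False by (auto simp: blinfun.minus_right)
  qed simp
  have wz: "(\<lambda>n. z - w n) \<longlonglongrightarrow> 0" using tendsto_diff[OF tendsto_const lim, of z] by simp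
  have "(\<lambda>n. grad F (w n) (z - w n)) \<longlonglongrightarrow> 0"
  proof (rule Lim_null_comparison)
    have "\<forall>\<^sub>F n in sequentially. w n \<in> ball z (r / 2)"
      using lim r(1) by (intro topological_tendstoD) auto
    then show "\<forall>\<^sub>F n in sequentially. norm (grad F (w n) (z - w n)) \<le> 4 / r * norm (z - w n)"
      by eventually_elim (use bound in auto)
    show "(\<lambda>n. 4 / r * norm (z - w n)) \<longlonglongrightarrow> 0"
      using tendsto_mult_right_zero[OF tendsto_norm_zero[OF wz]] .
  qed
  then have "(\<lambda>n. F u - F (w n) - (grad F (w n) (u - z) + grad F (w n) (z - w n)))
      \<longlonglongrightarrow> F u - F z - (grad F z (u - z) + 0)"
    by (intro tendsto_intros Fw pointwise)
  then show ?thesis by (simp add: breg_def blinfun.diff_right)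
qed

section \<open>Extended-valued functions and proximal steps\<close>
lemma closed_epi_eventually_greater:
  assumes "closed (epi f)" "x \<longlonglongrightarrow> l" "ereal a < f l"
  shows "\<forall>\<^sub>F n in sequentially. ereal a < f (x n)"
proof -
  have "(\<lambda>n. (x n, a)) \<longlonglongrightarrow> (l, a)" by (intro tendsto_intros assms)
  moreover have "open (- epi f)" "(l, a) \<in> - epi f" using assms by (auto simp: epi_def)
  ultimately have "\<forall>\<^sub>F n in sequentially. (x n, a) \<in> - epi f" by (rule topological_tendstoD)
  then show ?thesis by (simp add: epi_def not_le)
qed

text \<open>
  Joint lower semicontinuity of \<open>(x, y) \<mapsto> f x + h y\<close>. The limit value may be \<open>\<infinity>\<close> beforehand: with a
  bounded right-hand side the conclusion shows that the limit point lies in both domains.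
\<close>
lemma closed_epi_add_le_limit:
  assumes "closed (epi f)" "closed (epi h)" "x \<longlonglongrightarrow> l" "y \<longlonglongrightarrow> m" "c \<longlonglongrightarrow> c0"
    and nm: "f l \<noteq> -\<infinity>" "h m \<noteq> -\<infinity>"
    and le: "\<And>n. f (x n) + h (y n) \<le> ereal (c n)"
  shows "f l + h m \<le> ereal c0"
proof (rule ccontr)
  assume "\<not> ?thesis"
  then have gt: "ereal c0 < f l + h m" by simp
  have "\<exists>p q. ereal p < f l \<and> ereal q < h m \<and> c0 < p + q"
  proof (cases "f l")
    case (real r)
    show ?thesis
    proof (cases "h m")
      case (real s)
      then show ?thesis using gt \<open>f l = ereal r\<close>
        by (intro exI[of _ "r - (r + s - c0) / 4"] exI[of _ "s - (r + s - c0) / 4"])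
           (auto simp: field_simps)
    next
      case PInf
      then show ?thesis using real by (intro exI[of _ "r - 1"] exI[of _ "c0 - r + 2"]) auto
    qed (use nm in auto)
  next
    case PInf
    show ?thesis
    proof (cases "h m")
      case (real s)
      then show ?thesis using PInf by (intro exI[of _ "c0 - s + 2"] exI[of _ "s - 1"]) auto
    next
      case hP: PInf
      then show ?thesis using PInf by (intro exI[of _ "c0 + 1"] exI[of _ 0]) auto
    qed (use nm in auto)
  qed (use nm in auto)
  then obtain p q where pq: "ereal p < f l" "ereal q < h m" "c0 < p + q" by blast
  have "\<forall>\<^sub>F n in sequentially. c n < p + q" using assms(5) pq(3) by (rule order_tendstoD)
  moreover have "\<forall>\<^sub>F n in sequentially. ereal p < f (x n)"
    using assms(1,3) pq(1) by (rule closed_epi_eventually_greater)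
  moreover have "\<forall>\<^sub>F n in sequentially. ereal q < h (y n)"
    using assms(2,4) pq(2) by (rule closed_epi_eventually_greater)
  ultimately have "\<forall>\<^sub>F n in sequentially. False"
  proof eventually_elim
    case (elim n)
    have "ereal p + ereal q < f (x n) + h (y n)"
      using elim(2,3) by (rule ereal_add_strict_mono2)
    also have "\<dots> \<le> ereal (c n)" by (rule le)
    finally show False using elim(1) by simp
  qed
  then show False by simp
qed

lemma edom_ereal:
  assumes "u \<in> edom f" "f u \<noteq> -\<infinity>"
  shows "f u = ereal (real_of_ereal (f u))"
  using assms by (cases "f u") (auto simp: edom_def)

lemma closed_convex_fun_convex_on:
  assumes "closed_convex_fun f" "\<And>u. f u \<noteq> -\<infinity>"
  shows "convex_on (edom f) (\<lambda>u. real_of_ereal (f u))"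
proof -
  have *: "f ((1 - t) *\<^sub>R u + t *\<^sub>R v)
      \<le> ereal ((1 - t) * real_of_ereal (f u) + t * real_of_ereal (f v))"
    if "u \<in> edom f" "v \<in> edom f" "0 \<le> t" "t \<le> 1" for u v t
  proof -
    have "(u, real_of_ereal (f u)) \<in> epi f" "(v, real_of_ereal (f v)) \<in> epi f"
      using that assms(2) edom_ereal[of _ f] by (auto simp: epi_def)
    then have "(1 - t) *\<^sub>R (u, real_of_ereal (f u)) + t *\<^sub>R (v, real_of_ereal (f v)) \<in> epi f"
      using assms(1) that by (intro convexD_alt) (auto simp: closed_convex_fun_def)
    then show ?thesis by (simp add: epi_def)
  qed
  have in_dom: "(1 - t) *\<^sub>R u + t *\<^sub>R v \<in> edom f"
    if "u \<in> edom f" "v \<in> edom f" "0 \<le> t" "t \<le> 1" for u v t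
    using *[OF that] by (auto simp: edom_def intro: le_less_trans)
  show ?thesis
  proof (rule convex_onI)
    show "convex (edom f)" using in_dom by (auto simp: convex_alt)
    show "real_of_ereal (f ((1 - t) *\<^sub>R u + t *\<^sub>R v))
        \<le> (1 - t) * real_of_ereal (f u) + t * real_of_ereal (f v)"
      if "0 < t" "t < 1" "u \<in> edom f" "v \<in> edom f" for t u v
      using *[of u v t] that assms(2)[of "(1 - t) *\<^sub>R u + t *\<^sub>R v"]
      by (cases "f ((1 - t) *\<^sub>R u + t *\<^sub>R v)") auto
  qed
qed

context
  fixes \<phi> :: "'a::real_normed_vector \<Rightarrow> ereal" and S :: "'a set" and \<phi>r :: "'a \<Rightarrow> real"
  assumes dg: "distance_generating \<phi> S"
  defines "\<phi>r \<equiv> (\<lambda>u. real_of_ereal (\<phi> u))"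
begin

lemma distance_generating_domain: "S \<subseteq> edom \<phi>"
  using dg unfolding distance_generating_def by blast

lemma distance_generating_differentiable: "z \<in> S \<Longrightarrow> \<phi>r differentiable (at z)"
  using dg unfolding distance_generating_def \<phi>r_def by blast

lemma distance_generating_finite: "u \<in> edom \<phi> \<Longrightarrow> \<phi> u = ereal (\<phi>r u)"
  using dg edom_ereal[of u \<phi>] unfolding distance_generating_def \<phi>r_def by blast

lemma distance_generating_strongly_convex:
  assumes "u \<in> edom \<phi>" "v \<in> edom \<phi>" "0 \<le> t" "t \<le> 1"
  shows "t *\<^sub>R u + (1 - t) *\<^sub>R v \<in> edom \<phi>"
    and "\<phi>r (t *\<^sub>R u + (1 - t) *\<^sub>R v) + 1 / 2 * t * (1 - t) * (norm (u - v))\<^sup>2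
      \<le> t * \<phi>r u + (1 - t) * \<phi>r v"
proof -
  have "\<phi> (t *\<^sub>R u + (1 - t) *\<^sub>R v) + ereal (1 / 2 * t * (1 - t) * (norm (u - v))\<^sup>2)
      \<le> ereal t * \<phi> u + ereal (1 - t) * \<phi> v"
    using dg assms unfolding distance_generating_def strongly_convex_fun_def by blast
  also have "\<dots> = ereal (t * \<phi>r u + (1 - t) * \<phi>r v)"
    using assms by (simp add: distance_generating_finite)
  finally have *: "\<phi> (t *\<^sub>R u + (1 - t) *\<^sub>R v) + ereal (1 / 2 * t * (1 - t) * (norm (u - v))\<^sup>2)
      \<le> ereal (t * \<phi>r u + (1 - t) * \<phi>r v)" .
  then show dom: "t *\<^sub>R u + (1 - t) *\<^sub>R v \<in> edom \<phi>" by (auto simp: edom_def)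
  show "\<phi>r (t *\<^sub>R u + (1 - t) *\<^sub>R v) + 1 / 2 * t * (1 - t) * (norm (u - v))\<^sup>2
      \<le> t * \<phi>r u + (1 - t) * \<phi>r v"
    using * unfolding distance_generating_finite[OF dom] by simp
qed

lemma distance_generating_convex_on: "convex_on (edom \<phi>) \<phi>r"
proof (rule convex_onI)
  have "(1 - t) *\<^sub>R u + t *\<^sub>R v \<in> edom \<phi>" if "u \<in> edom \<phi>" "v \<in> edom \<phi>" "0 \<le> t" "t \<le> 1" for u v t
    using distance_generating_strongly_convex(1)[of v u t] that by (simp add: add.commute)
  then show "convex (edom \<phi>)" by (simp add: convex_alt)
  show "\<phi>r ((1 - t) *\<^sub>R u + t *\<^sub>R v) \<le> (1 - t) * \<phi>r u + t * \<phi>r v"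
    if "0 < t" "t < 1" "u \<in> edom \<phi>" "v \<in> edom \<phi>" for t u v
  proof -
    have "0 \<le> t * (1 - t) * (norm (v - u))\<^sup>2 / 2" using that by simp
    moreover have "\<phi>r (t *\<^sub>R v + (1 - t) *\<^sub>R u) + t * (1 - t) * (norm (v - u))\<^sup>2 / 2
        \<le> t * \<phi>r v + (1 - t) * \<phi>r u"
      using distance_generating_strongly_convex(2)[of v u t] that by simp
    ultimately have "\<phi>r (t *\<^sub>R v + (1 - t) *\<^sub>R u) \<le> t * \<phi>r v + (1 - t) * \<phi>r u"
      by linarith
    then show ?thesis by (simp add: add.commute)
  qed
qed

lemma bregman_eq_breg:
  assumes "u \<in> edom \<phi>" "z \<in> S"
  shows "bregman \<phi> u z = ereal (breg \<phi>r u z)"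
proof -
  have "z \<in> edom \<phi>" using assms(2) distance_generating_domain by blast
  then show ?thesis
    using assms(1) unfolding bregman_def breg_def
    by (simp add: distance_generating_finite \<phi>r_def[symmetric])
qed

lemma bregman_eq_PInf:
  assumes "u \<notin> edom \<phi>" "z \<in> S"
  shows "bregman \<phi> u z = \<infinity>"
proof -
  have "z \<in> edom \<phi>" using assms(2) distance_generating_domain by blast
  moreover have "\<phi> u = \<infinity>" using assms(1) by (simp add: edom_def)
  ultimately show ?thesis unfolding bregman_def by (simp add: distance_generating_finite)
qed

text \<open>
  Strong convexity along the segment from \<open>z\<close> to \<open>u\<close>, divided by the parameter, yields this bound as
  the parameter tends to zero.
\<close>
lemma breg_ge_norm:
  assumes "u \<in> edom \<phi>" "z \<in> S"
  shows "(norm (u - z))\<^sup>2 / 2 \<le> breg \<phi>r u z"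
proof -
  have z: "z \<in> edom \<phi>" using assms(2) distance_generating_domain by blast
  have "grad \<phi>r z (u - z) \<le> \<phi>r u - \<phi>r z - (norm (u - z))\<^sup>2 / 2"
  proof (rule derivative_le_of_quadratic_bound
      [OF has_derivative_grad[OF distance_generating_differentiable[OF assms(2)]],
        where b = "(norm (u - z))\<^sup>2 / 2"])
    fix t :: real assume t: "0 < t" "t \<le> 1"
    show "\<phi>r (z + t *\<^sub>R (u - z))
        \<le> \<phi>r z + t * (\<phi>r u - \<phi>r z - (norm (u - z))\<^sup>2 / 2) + t\<^sup>2 * ((norm (u - z))\<^sup>2 / 2)"
      using distance_generating_strongly_convex(2)[OF assms(1) z, of t] t
      by (simp add: algebra_simps power2_eq_square diff_divide_distrib)
  qed
  then show ?thesis by (simp add: breg_def)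
qed

lemma tendsto_bregman_real:
  assumes "z \<in> S" "w \<longlonglongrightarrow> z"
  shows "(\<lambda>n. breg \<phi>r u (w n)) \<longlonglongrightarrow> breg \<phi>r u z"
proof -
  obtain U where "open U" "S \<subseteq> U" "U \<subseteq> edom \<phi>" "\<And>v. v \<in> U \<Longrightarrow> \<phi>r differentiable (at v)"
    using dg unfolding distance_generating_def \<phi>r_def by blast
  then show ?thesis
    using assms by (intro tendsto_breg[OF distance_generating_convex_on, of U]) auto
qed

end

text \<open>
  First-order optimality of a Bregman proximal step. Comparing the minimiser \<open>p\<close> with points
  \<open>p + t (u - p)\<close> bounds the differentiable part \<open>c \<phi>\<close> from below in terms of the chord of \<open>g\<close>; the limit
  \<open>t \<rightarrow> 0\<close> turns this into a subgradient inequality for \<open>g\<close> alone.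
\<close>
lemma bregman_prox_subgradient:
  fixes g :: "'a::real_normed_vector \<Rightarrow> ereal" and \<phi> :: "'a \<Rightarrow> ereal"
  defines "gr \<equiv> (\<lambda>u. real_of_ereal (g u))" and "\<phi>r \<equiv> (\<lambda>u. real_of_ereal (\<phi> u))"
  assumes g: "closed_convex_fun g" "\<And>u. g u \<noteq> -\<infinity>"
    and dg: "distance_generating \<phi> (edom g)" and z: "z \<in> edom g" and c: "c > 0"
    and p: "is_arg_min (\<lambda>v. g v + ereal (blinfun_apply l v) + ereal c * bregman \<phi> v z) (\<lambda>_. True) p"
  shows "p \<in> edom g"
    and "- (l + c *\<^sub>R (grad \<phi>r p - grad \<phi>r z)) \<in> subdiff g p"
proof -
  define J where "J v = gr v + l v + c * breg \<phi>r v z" for v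
  have gfin: "g v = ereal (gr v)" if "v \<in> edom g" for v
    using edom_ereal[OF that g(2)] by (simp add: gr_def)
  have dom: "edom g \<subseteq> edom \<phi>" by (rule distance_generating_domain[OF dg])
  have obj: "g v + ereal (l v) + ereal c * bregman \<phi> v z = ereal (J v)" if "v \<in> edom g" for v
    using that dom bregman_eq_breg[OF dg, of v z] z by (auto simp: gfin J_def \<phi>r_def)
  have min: "g p + ereal (l p) + ereal c * bregman \<phi> p z
      \<le> g v + ereal (l v) + ereal c * bregman \<phi> v z" for v
    using p by (auto simp: is_arg_min_def not_less)
  show p_dom: "p \<in> edom g"
  proof (rule ccontr)
    assume "p \<notin> edom g"
    then have "g p = \<infinity>" by (simp add: edom_def)
    moreover have "bregman \<phi> p z \<noteq> -\<infinity>"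
      by (cases "p \<in> edom \<phi>") (use bregman_eq_breg[OF dg _ z] bregman_eq_PInf[OF dg _ z] in auto)
    ultimately have inf: "g p + ereal (l p) + ereal c * bregman \<phi> p z = \<infinity>"
      using c by (cases "bregman \<phi> p z") auto
    show False using min[of z] unfolding inf obj[OF z] by simp
  qed
  have J_min: "J p \<le> J v" if "v \<in> edom g" for v
    using min[of v] obj[OF that] obj[OF p_dom] by simp
  have cvx: "convex_on (edom g) gr"
    unfolding gr_def by (rule closed_convex_fun_convex_on[OF g])
  have "gr p - (l + c *\<^sub>R (grad \<phi>r p - grad \<phi>r z)) (u - p) \<le> gr u" if u: "u \<in> edom g" for u
  proof -
    define d where "d = u - p"
    have "((\<lambda>v. - (c * \<phi>r v)) has_derivative (\<lambda>v. - (c * grad \<phi>r p v))) (at p)"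
      using distance_generating_differentiable[OF dg p_dom]
      by (intro derivative_intros has_derivative_grad) (simp add: \<phi>r_def)
    then have "- (c * grad \<phi>r p d) \<le> gr u - gr p + l d - c * grad \<phi>r z d"
    proof (rule derivative_le_of_quadratic_bound[where b = 0])
      fix t :: real assume t: "0 < t" "t \<le> 1"
      have "gr ((1 - t) *\<^sub>R p + t *\<^sub>R u) \<le> (1 - t) * gr p + t * gr u"
        using cvx p_dom u t by (intro convex_onD) auto
      moreover have "(1 - t) *\<^sub>R p + t *\<^sub>R u = p + t *\<^sub>R d" by (simp add: d_def algebra_simps)
      ultimately have "gr (p + t *\<^sub>R d) \<le> gr p + t * (gr u - gr p)" by (simp add: algebra_simps)
      moreover have "J p \<le> J (p + t *\<^sub>R d)"
      proof (rule J_min)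
        have "convex (edom g)" using cvx by (simp add: convex_on_def)
        from convexD_alt[OF this p_dom u, of t] t show "p + t *\<^sub>R d \<in> edom g"
          by (simp add: d_def algebra_simps)
      qed
      ultimately show "- (c * \<phi>r (p + t *\<^sub>R d))
          \<le> - (c * \<phi>r p) + t * (gr u - gr p + l d - c * grad \<phi>r z d) + t\<^sup>2 * 0"
        by (simp add: J_def breg_def blinfun.add_right blinfun.diff_right blinfun.scaleR_right
            algebra_simps)
    qed
    then show ?thesis
      by (simp add: d_def blinfun.add_left blinfun.diff_left blinfun.scaleR_left algebra_simps)
  qed
  then show "- (l + c *\<^sub>R (grad \<phi>r p - grad \<phi>r z)) \<in> subdiff g p"
    unfolding subdiff_def
  proof safe
    fix u
    assume *: "\<And>u. u \<in> edom g \<Longrightarrow> gr p - (l + c *\<^sub>R (grad \<phi>r p - grad \<phi>r z)) (u - p) \<le> gr u"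
    show "g p + ereal ((- (l + c *\<^sub>R (grad \<phi>r p - grad \<phi>r z))) (u - p)) \<le> g u"
      by (cases "u \<in> edom g")
         (use *[of u] gfin[OF p_dom] gfin[of u] in \<open>auto simp: blinfun.minus_left blinfun.diff_left
           blinfun.add_left edom_def\<close>)
  qed
qed

text \<open>
  The convention \<open>0 / 0 = 0\<close> makes this inequality cover \<open>L = c = 0\<close>, where both sides vanish.
\<close>
lemma Young_weighted:
  fixes L c s a b :: real
  assumes "L = 0 \<or> c > 0" "c \<ge> 0" "s > 0"
  shows "L * a * b \<le> (L\<^sup>2 * s / c) / 2 * a\<^sup>2 + (c / s) / 2 * b\<^sup>2"
proof (cases "L = 0")
  case True
  then show ?thesis using assms by simp
next
  case False
  then have c: "c > 0" using assms by simp
  have "0 \<le> (L * s * a - c * b)\<^sup>2 / (2 * c * s)" using c assms by simp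
  also have "\<dots> = (L\<^sup>2 * s / c) / 2 * a\<^sup>2 + (c / s) / 2 * b\<^sup>2 - L * a * b"
    using c assms by (simp add: power2_eq_square field_simps)
  finally show ?thesis by simp
qed

lemma weighted_avg_Jensen:
  fixes z :: "nat \<Rightarrow> 'a::real_vector"
  assumes F: "convex_on S F" and z: "\<And>k. z (Suc k) \<in> S" and t: "\<And>k. t k > 0" and K: "K \<ge> 1"
  shows "weighted_avg t z K \<in> S"
    and "weight_sum t K * F (weighted_avg t z K) \<le> (\<Sum>k<K. t k * F (z (Suc k)))"
proof -
  have T: "weight_sum t K > 0"
    unfolding weight_sum_def using t K by (intro sum_pos) (auto simp: lessThan_empty_iff)
  define a where "a k = t k / weight_sum t K" for k
  have a: "sum a {..<K} = 1" "\<And>k. a k \<ge> 0"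
    using T t less_imp_le[OF t] by (auto simp: a_def sum_divide_distrib[symmetric] weight_sum_def)
  have ne: "{..<K} \<noteq> {}" using K by (auto simp: lessThan_empty_iff)
  have avg: "weighted_avg t z K = (\<Sum>k<K. a k *\<^sub>R z (Suc k))"
    by (simp add: weighted_avg_def a_def scaleR_sum_right)
  have "convex S" using F by (simp add: convex_on_def)
  then show "weighted_avg t z K \<in> S"
    unfolding avg using a z by (intro convex_sum) auto
  have "F (weighted_avg t z K) \<le> (\<Sum>k<K. a k * F (z (Suc k)))"
    unfolding avg using a z ne by (intro convex_on_sum[OF _ _ F]) auto
  also have "\<dots> = (\<Sum>k<K. t k * F (z (Suc k))) / weight_sum t K"
    by (simp add: a_def sum_divide_distrib)
  finally show "weight_sum t K * F (weighted_avg t z K) \<le> (\<Sum>k<K. t k * F (z (Suc k)))"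
    using T by (simp add: field_simps)
qed

section \<open>Step sizes\<close>

locale step_sizes =
  fixes \<mu> :: real and \<tau> \<sigma> \<gamma> \<theta> :: "nat \<Rightarrow> real"
  assumes step_sizes: "apd_step_sizes \<mu> \<tau> \<sigma> \<gamma> \<theta>"
    and mu_ge_0: "\<mu> \<ge> 0" and tau0: "\<tau> 0 > 0" and sigma0: "\<sigma> 0 > 0"
begin

lemma sigma_eq: "\<sigma> k = \<gamma> k * \<tau> k"
  and theta_eq: "\<theta> k = \<sigma> (k - 1) / \<sigma> k"
  and gamma_Suc: "\<gamma> (Suc k) = \<gamma> k * (1 + \<mu> * \<tau> k)"
  and tau_Suc: "\<tau> (Suc k) = \<tau> k * sqrt (\<gamma> k / \<gamma> (Suc k))"
  and gamma_0: "\<gamma> 0 = \<sigma> 0 / \<tau> 0"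
  using step_sizes unfolding apd_step_sizes_def by blast+

lemma gamma_tau_pos: "\<gamma> k > 0 \<and> \<tau> k > 0"
proof (induction k)
  case 0
  then show ?case using tau0 sigma0 by (simp add: gamma_0)
next
  case (Suc k)
  then have "\<gamma> (Suc k) > 0" using mu_ge_0 by (simp add: gamma_Suc add_pos_nonneg)
  then show ?case using Suc by (simp add: tau_Suc)
qed

lemma gamma_pos: "\<gamma> k > 0" and tau_pos: "\<tau> k > 0"
  using gamma_tau_pos by auto

lemma sigma_pos: "\<sigma> k > 0"
  by (simp add: sigma_eq gamma_pos tau_pos)

lemma growth_factor_ge_1: "1 \<le> 1 + \<mu> * \<tau> k"
  using mu_ge_0 tau_pos[of k] by simp

lemma tau_Suc_eq: "\<tau> (Suc k) = \<tau> k / sqrt (1 + \<mu> * \<tau> k)"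
  using gamma_pos[of k] by (simp add: tau_Suc gamma_Suc real_sqrt_divide)

lemma sigma_Suc_eq: "\<sigma> (Suc k) = \<sigma> k * sqrt (1 + \<mu> * \<tau> k)"
proof -
  define g where "g = 1 + \<mu> * \<tau> k"
  have "g > 0" using growth_factor_ge_1[of k] by (simp add: g_def)
  then have "sqrt g * sqrt g = g" "sqrt g > 0" by auto
  then have "g / sqrt g = sqrt g" by (simp add: field_simps)
  moreover have "\<sigma> (Suc k) = \<sigma> k * (g / sqrt g)"
    unfolding sigma_eq tau_Suc_eq gamma_Suc g_def by simp
  ultimately show ?thesis by (simp add: g_def)
qed

lemma theta_Suc_eq: "\<theta> (Suc k) = 1 / sqrt (1 + \<mu> * \<tau> k)"
  using sigma_pos[of k] by (simp add: theta_eq sigma_Suc_eq)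

lemma theta_pos: "\<theta> k > 0"
  by (simp add: theta_eq sigma_pos)

lemma sigma_mono: "\<sigma> k \<le> \<sigma> (Suc k)"
  using growth_factor_ge_1[of k] sigma_pos[of k] by (simp add: sigma_Suc_eq)

lemma sigma_ge_sigma0: "\<sigma> 0 \<le> \<sigma> k"
  using lift_Suc_mono_le[of \<sigma> 0 k] sigma_mono by simp

lemma theta_le_1: "\<theta> k \<le> 1"
  using sigma_mono[of "k - 1"] sigma_pos by (cases k) (auto simp: theta_eq)

text \<open>
  The two factors \<open>sqrt (1 + \<mu> \<tau>\<^sub>k)\<close> cancel. This invariant is why a condition on the initial step
  sizes controls all later ones.
\<close>
lemma sigma_tau: "\<sigma> k * \<tau> k = \<sigma> 0 * \<tau> 0"
proof (induction k)
  case (Suc k)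
  have "sqrt (1 + \<mu> * \<tau> k) \<noteq> 0" using growth_factor_ge_1[of k] by simp
  then show ?case using Suc by (simp add: sigma_Suc_eq tau_Suc_eq)
qed simp

lemma gamma_eq_sigma: "\<gamma> k * (\<sigma> 0 * \<tau> 0) = (\<sigma> k)\<^sup>2"
  using sigma_tau[of k] by (simp add: sigma_eq power2_eq_square algebra_simps)

lemma gamma_eq: "\<gamma> k = \<sigma> k / \<tau> k"
  using tau_pos[of k] by (simp add: sigma_eq)

lemma constant_steps:
  assumes "\<mu> = 0"
  shows "\<tau> k = \<tau> 0 \<and> \<sigma> k = \<sigma> 0 \<and> \<theta> k = 1"
proof -
  have const: "\<tau> n = \<tau> 0 \<and> \<sigma> n = \<sigma> 0" for n
    by (induction n) (use assms in \<open>auto simp: tau_Suc_eq sigma_Suc_eq\<close>)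
  have "\<theta> k = 1"
    unfolding theta_eq using const[of k] const[of "k - 1"] sigma0 by simp
  then show ?thesis using const[of k] by blast
qed

text \<open>
  By the invariant \<open>\<sigma>\<^sub>k \<tau>\<^sub>k = P\<close>, the update is \<open>\<sigma>\<^sub>k\<^sub>+\<^sub>1\<^sup>2 = \<sigma>\<^sub>k\<^sup>2 + \<mu> P \<sigma>\<^sub>k\<close>, which dominates \<open>(\<sigma>\<^sub>k + b)\<^sup>2\<close>
  as soon as \<open>2 b + b\<^sup>2 / \<sigma>\<^sub>k \<le> \<mu> P\<close>. The choice \<open>b \<le> \<sigma>\<^sub>0\<close> reduces this to \<open>3 b \<le> \<mu> P\<close>, and makes the
  normalised slope \<open>a = b / \<sigma>\<^sub>0\<close> at most \<open>1\<close>, which the estimate of the weight sums uses.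
\<close>
lemma sigma_linear_lower:
  assumes "\<mu> > 0"
  obtains a where "0 < a" "a \<le> 1" "\<And>k. \<sigma> 0 * (1 + a * real k) \<le> \<sigma> k"
proof -
  define P where "P = \<sigma> 0 * \<tau> 0"
  have P: "P > 0" using sigma0 tau0 by (simp add: P_def)
  define b where "b = min (\<mu> * P / 3) (\<sigma> 0)"
  have b: "b > 0" "b \<le> \<sigma> 0" "3 * b \<le> \<mu> * P" using assms P sigma0 by (auto simp: b_def)
  have "\<sigma> 0 + b * real k \<le> \<sigma> k" for k
  proof (induction k)
    case (Suc k)
    have sq: "(\<sigma> (Suc k))\<^sup>2 = (\<sigma> k)\<^sup>2 + \<mu> * P * \<sigma> k"
      using sigma_tau[of k] growth_factor_ge_1[of k]
      by (simp add: sigma_Suc_eq power_mult_distrib P_def power2_eq_square algebra_simps)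
    have "b * b \<le> b * \<sigma> k"
      using b sigma_ge_sigma0[of k] by (intro mult_left_mono) auto
    moreover have "3 * b * \<sigma> k \<le> \<mu> * P * \<sigma> k"
      using b sigma_pos[of k] by (intro mult_right_mono) auto
    ultimately have "(\<sigma> k + b)\<^sup>2 \<le> (\<sigma> (Suc k))\<^sup>2"
      by (simp add: sq power2_sum) (simp add: power2_eq_square algebra_simps)
    then have "\<sigma> k + b \<le> \<sigma> (Suc k)"
      by (rule power2_le_imp_le) (use sigma_pos less_imp_le in blast)
    then show ?case using Suc by (simp add: algebra_simps)
  qed simp
  then have "\<sigma> 0 * (1 + (b / \<sigma> 0) * real k) \<le> \<sigma> k" for k
    using sigma0 by (simp add: algebra_simps)
  then show ?thesis using that[of "b / \<sigma> 0"] b sigma0 by simp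
qed

text \<open>
  From \<open>sqrt (1 + m) \<le> 1 + m / 2\<close> and the invariance of \<open>\<sigma>\<^sub>k \<tau>\<^sub>k\<close>, each increment is at most
  \<open>\<mu> \<sigma>\<^sub>0 \<tau>\<^sub>0 / 2\<close>.
\<close>
lemma sigma_linear_upper:
  obtains b where "0 \<le> b" "\<And>k. \<sigma> k \<le> \<sigma> 0 * (1 + b * real k)"
proof -
  define b where "b = \<mu> * \<tau> 0 / 2"
  have b: "b \<ge> 0" using mu_ge_0 tau0 by (simp add: b_def)
  have "\<sigma> k \<le> \<sigma> 0 * (1 + b * real k)" for k
  proof (induction k)
    case (Suc k)
    have "sqrt (1 + m) \<le> 1 + m / 2" if "m \<ge> 0" for m :: real
      using that by (intro real_le_lsqrt) (auto simp: power2_sum power_divide)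
    then have "sqrt (1 + \<mu> * \<tau> k) \<le> 1 + \<mu> * \<tau> k / 2"
      using growth_factor_ge_1[of k] by simp
    then have "\<sigma> (Suc k) \<le> \<sigma> k * (1 + \<mu> * \<tau> k / 2)"
      using sigma_pos[of k] by (simp add: sigma_Suc_eq)
    also have "\<dots> = \<sigma> k + \<sigma> 0 * b"
      using sigma_tau[of k] by (simp add: b_def algebra_simps)
    finally show ?case using Suc by (simp add: algebra_simps)
  qed simp
  then show ?thesis using b that by blast
qed

lemma weight_sum_bounds:
  assumes "\<mu> > 0"
  obtains c C where "c > 0" "\<And>K. c * (real K)\<^sup>2 \<le> weight_sum (\<lambda>k. \<sigma> k / \<sigma> 0) K"
    "\<And>K. weight_sum (\<lambda>k. \<sigma> k / \<sigma> 0) K \<le> C * (real K)\<^sup>2"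
proof -
  obtain a where a: "0 < a" "a \<le> 1" "\<And>k. \<sigma> 0 * (1 + a * real k) \<le> \<sigma> k"
    using sigma_linear_lower[OF assms] by blast
  obtain b where b: "0 \<le> b" "\<And>k. \<sigma> k \<le> \<sigma> 0 * (1 + b * real k)"
    using sigma_linear_upper by blast
  have lower: "1 + a * real k \<le> \<sigma> k / \<sigma> 0" and upper: "\<sigma> k / \<sigma> 0 \<le> 1 + b * real k" for k
    using a(3)[of k] b(2)[of k] sigma0 by (auto simp: field_simps)
  have weight_Suc: "weight_sum (\<lambda>k. \<sigma> k / \<sigma> 0) (Suc K) = weight_sum (\<lambda>k. \<sigma> k / \<sigma> 0) K + \<sigma> K / \<sigma> 0" for K
    by (simp add: weight_sum_def)
  have "a / 2 * (real K)\<^sup>2 \<le> weight_sum (\<lambda>k. \<sigma> k / \<sigma> 0) K" for K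
  proof (induction K)
    case (Suc K)
    have "a / 2 * (real (Suc K))\<^sup>2 = a / 2 * (real K)\<^sup>2 + a * real K + a / 2"
      by (simp add: power2_eq_square algebra_simps add_divide_distrib)
    then show ?case using Suc lower[of K] a(2) unfolding weight_Suc by linarith
  qed (simp add: weight_sum_def)
  moreover have "weight_sum (\<lambda>k. \<sigma> k / \<sigma> 0) K \<le> (1 + b) * (real K)\<^sup>2" for K
  proof (induction K)
    case (Suc K)
    have "(1 + b) * (real (Suc K))\<^sup>2 = (1 + b) * (real K)\<^sup>2 + 2 * real K + 1 + 2 * (b * real K) + b"
      by (simp add: power2_eq_square algebra_simps)
    moreover have "b * real K \<ge> 0" using b(1) by simp
    ultimately show ?case using Suc upper[of K] b(1) unfolding weight_Suc by linarith
  qed (simp add: weight_sum_def)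
  ultimately show ?thesis using that[of "a / 2" "1 + b"] a(1) by auto
qed

lemma gamma_lower:
  assumes "\<mu> > 0"
  obtains c where "c > 0" "\<And>K. c * (real K)\<^sup>2 \<le> \<gamma> K"
proof -
  obtain a where a: "0 < a" "a \<le> 1" "\<And>k. \<sigma> 0 * (1 + a * real k) \<le> \<sigma> k"
    using sigma_linear_lower[OF assms] by blast
  have P: "\<sigma> 0 * \<tau> 0 > 0" using sigma0 tau0 by simp
  have "(\<sigma> 0 * a)\<^sup>2 / (\<sigma> 0 * \<tau> 0) * (real K)\<^sup>2 \<le> \<gamma> K" for K
  proof -
    have "\<sigma> 0 * a * real K \<le> \<sigma> K" using a(3)[of K] sigma0 by (simp add: algebra_simps)
    then have "(\<sigma> 0 * a * real K)\<^sup>2 \<le> (\<sigma> K)\<^sup>2"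
      using sigma0 a(1) by (intro power_mono) auto
    then have "(\<sigma> 0 * a)\<^sup>2 * (real K)\<^sup>2 \<le> \<gamma> K * (\<sigma> 0 * \<tau> 0)"
      by (simp only: gamma_eq_sigma power_mult_distrib)
    then show ?thesis using P by (simp add: pos_divide_le_eq)
  qed
  moreover have "(\<sigma> 0 * a)\<^sup>2 / (\<sigma> 0 * \<tau> 0) > 0" using P a(1) sigma0 by simp
  ultimately show ?thesis using that by blast
qed

end

section \<open>Estimates along a run\<close>

locale apd_run = saddle_setting f h \<Phi> \<phi>X \<phi>Y \<mu> Lxx Lyx Lyy + step_sizes \<mu> \<tau> \<sigma> \<gamma> \<theta>
  for f :: "'a::real_normed_vector \<Rightarrow> ereal"
    and h :: "'b::real_normed_vector \<Rightarrow> ereal"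
    and \<Phi> :: "'a \<Rightarrow> 'b \<Rightarrow> real"
    and \<phi>X :: "'a \<Rightarrow> ereal" and \<phi>Y :: "'b \<Rightarrow> ereal"
    and \<mu> Lxx Lyx Lyy :: real
    and \<tau> \<sigma> \<gamma> \<theta> :: "nat \<Rightarrow> real" +
  fixes x :: "nat \<Rightarrow> 'a" and y :: "nat \<Rightarrow> 'b"
  assumes run: "apd f h \<Phi> \<phi>X \<phi>Y \<mu> \<tau> \<sigma> \<gamma> \<theta> x y"
    and x0_dom: "x 0 \<in> edom f" and y0_dom: "y 0 \<in> edom h"
begin

text \<open>
  The real parts of \<open>f\<close> and \<open>h\<close>, meaningful on the domains; all iterates stay there, so the
  estimates can be made in the reals.
\<close>
definition fr :: "'a \<Rightarrow> real" where "fr u = real_of_ereal (f u)"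
definition hr :: "'b \<Rightarrow> real" where "hr v = real_of_ereal (h v)"
abbreviation "DX u w \<equiv> breg (\<lambda>u. real_of_ereal (\<phi>X u)) u w"
abbreviation "DY v w \<equiv> breg (\<lambda>v. real_of_ereal (\<phi>Y v)) v w"

definition Lr :: "'a \<Rightarrow> 'b \<Rightarrow> real" where
  "Lr u v = fr u + \<Phi> u v - hr v"

text \<open>
  Truncated subtraction makes the differences below vanish at index \<open>0\<close>, in accordance with
  \<open>(x\<^sub>-\<^sub>1, y\<^sub>-\<^sub>1) = (x\<^sub>0, y\<^sub>0)\<close>.
\<close>
definition q :: "nat \<Rightarrow> 'b \<Rightarrow>\<^sub>L real" where
  "q k = grad_y \<Phi> (x k) (y k) - grad_y \<Phi> (x (k - 1)) (y (k - 1))"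

definition dx :: "nat \<Rightarrow> real" where "dx k = norm (x k - x (k - 1))"
definition dy :: "nat \<Rightarrow> real" where "dy k = norm (y k - y (k - 1))"

lemma f_fin: "u \<in> edom f \<Longrightarrow> f u = ereal (fr u)"
  unfolding fr_def using edom_ereal[of u f] f_not_MInf[of u] by blast

lemma h_fin: "v \<in> edom h \<Longrightarrow> h v = ereal (hr v)"
  unfolding hr_def using edom_ereal[of v h] h_not_MInf[of v] by blast

lemma fr_convex: "convex_on (edom f) fr"
  using closed_convex_fun_convex_on[OF f_closed_convex f_not_MInf] by (simp add: fr_def[abs_def])

lemma hr_convex: "convex_on (edom h) hr"
  using closed_convex_fun_convex_on[OF h_closed_convex h_not_MInf] by (simp add: hr_def[abs_def])

lemma dom_f_convex: "convex (edom f)"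
  using fr_convex by (simp add: convex_on_def)

lemma y_prox:
  assumes "y k \<in> edom h"
  shows "y (Suc k) \<in> edom h"
    and "- (- apd_s \<Phi> \<theta> x y k + (1 / \<sigma> k) *\<^sub>R (grad (\<lambda>v. real_of_ereal (\<phi>Y v)) (y (Suc k))
          - grad (\<lambda>v. real_of_ereal (\<phi>Y v)) (y k))) \<in> subdiff h (y (Suc k))"
proof -
  have "is_arg_min (\<lambda>v. h v - ereal (blinfun_apply (apd_s \<Phi> \<theta> x y k) v)
      + ereal (1 / \<sigma> k) * bregman \<phi>Y v (y k)) (\<lambda>_. True) (y (Suc k))"
    using run unfolding apd_def by blast
  then have "is_arg_min (\<lambda>v. h v + ereal (blinfun_apply (- apd_s \<Phi> \<theta> x y k) v)
      + ereal (1 / \<sigma> k) * bregman \<phi>Y v (y k)) (\<lambda>_. True) (y (Suc k))"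
    by (simp only: minus_ereal_def blinfun.minus_left uminus_ereal.simps)
  moreover have "1 / \<sigma> k > 0" using sigma_pos[of k] by simp
  ultimately show "y (Suc k) \<in> edom h"
    and "- (- apd_s \<Phi> \<theta> x y k + (1 / \<sigma> k) *\<^sub>R (grad (\<lambda>v. real_of_ereal (\<phi>Y v)) (y (Suc k))
          - grad (\<lambda>v. real_of_ereal (\<phi>Y v)) (y k))) \<in> subdiff h (y (Suc k))"
    using bregman_prox_subgradient[OF h_closed_convex h_not_MInf phiY assms] by blast+
qed

lemma x_prox:
  assumes "x k \<in> edom f"
  shows "x (Suc k) \<in> edom f"
    and "- (grad_x \<Phi> (x k) (y (Suc k)) + (1 / \<tau> k) *\<^sub>R (grad (\<lambda>u. real_of_ereal (\<phi>X u)) (x (Suc k))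
          - grad (\<lambda>u. real_of_ereal (\<phi>X u)) (x k))) \<in> subdiff f (x (Suc k))"
proof -
  have "is_arg_min (\<lambda>u. f u + ereal (blinfun_apply (grad_x \<Phi> (x k) (y (Suc k))) u)
      + ereal (1 / \<tau> k) * bregman \<phi>X u (x k)) (\<lambda>_. True) (x (Suc k))"
    using run unfolding apd_def by blast
  moreover have "1 / \<tau> k > 0" using tau_pos[of k] by simp
  ultimately show "x (Suc k) \<in> edom f"
    and "- (grad_x \<Phi> (x k) (y (Suc k)) + (1 / \<tau> k) *\<^sub>R (grad (\<lambda>u. real_of_ereal (\<phi>X u)) (x (Suc k))
          - grad (\<lambda>u. real_of_ereal (\<phi>X u)) (x k))) \<in> subdiff f (x (Suc k))"
    using bregman_prox_subgradient[OF f_closed_convex f_not_MInf phiX assms] by blast+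
qed

lemma x_dom: "x k \<in> edom f"
  by (induction k) (auto intro: x0_dom x_prox)

lemma y_dom: "y k \<in> edom h"
  by (induction k) (auto intro: y0_dom y_prox)

lemma bregman_X: "u \<in> edom f \<Longrightarrow> bregman \<phi>X u (x k) = ereal (DX u (x k))"
  using bregman_eq_breg[OF phiX _ x_dom] distance_generating_domain[OF phiX] by blast

lemma bregman_Y: "v \<in> edom h \<Longrightarrow> bregman \<phi>Y v (y k) = ereal (DY v (y k))"
  using bregman_eq_breg[OF phiY _ y_dom] distance_generating_domain[OF phiY] by blast

lemma DX_ge: "u \<in> edom f \<Longrightarrow> (norm (u - x k))\<^sup>2 / 2 \<le> DX u (x k)"
  using breg_ge_norm[OF phiX _ x_dom] distance_generating_domain[OF phiX] by blast

lemma DY_ge: "v \<in> edom h \<Longrightarrow> (norm (v - y k))\<^sup>2 / 2 \<le> DY v (y k)"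
  using breg_ge_norm[OF phiY _ y_dom] distance_generating_domain[OF phiY] by blast

lemma DX_nonneg: "u \<in> edom f \<Longrightarrow> 0 \<le> DX u (x k)"
  using order_trans[OF _ DX_ge] by simp

lemma DY_nonneg: "v \<in> edom h \<Longrightarrow> 0 \<le> DY v (y k)"
  using order_trans[OF _ DY_ge] by simp

lemma DX_if_mu_pos: "u \<in> edom f \<Longrightarrow> \<mu> > 0 \<Longrightarrow> DX u (x k) = (norm (u - x k))\<^sup>2 / 2"
  using bregman_X[of u k] bregman_X_if_mu_pos[of u "x k"] by simp

lemma y_step:
  assumes "v \<in> edom h"
  shows "hr (y (Suc k)) + apd_s \<Phi> \<theta> x y k (v - y (Suc k)) \<le> hr v
    + (1 / \<sigma> k) * (DY v (y k) - DY v (y (Suc k)) - DY (y (Suc k)) (y k))"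
proof -
  have "h (y (Suc k)) + ereal (blinfun_apply (- (- apd_s \<Phi> \<theta> x y k
      + (1 / \<sigma> k) *\<^sub>R (grad (\<lambda>v. real_of_ereal (\<phi>Y v)) (y (Suc k))
          - grad (\<lambda>v. real_of_ereal (\<phi>Y v)) (y k)))) (v - y (Suc k))) \<le> h v"
    using y_prox(2)[OF y_dom, of k] by (simp add: subdiff_def)
  then show ?thesis
    unfolding breg_three_point h_fin[OF assms] h_fin[OF y_dom]
    by (simp add: blinfun.add_left blinfun.diff_left blinfun.minus_left blinfun.scaleR_left)
qed

text \<open>
  The modulus of convexity applies at the subgradient produced by the proximal step, which yields
  the additional quadratic term.
\<close>
lemma x_step:
  assumes "u \<in> edom f"
  shows "fr (x (Suc k)) - grad_x \<Phi> (x k) (y (Suc k)) (u - x (Suc k))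
      + \<mu> / 2 * (norm (u - x (Suc k)))\<^sup>2 \<le> fr u
    + (1 / \<tau> k) * (DX u (x k) - DX u (x (Suc k)) - DX (x (Suc k)) (x k))"
proof -
  have "f (x (Suc k)) + ereal (blinfun_apply (- (grad_x \<Phi> (x k) (y (Suc k))
      + (1 / \<tau> k) *\<^sub>R (grad (\<lambda>u. real_of_ereal (\<phi>X u)) (x (Suc k))
          - grad (\<lambda>u. real_of_ereal (\<phi>X u)) (x k)))) (u - x (Suc k)))
      + ereal (\<mu> / 2 * (norm (u - x (Suc k)))\<^sup>2) \<le> f u"
    using f_modulus x_prox(2)[OF x_dom, of k] x_dom assms
    unfolding convexity_modulus_def by blast
  then show ?thesis
    unfolding breg_three_point f_fin[OF assms] f_fin[OF x_dom]
    by (simp add: blinfun.add_left blinfun.diff_left blinfun.minus_left blinfun.scaleR_left)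
qed

text \<open>
  The error of the explicit treatment of \<open>\<Phi>\<close>: the extrapolated gradient \<open>s\<^sub>k\<close> instead of the gradient
  at the new point, and linearisation of \<open>\<Phi>\<close> in \<open>x\<close>.
\<close>
definition drift :: "nat \<Rightarrow> 'b \<Rightarrow> real" where
  "drift k v = q (Suc k) (v - y (Suc k)) - \<theta> k * q k (v - y k) + \<theta> k * q k (y (Suc k) - y k)
     + Lxx / 2 * (dx (Suc k))\<^sup>2"

text \<open>
  The proximal inequality for \<open>x\<close> contains the slope of \<open>\<Phi>(\<cdot>, y\<^sub>k\<^sub>+\<^sub>1)\<close> at \<open>x\<^sub>k\<close>; the descent lemma
  towards \<open>x\<^sub>k\<^sub>+\<^sub>1\<close> and convexity towards \<open>u\<close> replace it by values of \<open>\<Phi>\<close>. On the \<open>y\<close> side concavity is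
  used at the new point, and the gradient there differs from \<open>s\<^sub>k\<close> by \<open>q\<^sub>k\<^sub>+\<^sub>1 - \<theta>\<^sub>k q\<^sub>k\<close>.
\<close>
lemma one_step:
  assumes u: "u \<in> edom f" and v: "v \<in> edom h"
  shows "Lr (x (Suc k)) v - Lr u (y (Suc k)) \<le> drift k v
    + (1 / \<tau> k) * (DX u (x k) - DX u (x (Suc k)) - DX (x (Suc k)) (x k))
    - \<mu> / 2 * (norm (u - x (Suc k)))\<^sup>2
    + (1 / \<sigma> k) * (DY v (y k) - DY v (y (Suc k)) - DY (y (Suc k)) (y k))"
proof -
  define x' y' G where "x' = x (Suc k)" and "y' = y (Suc k)" and "G = grad_x \<Phi> (x k) y'"
  have dom: "x' \<in> edom f" "y' \<in> edom h" by (auto simp: x'_def y'_def x_dom y_dom)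
  have "\<Phi> x' y' \<le> \<Phi> (x k) y' + G (x' - x k) + Lxx / 2 * (norm (x' - x k))\<^sup>2"
    unfolding G_def grad_x_def
    by (rule Lipschitz_grad_quadratic_upper_bound[OF dom_f_convex x_dom dom(1)])
       (use Phi_x_diff Phi_x_Lipschitz dom x_dom in \<open>auto simp: grad_x_def\<close>)
  moreover have "\<Phi> (x k) y' + G (u - x k) \<le> \<Phi> u y'"
    unfolding G_def grad_x_def
    by (rule convex_on_grad_le[OF Phi_x_convex[OF dom(2)]]) (use Phi_x_diff dom in auto)
  moreover have "\<Phi> x' v \<le> \<Phi> x' y' + grad_y \<Phi> x' y' (v - y')"
  proof -
    have "convex_on UNIV (\<lambda>w. - \<Phi> x' w)"
      using Phi_y_concave[OF dom(1)] by (simp add: concave_on_def)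
    moreover have d: "(\<lambda>w. - \<Phi> x' w) differentiable (at y')"
      using Phi_y_diff[OF dom(1)] by (intro derivative_intros)
    ultimately have "- \<Phi> x' y' + grad (\<lambda>w. - \<Phi> x' w) y' (v - y') \<le> - \<Phi> x' v"
      by (intro convex_on_grad_le) auto
    moreover have "blinfun_apply (grad (\<lambda>w. - \<Phi> x' w) y') = (\<lambda>w. - grad_y \<Phi> x' y' w)"
      unfolding grad_y_def
      by (rule has_derivative_unique[OF has_derivative_grad[OF d]])
         (intro derivative_intros has_derivative_grad Phi_y_diff dom)
    ultimately show ?thesis by simp
  qed
  moreover have "drift k v = grad_y \<Phi> x' y' (v - y') - apd_s \<Phi> \<theta> x y k (v - y')
      + Lxx / 2 * (norm (x' - x k))\<^sup>2"
    unfolding drift_def q_def apd_s_def dx_def x'_def y'_def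
    by (simp add: blinfun.add_left blinfun.diff_left blinfun.scaleR_left blinfun.diff_right
        algebra_simps)
  ultimately show ?thesis
    using x_step[OF u, of k] y_step[OF v, of k]
    unfolding Lr_def x'_def[symmetric] y'_def[symmetric] G_def[symmetric]
    by (simp add: blinfun.diff_right)
qed

lemma norm_q_le: "norm (q k) \<le> Lyy * dy k + Lyx * dx k"
  unfolding q_def dx_def dy_def by (rule Phi_y_Lipschitz) (auto simp: x_dom y_dom)

lemma q_apply_le: "\<bar>q k w\<bar> \<le> (Lyy * dy k + Lyx * dx k) * norm w"
  using norm_blinfun[of "q k" w] mult_right_mono[OF norm_q_le[of k] norm_ge_zero[of w]] by simp

lemma dx_nonneg: "0 \<le> dx k" and dy_nonneg: "0 \<le> dy k"
  by (simp_all add: dx_def dy_def)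

lemma q_0: "q 0 = 0" and dx_0: "dx 0 = 0" and dy_0: "dy 0 = 0"
  by (simp_all add: q_def dx_def dy_def)

subsection \<open>Saddle points\<close>

abbreviation "L \<equiv> lagrangian f \<Phi> h"

lemma lagrangian_real: "u \<in> edom f \<Longrightarrow> v \<in> edom h \<Longrightarrow> L u v = ereal (Lr u v)"
  by (simp add: lagrangian_def Lr_def f_fin h_fin)

lemma lagrangian_PInf: "u \<notin> edom f \<Longrightarrow> L u v = \<infinity>"
  by (simp add: lagrangian_def edom_def)

lemma lagrangian_MInf: "u \<in> edom f \<Longrightarrow> v \<notin> edom h \<Longrightarrow> L u v = -\<infinity>"
  by (simp add: lagrangian_def f_fin) (simp add: edom_def)

text \<open>
  A saddle point lies in the domains because comparison with \<open>(x\<^sub>0, y\<^sub>0)\<close> excludes the values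
  \<open>\<plusminus>\<infinity>\<close>; conversely, points outside the domains satisfy the saddle inequalities trivially.
\<close>
lemma saddle_point_iff:
  "saddle_point L xs ys \<longleftrightarrow> xs \<in> edom f \<and> ys \<in> edom h \<and>
     (\<forall>u\<in>edom f. \<forall>v\<in>edom h. Lr xs v \<le> Lr u ys)"
proof
  assume s: "saddle_point L xs ys"
  then have le: "L xs v \<le> L u ys" for u v
    unfolding saddle_point_def using order_trans by blast
  have ys: "ys \<in> edom h"
  proof (rule ccontr)
    assume "ys \<notin> edom h"
    then have "L (x 0) ys = -\<infinity>" by (rule lagrangian_MInf[OF x0_dom])
    then show False using le[of "y 0" "x 0"]
      by (cases "xs \<in> edom f") (auto simp: lagrangian_PInf lagrangian_real y0_dom)
  qed
  have xs: "xs \<in> edom f"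
  proof (rule ccontr)
    assume "xs \<notin> edom f"
    then show False using le[of ys "x 0"] ys by (simp add: lagrangian_PInf lagrangian_real x0_dom)
  qed
  show "xs \<in> edom f \<and> ys \<in> edom h \<and> (\<forall>u\<in>edom f. \<forall>v\<in>edom h. Lr xs v \<le> Lr u ys)"
  proof (intro conjI ballI xs ys)
    fix u v assume "u \<in> edom f" "v \<in> edom h"
    then show "Lr xs v \<le> Lr u ys" using le[of v u] by (simp add: lagrangian_real xs ys)
  qed
next
  assume s: "xs \<in> edom f \<and> ys \<in> edom h \<and> (\<forall>u\<in>edom f. \<forall>v\<in>edom h. Lr xs v \<le> Lr u ys)"
  show "saddle_point L xs ys"
    unfolding saddle_point_def
  proof (intro allI conjI)
    fix u v
    show "L xs v \<le> L xs ys"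
      using s by (cases "v \<in> edom h") (auto simp: lagrangian_real lagrangian_MInf)
    show "L xs ys \<le> L u ys"
      using s by (cases "u \<in> edom f") (auto simp: lagrangian_real lagrangian_PInf)
  qed
qed

end

section \<open>The energy inequality\<close>

text \<open>
  Both regimes of step sizes share the energy estimate: either they are constant (\<open>\<mu> = 0\<close>), or
  \<open>\<sigma>\<^sub>k\<close> may grow and \<open>Lyy = 0\<close>.
\<close>
locale apd_energy = apd_run f h \<Phi> \<phi>X \<phi>Y \<mu> Lxx Lyx Lyy \<tau> \<sigma> \<gamma> \<theta> x y
  for f :: "'a::real_normed_vector \<Rightarrow> ereal"
    and h :: "'b::real_normed_vector \<Rightarrow> ereal"
    and \<Phi> :: "'a \<Rightarrow> 'b \<Rightarrow> real"
    and \<phi>X :: "'a \<Rightarrow> ereal" and \<phi>Y :: "'b \<Rightarrow> ereal"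
    and \<mu> Lxx Lyx Lyy :: real
    and \<tau> \<sigma> \<gamma> \<theta> :: "nat \<Rightarrow> real"
    and x :: "nat \<Rightarrow> 'a" and y :: "nat \<Rightarrow> 'b" +
  fixes \<delta> c\<alpha> c\<beta> :: real
  assumes cond: "step_condition Lxx Lyx Lyy (\<tau> 0) (\<sigma> 0) \<delta> c\<alpha> c\<beta>"
    and mu_or_Lyy: "\<mu> = 0 \<or> Lyy = 0"
begin

lemma step_constants:
  "\<delta> \<ge> 0" "c\<alpha> > 0" "c\<beta> \<ge> 0" "c\<alpha> + c\<beta> + \<delta> \<le> 1" "Lyy = 0 \<or> c\<beta> > 0"
proof -
  have "Lyy = 0 \<or> Lyy > 0" using Lyy_nonneg by linarith
  then show "\<delta> \<ge> 0" "c\<alpha> > 0" "c\<beta> \<ge> 0" "c\<alpha> + c\<beta> + \<delta> \<le> 1" "Lyy = 0 \<or> c\<beta> > 0"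
    using cond unfolding step_condition_def by blast+
qed

text \<open>
  With its factor \<open>1 / \<sigma>\<^sub>0\<close> multiplied out, the initial condition involves \<open>(1 - \<delta>) / (\<sigma>\<^sub>0 \<tau>\<^sub>0) - Lxx / \<sigma>\<^sub>0\<close>, whose first term is invariant
  and whose second term improves as \<open>\<sigma>\<^sub>k\<close> grows.
\<close>
lemma cond_x: "Lyx\<^sup>2 * \<sigma> k / c\<alpha> \<le> (1 - \<delta>) / \<tau> k - Lxx"
proof -
  have "Lyx\<^sup>2 / c\<alpha> \<le> ((1 - \<delta>) / \<tau> 0 - Lxx) * (1 / \<sigma> 0)"
    using cond unfolding step_condition_def by blast
  also have "\<dots> = (1 - \<delta>) / (\<sigma> 0 * \<tau> 0) - Lxx / \<sigma> 0" using sigma0 tau0 by (simp add: field_simps)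
  also have "\<dots> \<le> (1 - \<delta>) / (\<sigma> k * \<tau> k) - Lxx / \<sigma> k"
    unfolding sigma_tau[of k]
    using divide_left_mono[OF sigma_ge_sigma0 Lxx_nonneg mult_pos_pos[OF sigma_pos sigma_pos]]
    by (rule diff_left_mono)
  finally have "Lyx\<^sup>2 / c\<alpha> * \<sigma> k \<le> ((1 - \<delta>) / (\<sigma> k * \<tau> k) - Lxx / \<sigma> k) * \<sigma> k"
    by (rule mult_right_mono) (rule less_imp_le[OF sigma_pos])
  also have "\<dots> = (1 - \<delta>) / \<tau> k - Lxx"
  proof -
    have "(c / (s * w) - l / s) * s = c / w - l" if "s > 0" for c s w l :: real
      using that by (simp add: left_diff_distrib)
    then show ?thesis using sigma_pos[of k] by blast
  qed
  finally show ?thesis by simp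
qed

text \<open>
  This is where the hypothesis that \<open>\<mu>\<close> or \<open>Lyy\<close> vanishes enters: a growing \<open>\<sigma>\<^sub>k\<close> is compatible with
  the condition only if \<open>Lyy = 0\<close>.
\<close>
lemma cond_y: "Lyy\<^sup>2 * (\<sigma> k)\<^sup>2 / c\<beta> \<le> 1 - (\<delta> + c\<alpha> + c\<beta>)"
proof -
  have c: "Lyy\<^sup>2 / c\<beta> * (\<sigma> 0)\<^sup>2 \<le> 1 - (\<delta> + c\<alpha> + c\<beta>)"
    using cond unfolding step_condition_def by blast
  show ?thesis
  proof (cases "Lyy = 0")
    case False
    then have "\<sigma> k = \<sigma> 0" using mu_or_Lyy constant_steps by blast
    then show ?thesis using c by simp
  qed (use c in simp)
qed

definition t :: "nat \<Rightarrow> real" where "t k = \<sigma> k / \<sigma> 0"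

text \<open>
  The part of Young's bound for \<open>\<langle>q\<^sub>k, w\<rangle>\<close> that depends on the previous step. The constants
  \<open>c\<alpha> / \<sigma>\<^sub>k\<^sub>-\<^sub>1\<close> and \<open>c\<beta> / \<sigma>\<^sub>k\<^sub>-\<^sub>1\<close> of that bound make its other part \<open>(c\<alpha> + c\<beta>) \<parallel>w\<parallel>\<^sup>2 / (2 \<sigma>\<^sub>0)\<close>, with no
  dependence on \<open>k\<close>.
\<close>
definition lag :: "nat \<Rightarrow> real" where
  "lag k = t (k - 1) * ((Lyx\<^sup>2 * \<sigma> (k - 1) / c\<alpha>) / 2 * (dx k)\<^sup>2
     + (Lyy\<^sup>2 * \<sigma> (k - 1) / c\<beta>) / 2 * (dy k)\<^sup>2)"

text \<open>
  The weighted Bregman distances to \<open>(u, v)\<close>, corrected by the two terms that the next step inherits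
  from the extrapolation.
\<close>
definition V :: "nat \<Rightarrow> 'a \<Rightarrow> 'b \<Rightarrow> real" where
  "V k u v = \<gamma> k / \<sigma> 0 * DX u (x k) + 1 / \<sigma> 0 * DY v (y k) - t (k - 1) * q k (v - y k) + lag k"

lemma t_pos: "t k > 0"
  by (simp add: t_def sigma_pos)

lemma t_div_sigma: "t k / \<sigma> k = 1 / \<sigma> 0"
  using sigma_pos[of k] by (simp add: t_def)

lemma t_div_tau: "t k / \<tau> k = \<gamma> k / \<sigma> 0"
  by (simp add: t_def gamma_eq)

lemma t_theta: "t k * \<theta> k = t (k - 1)"
  using sigma_pos[of k] by (simp add: t_def theta_eq)

lemma lag_nonneg: "0 \<le> lag k"
proof -
  have "t (k - 1) \<ge> 0" "\<sigma> (k - 1) \<ge> 0"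
    using t_pos[of "k - 1"] sigma_pos[of "k - 1"] by simp_all
  then show ?thesis
    using step_constants(2,3) unfolding lag_def
    by (intro mult_nonneg_nonneg add_nonneg_nonneg divide_nonneg_nonneg) simp_all
qed

lemma q_Young: "t (k - 1) * \<bar>q k w\<bar> \<le> lag k + (c\<alpha> + c\<beta>) / (2 * \<sigma> 0) * (norm w)\<^sup>2"
proof -
  define s where "s = \<sigma> (k - 1)"
  have s: "s > 0" by (simp add: s_def sigma_pos)
  have "\<bar>q k w\<bar> \<le> Lyx * dx k * norm w + Lyy * dy k * norm w"
    using q_apply_le[of k w] by (simp add: algebra_simps)
  also have "\<dots> \<le> ((Lyx\<^sup>2 * s / c\<alpha>) / 2 * (dx k)\<^sup>2 + (c\<alpha> / s) / 2 * (norm w)\<^sup>2)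
      + ((Lyy\<^sup>2 * s / c\<beta>) / 2 * (dy k)\<^sup>2 + (c\<beta> / s) / 2 * (norm w)\<^sup>2)"
    using step_constants s by (intro add_mono Young_weighted) auto
  finally have "t (k - 1) * \<bar>q k w\<bar> \<le> t (k - 1) * (((Lyx\<^sup>2 * s / c\<alpha>) / 2 * (dx k)\<^sup>2 + (c\<alpha> / s) / 2 * (norm w)\<^sup>2)
      + ((Lyy\<^sup>2 * s / c\<beta>) / 2 * (dy k)\<^sup>2 + (c\<beta> / s) / 2 * (norm w)\<^sup>2))"
    using less_imp_le[OF t_pos] by (rule mult_left_mono)
  also have "\<dots> = lag k + t (k - 1) / s * ((c\<alpha> + c\<beta>) / 2 * (norm w)\<^sup>2)"
    unfolding lag_def s_def[symmetric] by (simp add: algebra_simps add_divide_distrib)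
  also have "t (k - 1) / s = 1 / \<sigma> 0" unfolding s_def by (rule t_div_sigma)
  finally show ?thesis by simp
qed

text \<open>
  Young's inequality for the inner product in \<open>V\<close> costs exactly the summand \<open>lag\<close> and the fraction
  \<open>c\<alpha> + c\<beta>\<close> of the distance in \<open>y\<close>.
\<close>
lemma V_lower:
  assumes "v \<in> edom h"
  shows "\<gamma> k / \<sigma> 0 * DX u (x k) + (1 - (c\<alpha> + c\<beta>)) / \<sigma> 0 * DY v (y k) \<le> V k u v"
proof -
  have "t (k - 1) * q k (v - y k) \<le> t (k - 1) * \<bar>q k (v - y k)\<bar>"
    using less_imp_le[OF t_pos] by (intro mult_left_mono) auto
  also have "\<dots> \<le> lag k + (c\<alpha> + c\<beta>) / (2 * \<sigma> 0) * (norm (v - y k))\<^sup>2" by (rule q_Young)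
  also have "(c\<alpha> + c\<beta>) / (2 * \<sigma> 0) * (norm (v - y k))\<^sup>2
      = (c\<alpha> + c\<beta>) / \<sigma> 0 * ((norm (v - y k))\<^sup>2 / 2)" by simp
  also have "\<dots> \<le> (c\<alpha> + c\<beta>) / \<sigma> 0 * DY v (y k)"
    using step_constants sigma0 DY_ge[OF assms] by (intro mult_left_mono) auto
  finally show ?thesis by (simp add: V_def diff_divide_distrib left_diff_distrib)
qed

lemma V_0: "V 0 u v = 1 / \<tau> 0 * DX u (x 0) + 1 / \<sigma> 0 * DY v (y 0)"
  using sigma0 by (simp add: V_def lag_def q_0 dx_0 dy_0 gamma_0)

text \<open>
  For \<open>\<mu> > 0\<close> the distance is \<open>\<parallel>u - x\<^sub>j\<parallel>\<^sup>2 / 2\<close>, so the gain from strong convexity is exactly what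
  raises the coefficient from \<open>\<gamma>\<^sub>k\<close> to \<open>\<gamma>\<^sub>k\<^sub>+\<^sub>1\<close>. For \<open>\<mu> = 0\<close> both sides agree trivially.
\<close>
lemma gamma_Suc_DX:
  assumes "u \<in> edom f"
  shows "\<gamma> (Suc k) / \<sigma> 0 * DX u (x j)
    = \<gamma> k / \<sigma> 0 * DX u (x j) + t k * (\<mu> / 2 * (norm (u - x j))\<^sup>2)"
proof -
  have mu: "\<mu> * DX u (x j) = \<mu> / 2 * (norm (u - x j))\<^sup>2"
    using DX_if_mu_pos[OF assms] mu_nonneg by (cases "\<mu> = 0") auto
  have "\<gamma> (Suc k) / \<sigma> 0 = \<gamma> k / \<sigma> 0 + t k * \<mu>"
    using sigma_eq[of k] by (simp add: gamma_Suc t_def algebra_simps add_divide_distrib)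
  then have "\<gamma> (Suc k) / \<sigma> 0 * DX u (x j) = \<gamma> k / \<sigma> 0 * DX u (x j) + t k * (\<mu> * DX u (x j))"
    by (simp add: algebra_simps)
  then show ?thesis unfolding mu .
qed

text \<open>
  \<open>one_step\<close> multiplied by \<open>t\<^sub>k\<close>. The distances \<open>D(x\<^sub>k\<^sub>+\<^sub>1, x\<^sub>k)\<close> and \<open>D(y\<^sub>k\<^sub>+\<^sub>1, y\<^sub>k)\<close> enter with negative
  sign and absorb, through \<open>cond_x\<close> and \<open>cond_y\<close>, the linearisation error, Young's bound for the
  current step, and the term \<open>lag\<close> passed on to the next step.
\<close>
lemma V_step:
  assumes u: "u \<in> edom f" and v: "v \<in> edom h"
  shows "t k * (Lr (x (Suc k)) v - Lr u (y (Suc k))) + V (Suc k) u v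
    + \<delta> / 2 * (\<gamma> k / \<sigma> 0 * (dx (Suc k))\<^sup>2 + 1 / \<sigma> 0 * (dy (Suc k))\<^sup>2) \<le> V k u v"
proof -
  define N where "N = (norm (u - x (Suc k)))\<^sup>2"
  define g where "g = \<gamma> k / \<sigma> 0"
  define a where "a = (dx (Suc k))\<^sup>2"
  define b where "b = (dy (Suc k))\<^sup>2"
  have "t k * (Lr (x (Suc k)) v - Lr u (y (Suc k))) \<le> t k * (drift k v
      + (1 / \<tau> k) * (DX u (x k) - DX u (x (Suc k)) - DX (x (Suc k)) (x k))
      - \<mu> / 2 * N
      + (1 / \<sigma> k) * (DY v (y k) - DY v (y (Suc k)) - DY (y (Suc k)) (y k)))"
    unfolding N_def by (intro mult_left_mono one_step u v less_imp_le[OF t_pos])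
  also have "\<dots> = t k * drift k v
      + t k / \<tau> k * (DX u (x k) - DX u (x (Suc k)) - DX (x (Suc k)) (x k))
      - t k * (\<mu> / 2 * N)
      + t k / \<sigma> k * (DY v (y k) - DY v (y (Suc k)) - DY (y (Suc k)) (y k))"
    by (simp add: algebra_simps)
  also have "\<dots> = t k * drift k v
      + (g * DX u (x k) - g * DX u (x (Suc k)) - g * DX (x (Suc k)) (x k))
      - t k * (\<mu> / 2 * N)
      + (1 / \<sigma> 0 * DY v (y k) - 1 / \<sigma> 0 * DY v (y (Suc k)) - 1 / \<sigma> 0 * DY (y (Suc k)) (y k))"
    unfolding t_div_tau t_div_sigma g_def by (simp add: right_diff_distrib diff_divide_distrib)
  finally have main: "t k * (Lr (x (Suc k)) v - Lr u (y (Suc k))) \<le> \<dots>" .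
  have drift: "t k * drift k v = t k * q (Suc k) (v - y (Suc k)) - t (k - 1) * q k (v - y k)
      + t (k - 1) * q k (y (Suc k) - y k) + t k * (Lxx / 2 * a)"
    unfolding drift_def a_def t_theta[symmetric] by (simp add: algebra_simps)
  have "t (k - 1) * q k (y (Suc k) - y k) \<le> t (k - 1) * \<bar>q k (y (Suc k) - y k)\<bar>"
    using less_imp_le[OF t_pos] by (intro mult_left_mono) auto
  also have "\<dots> \<le> lag k + (c\<alpha> + c\<beta>) / (2 * \<sigma> 0) * b"
    using q_Young[of k "y (Suc k) - y k"] by (simp add: b_def dy_def)
  finally have young: "t (k - 1) * q k (y (Suc k) - y k) \<le> lag k + (c\<alpha> + c\<beta>) / (2 * \<sigma> 0) * b" .
  have DXs: "g / 2 * a \<le> g * DX (x (Suc k)) (x k)"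
    using mult_left_mono[OF DX_ge[OF x_dom, of "Suc k" k], of g] gamma_pos[of k] sigma0
    by (simp add: g_def a_def dx_def)
  have DYs: "1 / (2 * \<sigma> 0) * b \<le> 1 / \<sigma> 0 * DY (y (Suc k)) (y k)"
    using mult_left_mono[OF DY_ge[OF y_dom, of "Suc k" k], of "1 / \<sigma> 0"] sigma0
    by (simp add: b_def dy_def)
  have Rs: "lag (Suc k) = t k * (Lyx\<^sup>2 * \<sigma> k / c\<alpha>) / 2 * a + t k * (Lyy\<^sup>2 * \<sigma> k / c\<beta>) / 2 * b"
    by (simp add: lag_def a_def b_def algebra_simps)
  \<comment> \<open>The \<open>x\<close> part of \<open>lag\<close> and the linearisation error fit into the share \<open>1 - \<delta>\<close> of the distance.\<close>
  have "t k * (Lyx\<^sup>2 * \<sigma> k / c\<alpha>) \<le> t k * ((1 - \<delta>) / \<tau> k - Lxx)"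
    by (intro mult_left_mono cond_x less_imp_le[OF t_pos])
  also have "\<dots> = t k / \<tau> k * (1 - \<delta>) - t k * Lxx"
    by (simp add: right_diff_distrib diff_divide_distrib)
  also have "\<dots> = g * (1 - \<delta>) - t k * Lxx" by (simp add: t_div_tau g_def)
  finally have "t k * (Lyx\<^sup>2 * \<sigma> k / c\<alpha>) / 2 * a \<le> (g * (1 - \<delta>) - t k * Lxx) / 2 * a"
    by (intro mult_right_mono divide_right_mono) (auto simp: a_def)
  moreover have "(g * (1 - \<delta>) - t k * Lxx) / 2 * a = g / 2 * a - \<delta> / 2 * (g * a) - t k * (Lxx / 2 * a)"
    by (simp add: algebra_simps diff_divide_distrib)
  ultimately have Rx: "t k * (Lyx\<^sup>2 * \<sigma> k / c\<alpha>) / 2 * a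
      \<le> g / 2 * a - \<delta> / 2 * (g * a) - t k * (Lxx / 2 * a)" by linarith
  \<comment> \<open>The \<open>y\<close> part of \<open>lag\<close> leaves the share \<open>c\<alpha> + c\<beta>\<close> for Young's bound and \<open>\<delta>\<close> as margin.\<close>
  have "t k * (Lyy\<^sup>2 * \<sigma> k / c\<beta>) = 1 / \<sigma> 0 * (Lyy\<^sup>2 * (\<sigma> k)\<^sup>2 / c\<beta>)"
    by (simp add: t_def power2_eq_square)
  also have "\<dots> \<le> 1 / \<sigma> 0 * (1 - (\<delta> + c\<alpha> + c\<beta>))"
    using sigma0 by (intro mult_left_mono cond_y) auto
  finally have "t k * (Lyy\<^sup>2 * \<sigma> k / c\<beta>) / 2 * b \<le> 1 / \<sigma> 0 * (1 - (\<delta> + c\<alpha> + c\<beta>)) / 2 * b"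
    by (intro mult_right_mono divide_right_mono) (auto simp: b_def)
  moreover have "1 / \<sigma> 0 * (1 - (\<delta> + c\<alpha> + c\<beta>)) / 2 * b
      = 1 / (2 * \<sigma> 0) * b - \<delta> / 2 * (1 / \<sigma> 0 * b) - (c\<alpha> + c\<beta>) / (2 * \<sigma> 0) * b"
    using sigma0 by (simp add: field_simps)
  ultimately have Ry: "t k * (Lyy\<^sup>2 * \<sigma> k / c\<beta>) / 2 * b
      \<le> 1 / (2 * \<sigma> 0) * b - \<delta> / 2 * (1 / \<sigma> 0 * b) - (c\<alpha> + c\<beta>) / (2 * \<sigma> 0) * b" by linarith
  have "V (Suc k) u v = g * DX u (x (Suc k)) + t k * (\<mu> / 2 * N) + 1 / \<sigma> 0 * DY v (y (Suc k))
      - t k * q (Suc k) (v - y (Suc k)) + lag (Suc k)"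
    unfolding V_def gamma_Suc_DX[OF u] N_def g_def by simp
  moreover have "V k u v = g * DX u (x k) + 1 / \<sigma> 0 * DY v (y k) - t (k - 1) * q k (v - y k) + lag k"
    unfolding V_def g_def ..
  moreover have "\<delta> / 2 * (g * a + 1 / \<sigma> 0 * b) = \<delta> / 2 * (g * a) + \<delta> / 2 * (1 / \<sigma> 0 * b)"
    by (rule distrib_left)
  ultimately show ?thesis
    unfolding g_def[symmetric] a_def[symmetric] b_def[symmetric]
    using main drift young DXs DYs Rs Rx Ry by linarith
qed

lemma energy_sum:
  assumes "u \<in> edom f" "v \<in> edom h"
  shows "(\<Sum>k<K. t k * (Lr (x (Suc k)) v - Lr u (y (Suc k)))) + V K u v
    + \<delta> / 2 * (\<Sum>k<K. \<gamma> k / \<sigma> 0 * (dx (Suc k))\<^sup>2 + 1 / \<sigma> 0 * (dy (Suc k))\<^sup>2) \<le> V 0 u v"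
proof (induction K)
  case (Suc K)
  then show ?case using V_step[OF assms, of K] by (simp add: distrib_left)
qed simp

end

context apd_energy
begin

section \<open>The ergodic gap\<close>

lemma weight_sum_pos: "K \<ge> 1 \<Longrightarrow> weight_sum t K > 0"
  unfolding weight_sum_def using t_pos by (intro sum_pos) (auto simp: lessThan_empty_iff)

lemma x_avg_dom: "K \<ge> 1 \<Longrightarrow> weighted_avg t x K \<in> edom f"
  by (rule weighted_avg_Jensen(1)[OF fr_convex x_dom t_pos])

lemma y_avg_dom: "K \<ge> 1 \<Longrightarrow> weighted_avg t y K \<in> edom h"
  by (rule weighted_avg_Jensen(1)[OF hr_convex y_dom t_pos])

lemma weighted_gap_le_sum:
  assumes u: "u \<in> edom f" and v: "v \<in> edom h" and K: "K \<ge> 1"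
  shows "weight_sum t K * (Lr (weighted_avg t x K) v - Lr u (weighted_avg t y K))
    \<le> (\<Sum>k<K. t k * (Lr (x (Suc k)) v - Lr u (y (Suc k))))"
proof -
  have "convex_on (edom f) (\<lambda>w. fr w + \<Phi> w v)"
    by (intro convex_on_add fr_convex convex_on_subset[OF Phi_x_convex[OF v]] dom_f_convex) simp
  from weighted_avg_Jensen(2)[OF this x_dom t_pos K]
  have X: "weight_sum t K * (fr (weighted_avg t x K) + \<Phi> (weighted_avg t x K) v)
      \<le> (\<Sum>k<K. t k * (fr (x (Suc k)) + \<Phi> (x (Suc k)) v))" .
  have "convex_on UNIV (\<lambda>w. - \<Phi> u w)" using Phi_y_concave[OF u] by (simp add: concave_on_def)
  then have "convex_on (edom h) (\<lambda>w. - \<Phi> u w)"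
    by (rule convex_on_subset) (use hr_convex in \<open>auto simp: convex_on_def\<close>)
  then have "convex_on (edom h) (\<lambda>w. hr w + - \<Phi> u w)"
    by (intro convex_on_add hr_convex)
  from weighted_avg_Jensen(2)[OF this y_dom t_pos K]
  have Y: "weight_sum t K * (hr (weighted_avg t y K) + - \<Phi> u (weighted_avg t y K))
      \<le> (\<Sum>k<K. t k * (hr (y (Suc k)) + - \<Phi> u (y (Suc k))))" .
  have "(\<Sum>k<K. t k * (Lr (x (Suc k)) v - Lr u (y (Suc k))))
      = (\<Sum>k<K. t k * (fr (x (Suc k)) + \<Phi> (x (Suc k)) v)
        + t k * (hr (y (Suc k)) + - \<Phi> u (y (Suc k))) - t k * (hr v + fr u))"
    by (simp add: Lr_def algebra_simps)
  also have "\<dots> = (\<Sum>k<K. t k * (fr (x (Suc k)) + \<Phi> (x (Suc k)) v))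
      + (\<Sum>k<K. t k * (hr (y (Suc k)) + - \<Phi> u (y (Suc k)))) - weight_sum t K * (hr v + fr u)"
    unfolding weight_sum_def sum_distrib_right by (simp only: sum.distrib sum_subtractf)
  finally have "(\<Sum>k<K. t k * (Lr (x (Suc k)) v - Lr u (y (Suc k)))) = \<dots>" .
  moreover have "weight_sum t K * (Lr (weighted_avg t x K) v - Lr u (weighted_avg t y K))
      = weight_sum t K * (fr (weighted_avg t x K) + \<Phi> (weighted_avg t x K) v)
      + weight_sum t K * (hr (weighted_avg t y K) + - \<Phi> u (weighted_avg t y K))
      - weight_sum t K * (hr v + fr u)"
    by (simp add: Lr_def algebra_simps)
  ultimately show ?thesis using X Y by linarith
qed

lemma V_nonneg:
  assumes "u \<in> edom f" "v \<in> edom h"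
  shows "0 \<le> V k u v"
proof -
  have "0 \<le> \<gamma> k / \<sigma> 0 * DX u (x k)"
    using DX_nonneg[OF assms(1)] gamma_pos[of k] sigma0 by simp
  moreover have "0 \<le> (1 - (c\<alpha> + c\<beta>)) / \<sigma> 0 * DY v (y k)"
    using DY_nonneg[OF assms(2)] step_constants sigma0 by (intro mult_nonneg_nonneg divide_nonneg_nonneg) auto
  ultimately show ?thesis using V_lower[OF assms(2), of k u] by linarith
qed

lemma initial_dist_eq:
  assumes "u \<in> edom f" "v \<in> edom h"
  shows "initial_dist \<phi>X \<phi>Y (\<tau> 0) (\<sigma> 0) (x 0) (y 0) u v = ereal (V 0 u v)"
  unfolding initial_dist_def V_0 bregman_X[OF assms(1)] bregman_Y[OF assms(2)] by simp

lemma gap_eq: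
  assumes "u \<in> edom f" "v \<in> edom h" "K \<ge> 1"
  shows "gap L t x y K u v = ereal (Lr (weighted_avg t x K) v - Lr u (weighted_avg t y K))"
  unfolding gap_def using assms by (simp add: lagrangian_real x_avg_dom y_avg_dom)

text \<open>
  Outside the domains the gap is \<open>-\<infinity>\<close>, because the averages lie in the domains.
\<close>
lemma gap_le:
  assumes K: "K \<ge> 1"
  shows "gap L t x y K u v \<le> ereal (1 / weight_sum t K)
    * initial_dist \<phi>X \<phi>Y (\<tau> 0) (\<sigma> 0) (x 0) (y 0) u v"
proof (cases "u \<in> edom f \<and> v \<in> edom h")
  case True
  then have uv: "u \<in> edom f" "v \<in> edom h" by auto
  have "0 \<le> \<delta> / 2 * (\<Sum>k<K. \<gamma> k / \<sigma> 0 * (dx (Suc k))\<^sup>2 + 1 / \<sigma> 0 * (dy (Suc k))\<^sup>2)"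
    using step_constants(1) sigma0 less_imp_le[OF gamma_pos]
    by (intro mult_nonneg_nonneg sum_nonneg add_nonneg_nonneg divide_nonneg_nonneg) simp_all
  then have "weight_sum t K * (Lr (weighted_avg t x K) v - Lr u (weighted_avg t y K)) \<le> V 0 u v"
    using weighted_gap_le_sum[OF uv K] energy_sum[OF uv, of K] V_nonneg[OF uv, of K] by linarith
  then have "Lr (weighted_avg t x K) v - Lr u (weighted_avg t y K) \<le> 1 / weight_sum t K * V 0 u v"
    using weight_sum_pos[OF K] by (simp add: field_simps)
  then show ?thesis by (simp add: gap_eq[OF uv K] initial_dist_eq[OF uv])
next
  case False
  have "gap L t x y K u v = -\<infinity>"
  proof (cases "u \<in> edom f")
    case True
    with False have "v \<notin> edom h" by blast
    then show ?thesis
      unfolding gap_def using True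
      by (simp add: lagrangian_MInf x_avg_dom[OF K] lagrangian_real y_avg_dom[OF K])
  next
    case False
    then show ?thesis
      unfolding gap_def
      by (cases "v \<in> edom h")
         (simp_all add: lagrangian_PInf lagrangian_MInf lagrangian_real x_avg_dom[OF K])
  qed
  then show ?thesis by simp
qed

lemma gamma_ge_gamma0: "\<gamma> 0 \<le> \<gamma> k"
proof -
  have "(\<sigma> 0)\<^sup>2 \<le> (\<sigma> k)\<^sup>2" using sigma_ge_sigma0[of k] sigma0 by (intro power_mono) auto
  then have "\<gamma> 0 * (\<sigma> 0 * \<tau> 0) \<le> \<gamma> k * (\<sigma> 0 * \<tau> 0)" by (simp only: gamma_eq_sigma)
  then show ?thesis using sigma0 tau0 by (simp add: mult_le_cancel_right)
qed

end

section \<open>Behaviour relative to a saddle point\<close>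

locale apd_saddle = apd_energy f h \<Phi> \<phi>X \<phi>Y \<mu> Lxx Lyx Lyy \<tau> \<sigma> \<gamma> \<theta> x y \<delta> c\<alpha> c\<beta>
  for f :: "'a::real_normed_vector \<Rightarrow> ereal"
    and h :: "'b::real_normed_vector \<Rightarrow> ereal"
    and \<Phi> :: "'a \<Rightarrow> 'b \<Rightarrow> real"
    and \<phi>X :: "'a \<Rightarrow> ereal" and \<phi>Y :: "'b \<Rightarrow> ereal"
    and \<mu> Lxx Lyx Lyy :: real
    and \<tau> \<sigma> \<gamma> \<theta> :: "nat \<Rightarrow> real"
    and x :: "nat \<Rightarrow> 'a" and y :: "nat \<Rightarrow> 'b"
    and \<delta> c\<alpha> c\<beta> :: real +
  fixes xs :: 'a and ys :: 'b
  assumes saddle: "saddle_point L xs ys"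
begin

lemma xs_dom: "xs \<in> edom f" and ys_dom: "ys \<in> edom h"
  and Lr_saddle: "u \<in> edom f \<Longrightarrow> v \<in> edom h \<Longrightarrow> Lr xs v \<le> Lr u ys"
  using saddle unfolding saddle_point_iff by blast+

lemma V_saddle_step:
  "V (Suc k) xs ys + \<delta> / 2 * (\<gamma> k / \<sigma> 0 * (dx (Suc k))\<^sup>2 + 1 / \<sigma> 0 * (dy (Suc k))\<^sup>2) \<le> V k xs ys"
proof -
  have "0 \<le> t k * (Lr (x (Suc k)) ys - Lr xs (y (Suc k)))"
    using Lr_saddle[OF x_dom y_dom, of "Suc k" "Suc k"] less_imp_le[OF t_pos]
    by (intro mult_nonneg_nonneg) auto
  then show ?thesis using V_step[OF xs_dom ys_dom, of k] by linarith
qed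

lemma V_saddle_Suc_le: "V (Suc k) xs ys \<le> V k xs ys"
proof -
  have "0 \<le> \<delta> / 2 * (\<gamma> k / \<sigma> 0 * (dx (Suc k))\<^sup>2 + 1 / \<sigma> 0 * (dy (Suc k))\<^sup>2)"
    using step_constants(1) sigma0 gamma_pos[of k] by simp
  then show ?thesis using V_saddle_step[of k] by linarith
qed

lemma V_saddle_mono: "m \<le> n \<Longrightarrow> V n xs ys \<le> V m xs ys"
  using lift_Suc_antimono_le[of "\<lambda>k. V k xs ys"] V_saddle_Suc_le by blast

lemma saddle_energy_bound:
  "\<gamma> k * DX xs (x k) + (1 - (c\<alpha> + c\<beta>)) * DY ys (y k) \<le> \<sigma> 0 * V 0 xs ys"
proof -
  have "\<gamma> k / \<sigma> 0 * DX xs (x k) + (1 - (c\<alpha> + c\<beta>)) / \<sigma> 0 * DY ys (y k) \<le> V 0 xs ys"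
    using V_lower[OF ys_dom, of k xs] V_saddle_mono[of 0 k] by simp
  then have "\<sigma> 0 * (\<gamma> k / \<sigma> 0 * DX xs (x k) + (1 - (c\<alpha> + c\<beta>)) / \<sigma> 0 * DY ys (y k))
      \<le> \<sigma> 0 * V 0 xs ys"
    using sigma0 by (intro mult_left_mono) auto
  then show ?thesis using sigma0 by (simp add: distrib_left)
qed

lemma gamma_DX_bound: "\<gamma> k * DX xs (x k) \<le> \<sigma> 0 * V 0 xs ys"
proof -
  have "0 \<le> (1 - (c\<alpha> + c\<beta>)) * DY ys (y k)"
    using step_constants DY_nonneg[OF ys_dom] by (intro mult_nonneg_nonneg) auto
  then show ?thesis using saddle_energy_bound[of k] by linarith
qed

lemma DX_bound: "DX xs (x k) \<le> \<sigma> 0 * V 0 xs ys / \<gamma> 0"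
proof -
  have "\<gamma> 0 * DX xs (x k) \<le> \<gamma> k * DX xs (x k)"
    by (intro mult_right_mono gamma_ge_gamma0 DX_nonneg xs_dom)
  then show ?thesis using gamma_DX_bound[of k] gamma_pos[of 0] by (simp add: field_simps)
qed

lemma DY_bound:
  assumes "\<delta> > 0"
  shows "DY ys (y k) \<le> \<sigma> 0 * V 0 xs ys / \<delta>"
proof -
  have "\<delta> * DY ys (y k) \<le> (1 - (c\<alpha> + c\<beta>)) * DY ys (y k)"
    using step_constants DY_nonneg[OF ys_dom] by (intro mult_right_mono) auto
  moreover have "0 \<le> \<gamma> k * DX xs (x k)"
    using gamma_pos[of k] DX_nonneg[OF xs_dom, of k] by simp
  ultimately have "\<delta> * DY ys (y k) \<le> \<sigma> 0 * V 0 xs ys"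
    using saddle_energy_bound[of k] by linarith
  then show ?thesis using assms by (simp add: field_simps)
qed

lemma x_bounded: obtains B where "\<And>k. norm (xs - x k) \<le> B"
  using norm_le_of_half_square_le[OF order_trans[OF DX_ge[OF xs_dom] DX_bound]] by blast

lemma y_bounded:
  assumes "\<delta> > 0"
  obtains B where "\<And>k. norm (ys - y k) \<le> B"
  using norm_le_of_half_square_le[OF order_trans[OF DY_ge[OF ys_dom] DY_bound[OF assms]]] by blast

lemma saddle_gap_nonneg:
  assumes "K \<ge> 1"
  shows "0 \<le> gap L t x y K xs ys"
  using Lr_saddle[OF x_avg_dom[OF assms] y_avg_dom[OF assms]]
  by (simp add: gap_eq[OF xs_dom ys_dom assms])

text \<open>
  Summability of the squared steps with weights \<open>\<gamma>\<^sub>k\<close> and \<open>1\<close>. Because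
  \<open>\<gamma>\<^sub>k = \<sigma>\<^sub>0 \<tau>\<^sub>0 / \<tau>\<^sub>k\<^sup>2\<close>, the weight in \<open>x\<close> is exactly strong enough for the steps to be negligible
  against \<open>\<tau>\<^sub>k\<close>, which the limit of \<open>one_step\<close> requires when \<open>\<tau>\<^sub>k \<rightarrow> 0\<close>.
\<close>
lemma steps_vanish:
  assumes "\<delta> > 0"
  shows "(\<lambda>k. dx (Suc k) / \<tau> k) \<longlonglongrightarrow> 0" and "dx \<longlonglongrightarrow> 0" and "dy \<longlonglongrightarrow> 0"
proof -
  define a where "a k = \<gamma> k / \<sigma> 0 * (dx (Suc k))\<^sup>2 + 1 / \<sigma> 0 * (dy (Suc k))\<^sup>2" for k
  have dx_part: "0 \<le> \<gamma> k / \<sigma> 0 * (dx (Suc k))\<^sup>2" and dy_part: "0 \<le> 1 / \<sigma> 0 * (dy (Suc k))\<^sup>2" for k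
    using sigma0 gamma_pos[of k] by simp_all
  have sum_le: "V K xs ys + \<delta> / 2 * (\<Sum>k<K. a k) \<le> V 0 xs ys" for K
  proof (induction K)
    case (Suc K)
    then show ?case using V_saddle_step[of K] by (simp add: a_def distrib_left)
  qed simp
  have "(\<Sum>k<K. a k) \<le> 2 * V 0 xs ys / \<delta>" for K
  proof -
    have "\<delta> / 2 * (\<Sum>k<K. a k) \<le> V 0 xs ys"
      using sum_le[of K] V_nonneg[OF xs_dom ys_dom, of K] by linarith
    then show ?thesis using assms by (simp add: field_simps)
  qed
  moreover have "0 \<le> a k" for k using dx_part[of k] dy_part[of k] by (simp add: a_def)
  ultimately have "summable a" by (intro summableI_nonneg_bounded)
  then have a0: "a \<longlonglongrightarrow> 0" by (rule summable_LIMSEQ_zero)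
  have "(\<lambda>k. \<gamma> k / \<sigma> 0 * (dx (Suc k))\<^sup>2) \<longlonglongrightarrow> 0"
  proof (rule tendsto_zero_dominated[OF _ a0])
    show "\<bar>\<gamma> k / \<sigma> 0 * (dx (Suc k))\<^sup>2\<bar> \<le> a k" for k
      using dx_part[of k] dy_part[of k] unfolding a_def by linarith
  qed
  moreover have "(dx (Suc k) / \<tau> k)\<^sup>2 = \<gamma> k / \<sigma> 0 * (dx (Suc k))\<^sup>2 * (1 / \<tau> 0)" for k
  proof -
    have "(dx (Suc k) / \<tau> k)\<^sup>2 = (dx (Suc k))\<^sup>2 * (\<gamma> k / (\<sigma> k * \<tau> k))"
      using gamma_eq[of k] sigma_pos[of k] tau_pos[of k] by (simp add: power2_eq_square field_simps)
    also have "\<dots> = (dx (Suc k))\<^sup>2 * (\<gamma> k / (\<sigma> 0 * \<tau> 0))" by (simp only: sigma_tau[of k])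
    finally show ?thesis by simp
  qed
  ultimately have "(\<lambda>k. (dx (Suc k) / \<tau> k)\<^sup>2) \<longlonglongrightarrow> 0"
    using tendsto_mult_left_zero[of "\<lambda>k. \<gamma> k / \<sigma> 0 * (dx (Suc k))\<^sup>2" sequentially "1 / \<tau> 0"] by simp
  then show lim: "(\<lambda>k. dx (Suc k) / \<tau> k) \<longlonglongrightarrow> 0" by (rule tendsto_zero_of_square)
  have "\<tau> k \<le> \<tau> 0" for k
  proof -
    have "\<sigma> 0 * \<tau> k \<le> \<sigma> k * \<tau> k"
      by (intro mult_right_mono sigma_ge_sigma0 less_imp_le[OF tau_pos])
    then have "\<sigma> 0 * \<tau> k \<le> \<sigma> 0 * \<tau> 0" unfolding sigma_tau[of k] .
    then show ?thesis using sigma0 by simp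
  qed
  then have "dx (Suc k) \<le> dx (Suc k) / \<tau> k * \<tau> 0" for k
    using mult_left_mono[of "\<tau> k" "\<tau> 0" "dx (Suc k) / \<tau> k"] tau_pos[of k] dx_nonneg[of "Suc k"] by simp
  then have "\<bar>dx (Suc k)\<bar> \<le> dx (Suc k) / \<tau> k * \<tau> 0" for k
    using dx_nonneg[of "Suc k"] by simp
  then have "(\<lambda>k. dx (Suc k)) \<longlonglongrightarrow> 0"
    by (rule tendsto_zero_dominated) (rule tendsto_mult_left_zero[OF lim])
  then show "dx \<longlonglongrightarrow> 0" by (rule LIMSEQ_imp_Suc)
  have "(\<lambda>k. 1 / \<sigma> 0 * (dy (Suc k))\<^sup>2) \<longlonglongrightarrow> 0"
  proof (rule tendsto_zero_dominated[OF _ a0])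
    show "\<bar>1 / \<sigma> 0 * (dy (Suc k))\<^sup>2\<bar> \<le> a k" for k
      using dx_part[of k] dy_part[of k] unfolding a_def by linarith
  qed
  then have "(\<lambda>k. (dy (Suc k))\<^sup>2) \<longlonglongrightarrow> 0"
    using tendsto_mult_right_zero[of "\<lambda>k. 1 / \<sigma> 0 * (dy (Suc k))\<^sup>2" sequentially "\<sigma> 0"] sigma0 by simp
  then have "(\<lambda>k. dy (Suc k)) \<longlonglongrightarrow> 0" by (rule tendsto_zero_of_square)
  then show "dy \<longlonglongrightarrow> 0" by (rule LIMSEQ_imp_Suc)
qed

lemma drift_vanishes:
  assumes "\<delta> > 0"
  shows "(\<lambda>k. drift k v) \<longlonglongrightarrow> 0"
proof -
  obtain B where B: "\<And>k. norm (ys - y k) \<le> B" using y_bounded[OF assms] by blast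
  define C where "C = norm (v - ys) + B"
  have C: "norm (v - y k) \<le> C" for k
    using norm_triangle_ineq[of "v - ys" "ys - y k"] B[of k] by (simp add: C_def)
  define n where "n k = Lyy * dy k + Lyx * dx k" for k
  have n_nonneg: "0 \<le> n k" for k
    using Lyy_nonneg Lyx_pos dx_nonneg dy_nonneg by (simp add: n_def)
  have qC: "\<bar>q k (v - y k)\<bar> \<le> n k * C" for k
    using q_apply_le[of k "v - y k"] mult_left_mono[OF C n_nonneg] by (simp add: n_def order_trans)
  have n0: "n \<longlonglongrightarrow> 0"
    unfolding n_def using tendsto_add[OF tendsto_mult_right_zero[OF steps_vanish(3)[OF assms], of Lyy]
        tendsto_mult_right_zero[OF steps_vanish(2)[OF assms], of Lyx]] by simp
  have bound: "\<bar>drift k v\<bar> \<le> n (Suc k) * C + n k * C + n k * dy (Suc k) + Lxx / 2 * (dx (Suc k))\<^sup>2" for k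
  proof -
    have le: "\<theta> k * \<bar>z\<bar> \<le> \<bar>z\<bar>" for z
      using mult_right_mono[OF theta_le_1[of k], of "\<bar>z\<bar>"] by simp
    have "\<bar>q k (y (Suc k) - y k)\<bar> \<le> n k * dy (Suc k)"
      using q_apply_le[of k "y (Suc k) - y k"] by (simp add: n_def dy_def)
    then have 1: "\<bar>\<theta> k * q k (y (Suc k) - y k)\<bar> \<le> n k * dy (Suc k)"
      using le[of "q k (y (Suc k) - y k)"] theta_pos[of k] by (simp add: abs_mult)
    have 2: "\<bar>\<theta> k * q k (v - y k)\<bar> \<le> n k * C"
      using le[of "q k (v - y k)"] theta_pos[of k] qC[of k] by (simp add: abs_mult)
    have 3: "0 \<le> Lxx / 2 * (dx (Suc k))\<^sup>2" using Lxx_nonneg by simp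
    show ?thesis unfolding drift_def using 1 2 3 qC[of "Suc k"] by linarith
  qed
  have nS: "(\<lambda>k. n (Suc k)) \<longlonglongrightarrow> 0" using LIMSEQ_Suc[OF n0] .
  have dxS: "(\<lambda>k. dx (Suc k)) \<longlonglongrightarrow> 0" using LIMSEQ_Suc[OF steps_vanish(2)[OF assms]] .
  have dyS: "(\<lambda>k. dy (Suc k)) \<longlonglongrightarrow> 0" using LIMSEQ_Suc[OF steps_vanish(3)[OF assms]] .
  have "(\<lambda>k. n (Suc k) * C + n k * C + n k * dy (Suc k) + Lxx / 2 * (dx (Suc k))\<^sup>2)
      \<longlonglongrightarrow> 0 * C + 0 * C + 0 * 0 + Lxx / 2 * 0\<^sup>2"
    by (intro tendsto_intros n0 nS dxS dyS)
  then have "(\<lambda>k. n (Suc k) * C + n k * C + n k * dy (Suc k) + Lxx / 2 * (dx (Suc k))\<^sup>2) \<longlonglongrightarrow> 0"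
    by simp
  with bound show ?thesis by (rule tendsto_zero_dominated)
qed

lemma DX_difference_bound:
  assumes "\<mu> > 0" "u \<in> edom f"
  shows "\<bar>(1 / \<tau> k) * (DX u (x k) - DX u (x (Suc k)))\<bar>
    \<le> dx (Suc k) / \<tau> k * ((norm (u - x k) + norm (u - x (Suc k))) / 2)"
proof -
  define a b where "a = norm (u - x k)" and "b = norm (u - x (Suc k))"
  have "DX u (x k) - DX u (x (Suc k)) = (a - b) * ((a + b) / 2)"
    unfolding DX_if_mu_pos[OF assms(2,1)] a_def b_def
    by (simp add: power2_eq_square field_simps)
  moreover have "\<bar>a - b\<bar> \<le> dx (Suc k)"
    using norm_triangle_ineq3[of "u - x k" "u - x (Suc k)"] by (simp add: a_def b_def dx_def)
  moreover have "0 \<le> (a + b) / 2" by (simp add: a_def b_def)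
  ultimately have "\<bar>DX u (x k) - DX u (x (Suc k))\<bar> \<le> dx (Suc k) * ((a + b) / 2)"
    using mult_right_mono[of "\<bar>a - b\<bar>" "dx (Suc k)" "(a + b) / 2"] by (simp only: abs_mult abs_of_nonneg)
  then have "1 / \<tau> k * \<bar>DX u (x k) - DX u (x (Suc k))\<bar> \<le> 1 / \<tau> k * (dx (Suc k) * ((a + b) / 2))"
    using less_imp_le[OF tau_pos[of k]] by (intro mult_left_mono) auto
  then show ?thesis using tau_pos[of k] by (simp add: abs_mult a_def b_def)
qed

text \<open>
  An upper bound that does not presuppose that limit points of the iterates lie in \<open>dom f\<close>; it serves
  to prove that they do.
\<close>
lemma DX_difference_saddle_bounded:
  assumes "\<delta> > 0"
  obtains C where "\<And>k. (1 / \<tau> k) * (DX xs (x k) - DX xs (x (Suc k))) \<le> C"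
proof (cases "\<mu> = 0")
  case True
  have "(1 / \<tau> k) * (DX xs (x k) - DX xs (x (Suc k))) \<le> 1 / \<tau> 0 * (\<sigma> 0 * V 0 xs ys / \<gamma> 0)" for k
  proof -
    have "\<tau> k = \<tau> 0" using constant_steps[OF True] by blast
    moreover have "1 / \<tau> 0 * (DX xs (x k) - DX xs (x (Suc k))) \<le> 1 / \<tau> 0 * (\<sigma> 0 * V 0 xs ys / \<gamma> 0)"
      using DX_bound[of k] DX_nonneg[OF xs_dom, of "Suc k"] tau0 by (intro mult_left_mono) auto
    ultimately show ?thesis by simp
  qed
  then show ?thesis using that by blast
next
  case False
  then have mu: "\<mu> > 0" using mu_nonneg by simp
  obtain B where B: "\<And>k. norm (xs - x k) \<le> B" using x_bounded by blast
  obtain E where E: "\<And>k. \<bar>dx (Suc k) / \<tau> k\<bar> \<le> E"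
    using convergent_imp_bounded[OF steps_vanish(1)[OF assms]] by (auto simp: bounded_iff)
  have "(1 / \<tau> k) * (DX xs (x k) - DX xs (x (Suc k))) \<le> E * B" for k
  proof -
    have "(1 / \<tau> k) * (DX xs (x k) - DX xs (x (Suc k)))
        \<le> dx (Suc k) / \<tau> k * ((norm (xs - x k) + norm (xs - x (Suc k))) / 2)"
      using DX_difference_bound[OF mu xs_dom, of k] by linarith
    also have "\<dots> \<le> E * B"
    proof (rule mult_mono)
      show "dx (Suc k) / \<tau> k \<le> E" using E[of k] by linarith
      show "(norm (xs - x k) + norm (xs - x (Suc k))) / 2 \<le> B" using B[of k] B[of "Suc k"] by simp
      show "0 \<le> E" using E[of k] by linarith
    qed simp
    finally show ?thesis .
  qed
  then show ?thesis using that by blast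
qed

lemma tendsto_next_x:
  assumes "\<delta> > 0" "strict_mono r" "(\<lambda>n. x (r n)) \<longlonglongrightarrow> l"
  shows "(\<lambda>n. x (Suc (r n))) \<longlonglongrightarrow> l"
proof -
  have "(\<lambda>n. dx (Suc (r n))) \<longlonglongrightarrow> 0"
    using LIMSEQ_subseq_LIMSEQ[OF LIMSEQ_Suc[OF steps_vanish(2)[OF assms(1)]] assms(2)] by (simp add: o_def)
  then have "(\<lambda>n. x (Suc (r n)) - x (r n)) \<longlonglongrightarrow> 0"
    by (simp add: dx_def tendsto_norm_zero_iff)
  from tendsto_add[OF this assms(3)] show ?thesis by simp
qed

lemma tendsto_next_y:
  assumes "\<delta> > 0" "strict_mono r" "(\<lambda>n. y (r n)) \<longlonglongrightarrow> m"
  shows "(\<lambda>n. y (Suc (r n))) \<longlonglongrightarrow> m"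
proof -
  have "(\<lambda>n. dy (Suc (r n))) \<longlonglongrightarrow> 0"
    using LIMSEQ_subseq_LIMSEQ[OF LIMSEQ_Suc[OF steps_vanish(3)[OF assms(1)]] assms(2)] by (simp add: o_def)
  then have "(\<lambda>n. y (Suc (r n)) - y (r n)) \<longlonglongrightarrow> 0"
    by (simp add: dy_def tendsto_norm_zero_iff)
  from tendsto_add[OF this assms(3)] show ?thesis by simp
qed

text \<open>
  With constant \<open>\<tau>\<close> this is continuity of the Bregman distance at \<open>l \<in> dom f\<close>; with \<open>\<tau>\<^sub>k \<rightarrow> 0\<close> it is the
  fast decay of the steps.
\<close>
lemma DX_difference_vanishes:
  assumes \<delta>: "\<delta> > 0" and u: "u \<in> edom f" and l: "l \<in> edom f"
    and r: "strict_mono r" "(\<lambda>n. x (r n)) \<longlonglongrightarrow> l"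
  shows "(\<lambda>n. (1 / \<tau> (r n)) * (DX u (x (r n)) - DX u (x (Suc (r n))))) \<longlonglongrightarrow> 0"
proof (cases "\<mu> = 0")
  case True
  have "(\<lambda>n. (1 / \<tau> 0) * (DX u (x (r n)) - DX u (x (Suc (r n))))) \<longlonglongrightarrow> (1 / \<tau> 0) * (DX u l - DX u l)"
    by (intro tendsto_intros tendsto_bregman_real[OF phiX l] r(2) tendsto_next_x[OF \<delta> r])
  moreover have "\<tau> (r n) = \<tau> 0" for n using constant_steps[OF True] by blast
  ultimately show ?thesis by (simp only: diff_self mult_zero_right)
next
  case False
  then have mu: "\<mu> > 0" using mu_nonneg by simp
  have "(\<lambda>n. dx (Suc (r n)) / \<tau> (r n)) \<longlonglongrightarrow> 0"
    using LIMSEQ_subseq_LIMSEQ[OF steps_vanish(1)[OF \<delta>] r(1)] by (simp add: o_def)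
  then have "(\<lambda>n. dx (Suc (r n)) / \<tau> (r n) * ((norm (u - x (r n)) + norm (u - x (Suc (r n)))) / 2))
      \<longlonglongrightarrow> 0 * ((norm (u - l) + norm (u - l)) / 2)"
    by (intro tendsto_intros r(2) tendsto_next_x[OF \<delta> r]) simp_all
  then have "(\<lambda>n. dx (Suc (r n)) / \<tau> (r n) * ((norm (u - x (r n)) + norm (u - x (Suc (r n)))) / 2))
      \<longlonglongrightarrow> 0" by simp
  with DX_difference_bound[OF mu u] show ?thesis by (rule tendsto_zero_dominated)
qed

lemma DY_difference_vanishes:
  assumes \<delta>: "\<delta> > 0" and m: "m \<in> edom h"
    and r: "strict_mono r" "(\<lambda>n. y (r n)) \<longlonglongrightarrow> m"
  shows "(\<lambda>n. (1 / \<sigma> (r n)) * (DY v (y (r n)) - DY v (y (Suc (r n))))) \<longlonglongrightarrow> 0"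
proof -
  have "(\<lambda>n. DY v (y (r n)) - DY v (y (Suc (r n)))) \<longlonglongrightarrow> DY v m - DY v m"
    by (intro tendsto_intros tendsto_bregman_real[OF phiY m] r(2) tendsto_next_y[OF \<delta> r])
  then have lim: "(\<lambda>n. (1 / \<sigma> 0) * \<bar>DY v (y (r n)) - DY v (y (Suc (r n)))\<bar>) \<longlonglongrightarrow> 0"
    by (intro tendsto_mult_right_zero tendsto_rabs_zero) simp
  have "\<bar>(1 / \<sigma> k) * z\<bar> \<le> (1 / \<sigma> 0) * \<bar>z\<bar>" for k z
  proof -
    have "1 / \<sigma> k \<le> 1 / \<sigma> 0" using sigma_ge_sigma0[of k] sigma0 by (simp add: frac_le)
    from mult_right_mono[OF this, of "\<bar>z\<bar>"] show ?thesis using sigma_pos[of k] by (simp add: abs_mult)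
  qed
  then have "\<bar>(1 / \<sigma> (r n)) * (DY v (y (r n)) - DY v (y (Suc (r n))))\<bar>
      \<le> (1 / \<sigma> 0) * \<bar>DY v (y (r n)) - DY v (y (Suc (r n)))\<bar>" for n by blast
  note bnd = this
  show ?thesis by (rule tendsto_zero_dominated[OF bnd lim])
qed

text \<open>
  \<open>one_step\<close> is used twice. At the known saddle point its right-hand side stays bounded, so lower
  semicontinuity places the limit \<open>(l, m)\<close> in \<open>dom f \<times> dom h\<close>. Only then is the Bregman distance known
  to be continuous there, and for every \<open>(u, v)\<close> the error terms vanish, which leaves
  \<open>L(l, v) \<le> L(u, m)\<close>.
\<close>
lemma limit_point_saddle:
  assumes \<delta>: "\<delta> > 0" and r: "strict_mono r"
    and xr: "(\<lambda>n. x (r n)) \<longlonglongrightarrow> l" and yr: "(\<lambda>n. y (r n)) \<longlonglongrightarrow> m"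
  shows "saddle_point L l m"
proof -
  note x' = tendsto_next_x[OF \<delta> r xr] and y' = tendsto_next_y[OF \<delta> r yr]
  have \<Phi>_lim: "(\<lambda>n. \<Phi> (a n) (b n)) \<longlonglongrightarrow> \<Phi> a0 b0"
    if "a \<longlonglongrightarrow> a0" "b \<longlonglongrightarrow> b0" for a b a0 b0
  proof -
    have "isCont (\<lambda>(u, v). \<Phi> u v) (a0, b0)"
      using Phi_continuous by (simp add: continuous_on_eq_continuous_at)
    from isCont_tendsto_compose[OF this tendsto_Pair[OF that]] show ?thesis by simp
  qed
  \<comment> \<open>The bound on \<open>f + h\<close> at the new iterate: a part that converges without any knowledge of
    the domains, and the two differences of Bregman distances.\<close>
  define main where "main u v n = fr u + hr v - \<Phi> (x (Suc (r n))) v + \<Phi> u (y (Suc (r n))) + drift (r n) v" for u v n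
  define bx where "bx u n = (1 / \<tau> (r n)) * (DX u (x (r n)) - DX u (x (Suc (r n))))" for u n
  define by' where "by' v n = (1 / \<sigma> (r n)) * (DY v (y (r n)) - DY v (y (Suc (r n))))" for v n
  have main_lim: "main u v \<longlonglongrightarrow> fr u + hr v - \<Phi> l v + \<Phi> u m + 0" for u v
    unfolding main_def
    by (intro tendsto_intros \<Phi>_lim x' y' LIMSEQ_subseq_LIMSEQ[OF drift_vanishes[OF \<delta>] r, unfolded o_def])
  have step: "f (x (Suc (r n))) + h (y (Suc (r n))) \<le> ereal (main u v n + bx u n + by' v n)"
    if u: "u \<in> edom f" and v: "v \<in> edom h" for u v n
  proof -
    let ?k = "r n"
    have "0 \<le> (1 / \<tau> ?k) * DX (x (Suc ?k)) (x ?k)" "0 \<le> (1 / \<sigma> ?k) * DY (y (Suc ?k)) (y ?k)"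
      using DX_nonneg[OF x_dom, of "Suc ?k" ?k] DY_nonneg[OF y_dom, of "Suc ?k" ?k]
        tau_pos[of ?k] sigma_pos[of ?k] by simp_all
    moreover have "(1 / \<tau> ?k) * (DX u (x ?k) - DX u (x (Suc ?k)) - DX (x (Suc ?k)) (x ?k))
        = bx u n - (1 / \<tau> ?k) * DX (x (Suc ?k)) (x ?k)"
      unfolding bx_def by (rule right_diff_distrib)
    moreover have "(1 / \<sigma> ?k) * (DY v (y ?k) - DY v (y (Suc ?k)) - DY (y (Suc ?k)) (y ?k))
        = by' v n - (1 / \<sigma> ?k) * DY (y (Suc ?k)) (y ?k)"
      unfolding by'_def by (rule right_diff_distrib)
    moreover have "0 \<le> \<mu> / 2 * (norm (u - x (Suc ?k)))\<^sup>2" using mu_nonneg by simp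
    ultimately have "fr (x (Suc ?k)) + hr (y (Suc ?k)) \<le> main u v n + bx u n + by' v n"
      using one_step[OF u v, of ?k] unfolding Lr_def main_def by linarith
    then show ?thesis by (simp add: f_fin[OF x_dom] h_fin[OF y_dom])
  qed
  have epi: "closed (epi f)" "closed (epi h)"
    using f_closed_convex h_closed_convex by (auto simp: closed_convex_fun_def)
  have dom: "l \<in> edom f" "m \<in> edom h"
  proof -
    obtain M where M: "\<And>n. \<bar>main xs ys n\<bar> \<le> M"
      using convergent_imp_bounded[OF main_lim[of xs ys]] by (auto simp: bounded_iff)
    obtain C where C: "\<And>n. bx xs n \<le> C"
      using DX_difference_saddle_bounded[OF \<delta>] unfolding bx_def by metis
    have D: "by' ys n \<le> 1 / \<sigma> 0 * (\<sigma> 0 * V 0 xs ys / \<delta>)" for n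
    proof -
      let ?k = "r n"
      have "by' ys n \<le> 1 / \<sigma> ?k * DY ys (y ?k)"
        unfolding by'_def using sigma_pos[of ?k] DY_nonneg[OF ys_dom, of "Suc ?k"]
        by (intro mult_left_mono) auto
      also have "\<dots> \<le> 1 / \<sigma> 0 * (\<sigma> 0 * V 0 xs ys / \<delta>)"
        using sigma_ge_sigma0[of ?k] sigma0 DY_bound[OF \<delta>] DY_nonneg[OF ys_dom]
        by (intro mult_mono frac_le) auto
      finally show ?thesis .
    qed
    define b where "b = M + C + 1 / \<sigma> 0 * (\<sigma> 0 * V 0 xs ys / \<delta>)"
    have "f (x (Suc (r n))) + h (y (Suc (r n))) \<le> ereal b" for n
    proof -
      have "main xs ys n + bx xs n + by' ys n \<le> b"
        using M[of n] C[of n] D[of n] unfolding b_def by linarith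
      then show ?thesis using step[OF xs_dom ys_dom, of n] order_trans ereal_less_eq(3) by blast
    qed
    then have "f l + h m \<le> ereal b"
      by (rule closed_epi_add_le_limit[OF epi x' y' tendsto_const f_not_MInf h_not_MInf])
    then show "l \<in> edom f" "m \<in> edom h"
      using f_not_MInf[of l] h_not_MInf[of m] by (auto simp: edom_def)
  qed
  have "Lr l v \<le> Lr u m" if u: "u \<in> edom f" and v: "v \<in> edom h" for u v
  proof -
    have "(\<lambda>n. main u v n + bx u n + by' v n) \<longlonglongrightarrow> (fr u + hr v - \<Phi> l v + \<Phi> u m + 0) + 0 + 0"
      unfolding bx_def by'_def
      by (intro tendsto_add main_lim DX_difference_vanishes[OF \<delta> u dom(1) r xr]
          DY_difference_vanishes[OF \<delta> dom(2) r yr])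
    from closed_epi_add_le_limit[OF epi x' y' this f_not_MInf h_not_MInf step[OF u v]]
    show ?thesis by (simp add: f_fin[OF dom(1)] h_fin[OF dom(2)] Lr_def)
  qed
  then show ?thesis using dom by (simp add: saddle_point_iff)
qed

end

context apd_saddle
begin

lemma iterates_have_limit_point:
  assumes "\<And>k. norm (ys - y k) \<le> B"
  obtains l m r where "strict_mono r" "(\<lambda>n. x (r n)) \<longlonglongrightarrow> l" "(\<lambda>n. y (r n)) \<longlonglongrightarrow> m"
proof -
  obtain Bx where Bx: "\<And>k. norm (xs - x k) \<le> Bx" using x_bounded by blast
  have "norm (x k) \<le> norm xs + Bx" for k
    using norm_triangle_ineq4[of xs "xs - x k"] Bx[of k] by simp
  then have "bounded (range x)" by (auto simp: bounded_iff)
  moreover obtain BX :: "'a set" where "finite BX" "span BX = UNIV" using finite_dim_X by blast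
  ultimately obtain l r1 where r1: "strict_mono r1" "(x \<circ> r1) \<longlonglongrightarrow> l"
    using finite_span_convergent_subsequence[of BX x] by auto
  have "norm (y k) \<le> norm ys + B" for k
    using norm_triangle_ineq4[of ys "ys - y k"] assms[of k] by simp
  then have "bounded (range (y \<circ> r1))" by (auto simp: bounded_iff)
  moreover obtain BY :: "'b set" where "finite BY" "span BY = UNIV" using finite_dim_Y by blast
  ultimately obtain m r2 where r2: "strict_mono r2" "((y \<circ> r1) \<circ> r2) \<longlonglongrightarrow> m"
    using finite_span_convergent_subsequence[of BY "y \<circ> r1"] by auto
  have "((x \<circ> r1) \<circ> r2) \<longlonglongrightarrow> l" using r1(2) r2(1) by (rule LIMSEQ_subseq_LIMSEQ)
  then show ?thesis
    using that[of "r1 \<circ> r2" l m] strict_mono_o[OF r1(1) r2(1)] r2(2) by (simp add: o_def)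
qed

text \<open>
  If \<open>\<delta> = 0\<close> and \<open>c\<alpha> = 1\<close>, the lower bound of the energy gives no control of \<open>y\<close>. Instead, the
  inner product in \<open>V\<close> is estimated directly: it is at most a multiple of
  \<open>\<sigma>\<^sub>k\<^sub>-\<^sub>1 \<parallel>x\<^sub>k - x\<^sub>k\<^sub>-\<^sub>1\<parallel> \<parallel>ys - y\<^sub>k\<parallel>\<close>, and \<open>\<sigma>\<^sub>k \<parallel>xs - x\<^sub>k\<parallel>\<close> is bounded because \<open>\<gamma>\<^sub>k\<close> is proportional to \<open>\<sigma>\<^sub>k\<^sup>2\<close>.
  So \<open>b = \<parallel>ys - y\<^sub>k\<parallel>\<close> satisfies \<open>b\<^sup>2 / 2 \<le> C + D b\<close>, which bounds it.
\<close>
lemma y_bounded_if_Lyy_0: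
  assumes "Lyy = 0"
  obtains B where "\<And>k. norm (ys - y k) \<le> B"
proof -
  define P where "P = \<sigma> 0 * \<tau> 0"
  have P: "P > 0" using sigma0 tau0 by (simp add: P_def)
  define A where "A = sqrt (2 * (P * (\<sigma> 0 * V 0 xs ys)))"
  have sx: "\<sigma> k * norm (xs - x k) \<le> A" for k
  proof -
    have "(\<sigma> k * norm (xs - x k))\<^sup>2 = 2 * (P * (\<gamma> k * ((norm (xs - x k))\<^sup>2 / 2)))"
      using gamma_eq_sigma[of k] by (simp add: power_mult_distrib P_def algebra_simps)
    also have "\<dots> \<le> 2 * (P * (\<gamma> k * DX xs (x k)))"
      using P gamma_pos[of k] DX_ge[OF xs_dom, of k] by (intro mult_left_mono) auto
    also have "\<dots> \<le> 2 * (P * (\<sigma> 0 * V 0 xs ys))"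
      using P gamma_DX_bound[of k] by (intro mult_left_mono) auto
    finally show ?thesis unfolding A_def by (rule real_le_rsqrt)
  qed
  have A: "A \<ge> 0" using sx[of 0] sigma_pos[of 0] norm_ge_zero[of "xs - x 0"]
    by (meson mult_nonneg_nonneg less_imp_le order_trans)
  have se: "\<sigma> (k - 1) * dx k \<le> 2 * A" for k
  proof (cases k)
    case 0
    then show ?thesis using A by (simp add: dx_0)
  next
    case (Suc j)
    have "dx k \<le> norm (xs - x j) + norm (xs - x k)"
      using norm_triangle_ineq4[of "xs - x j" "xs - x k"] Suc by (simp add: dx_def)
    then have "\<sigma> j * dx k \<le> \<sigma> j * norm (xs - x j) + \<sigma> j * norm (xs - x k)"
      using mult_left_mono[of _ _ "\<sigma> j"] sigma_pos[of j] by (simp add: distrib_left[symmetric])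
    also have "\<dots> \<le> \<sigma> j * norm (xs - x j) + \<sigma> k * norm (xs - x k)"
      using sigma_mono[of j] Suc by (intro add_left_mono mult_right_mono) auto
    also have "\<dots> \<le> 2 * A" using sx[of j] sx[of k] by simp
    finally show ?thesis using Suc by simp
  qed
  define C D where "C = \<sigma> 0 * V 0 xs ys" and "D = 2 * (Lyx * A)"
  have C: "C \<ge> 0" using V_nonneg[OF xs_dom ys_dom, of 0] sigma0 by (simp add: C_def)
  have D: "D \<ge> 0" using Lyx_pos A by (simp add: D_def)
  have "norm (ys - y k) \<le> 2 * D + 2 * C + 1" for k
  proof -
    define b where "b = norm (ys - y k)"
    have "t (k - 1) * q k (ys - y k) \<le> t (k - 1) * (Lyx * dx k * b)"
      using q_apply_le[of k "ys - y k"] assms less_imp_le[OF t_pos, of "k - 1"]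
      by (intro mult_left_mono) (auto simp: b_def)
    then have "\<sigma> 0 * (t (k - 1) * q k (ys - y k)) \<le> \<sigma> 0 * (t (k - 1) * (Lyx * dx k * b))"
      by (rule mult_left_mono) (rule less_imp_le[OF sigma0])
    also have "\<dots> = (\<sigma> (k - 1) * dx k) * (Lyx * b)" using sigma0 by (simp add: t_def)
    also have "\<dots> \<le> (2 * A) * (Lyx * b)"
      using se[of k] Lyx_pos by (intro mult_right_mono) (auto simp: b_def)
    finally have q: "\<sigma> 0 * (t (k - 1) * q k (ys - y k)) \<le> D * b" by (simp add: D_def algebra_simps)
    have "0 \<le> \<gamma> k / \<sigma> 0 * DX xs (x k)"
      using gamma_pos[of k] sigma0 DX_nonneg[OF xs_dom, of k] by simp
    then have "1 / \<sigma> 0 * DY ys (y k) - t (k - 1) * q k (ys - y k) \<le> V 0 xs ys"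
      using V_saddle_mono[of 0 k] lag_nonneg[of k] unfolding V_def[of k] by linarith
    then have "\<sigma> 0 * (1 / \<sigma> 0 * DY ys (y k) - t (k - 1) * q k (ys - y k)) \<le> C"
      unfolding C_def by (rule mult_left_mono) (rule less_imp_le[OF sigma0])
    moreover have "\<sigma> 0 * (1 / \<sigma> 0 * DY ys (y k) - t (k - 1) * q k (ys - y k))
        = DY ys (y k) - \<sigma> 0 * (t (k - 1) * q k (ys - y k))"
      using sigma0 by (simp add: right_diff_distrib)
    ultimately have main: "b\<^sup>2 / 2 \<le> C + D * b"
      using DY_ge[OF ys_dom, of k] q unfolding b_def by linarith
    \<comment> \<open>If \<open>b > 2 D + 2 C + 1\<close>, then \<open>b\<^sup>2 / 2 > D b + C b \<ge> D b + C\<close>.\<close>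
    show ?thesis
    proof (rule ccontr)
      assume "\<not> ?thesis"
      then have big: "b > 2 * D + 2 * C + 1" by (simp add: b_def)
      then have "b * (2 * D + 2 * C + 1) \<le> b * b" using C D by (intro mult_left_mono) auto
      moreover have "C \<le> b * C" using mult_right_mono[of 1 b C] big C D by simp
      moreover have "b > 0" using big C D by linarith
      ultimately show False using main by (simp add: power2_eq_square algebra_simps)
    qed
  qed
  then show ?thesis using that by blast
qed

lemma x_converges_if_mu_pos:
  assumes "\<mu> > 0"
  shows "x \<longlonglongrightarrow> xs"
proof -
  obtain c where c: "c > 0" "\<And>K. c * (real K)\<^sup>2 \<le> \<gamma> K" using gamma_lower[OF assms] by blast
  define C where "C = 2 * (\<sigma> 0 * V 0 xs ys) / c"
  have "\<bar>(norm (x (Suc k) - xs))\<^sup>2\<bar> \<le> C * (inverse (real (Suc k)))\<^sup>2" for k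
  proof -
    have "c * (real (Suc k))\<^sup>2 * ((norm (xs - x (Suc k)))\<^sup>2 / 2) \<le> \<gamma> (Suc k) * DX xs (x (Suc k))"
      using c(2)[of "Suc k"] gamma_pos[of "Suc k"] DX_ge[OF xs_dom, of "Suc k"]
      by (intro mult_mono) auto
    also have "\<dots> \<le> \<sigma> 0 * V 0 xs ys" by (rule gamma_DX_bound)
    finally show ?thesis using c(1) by (simp add: C_def norm_minus_commute field_simps)
  qed
  moreover have "(\<lambda>k. C * (inverse (real (Suc k)))\<^sup>2) \<longlonglongrightarrow> C * 0\<^sup>2"
    by (intro tendsto_intros LIMSEQ_inverse_real_of_nat)
  then have "(\<lambda>k. C * (inverse (real (Suc k)))\<^sup>2) \<longlonglongrightarrow> 0" by simp
  ultimately have "(\<lambda>k. (norm (x (Suc k) - xs))\<^sup>2) \<longlonglongrightarrow> 0" by (rule tendsto_zero_dominated)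
  then have "(\<lambda>k. norm (x (Suc k) - xs)) \<longlonglongrightarrow> 0" by (rule tendsto_zero_of_square)
  then have "(\<lambda>k. x (Suc k)) \<longlonglongrightarrow> xs" by (simp add: tendsto_norm_zero_iff LIM_zero_iff)
  then show ?thesis by (rule LIMSEQ_imp_Suc)
qed

text \<open>
  Here the limit of a subsequence is the reference saddle point. An upper bound \<open>W\<close> of the energy,
  in which the inner product is replaced by norms, tends to zero along the subsequence; the energy
  is nonincreasing, so it tends to zero along the whole sequence and takes both distances with it.
\<close>
lemma iterates_converge_if_mu_0:
  assumes mu: "\<mu> = 0" and \<delta>: "\<delta> > 0" and r: "strict_mono r"
    and xr: "(\<lambda>n. x (r n)) \<longlonglongrightarrow> xs" and yr: "(\<lambda>n. y (r n)) \<longlonglongrightarrow> ys"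
  shows "x \<longlonglongrightarrow> xs" and "y \<longlonglongrightarrow> ys"
proof -
  have t1: "t k = 1" for k
    using constant_steps[OF mu, of k] sigma0 by (simp add: t_def)
  have sig: "\<sigma> (k - 1) = \<sigma> 0" for k using constant_steps[OF mu, of "k - 1"] by blast
  have gam: "\<gamma> k = \<gamma> 0" for k
    using constant_steps[OF mu, of k] gamma_eq[of k] gamma_eq[of 0] by simp
  define W where "W k = \<gamma> 0 / \<sigma> 0 * DX xs (x k) + 1 / \<sigma> 0 * DY ys (y k)
    + (Lyy * dy k + Lyx * dx k) * norm (ys - y k)
    + ((Lyx\<^sup>2 * \<sigma> 0 / c\<alpha>) / 2 * (dx k)\<^sup>2 + (Lyy\<^sup>2 * \<sigma> 0 / c\<beta>) / 2 * (dy k)\<^sup>2)" for k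
  have VW: "V k xs ys \<le> W k" for k
    using q_apply_le[of k "ys - y k"] gam[of k] sig[of k] unfolding V_def W_def lag_def t1 by simp
  have "(\<lambda>n. W (r n)) \<longlonglongrightarrow> \<gamma> 0 / \<sigma> 0 * DX xs xs + 1 / \<sigma> 0 * DY ys ys
    + (Lyy * 0 + Lyx * 0) * norm (ys - ys)
    + ((Lyx\<^sup>2 * \<sigma> 0 / c\<alpha>) / 2 * 0\<^sup>2 + (Lyy\<^sup>2 * \<sigma> 0 / c\<beta>) / 2 * 0\<^sup>2)"
    unfolding W_def
    by (intro tendsto_intros tendsto_bregman_real[OF phiX xs_dom] tendsto_bregman_real[OF phiY ys_dom]
        xr yr LIMSEQ_subseq_LIMSEQ[OF steps_vanish(2)[OF \<delta>] r, unfolded o_def]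
        LIMSEQ_subseq_LIMSEQ[OF steps_vanish(3)[OF \<delta>] r, unfolded o_def])
  then have Wr: "(\<lambda>n. W (r n)) \<longlonglongrightarrow> 0" by (simp add: breg_def)
  have V0: "(\<lambda>k. V k xs ys) \<longlonglongrightarrow> 0"
  proof (rule order_tendstoI)
    show "\<forall>\<^sub>F k in sequentially. a < V k xs ys" if "a < 0" for a
      using V_nonneg[OF xs_dom ys_dom] that by (intro always_eventually allI) (rule less_le_trans)
    show "\<forall>\<^sub>F k in sequentially. V k xs ys < a" if "0 < a" for a
    proof -
      have "\<forall>\<^sub>F n in sequentially. W (r n) < a" using Wr that by (rule order_tendstoD)
      then obtain n where n: "W (r n) < a" using eventually_happens'[OF sequentially_bot] by blast
      have "V k xs ys < a" if "k \<ge> r n" for k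
        using V_saddle_mono[OF that] VW[of "r n"] n by linarith
      then show ?thesis by (auto simp: eventually_sequentially)
    qed
  qed
  have X: "\<bar>(norm (x k - xs))\<^sup>2\<bar> \<le> 2 * \<sigma> 0 / \<gamma> 0 * V k xs ys"
    and Y: "\<bar>(norm (y k - ys))\<^sup>2\<bar> \<le> 2 * \<sigma> 0 / \<delta> * V k xs ys" for k
  proof -
    define a b where "a = \<gamma> 0 / \<sigma> 0" and "b = \<delta> / \<sigma> 0"
    have pos: "a > 0" "b > 0" using gamma_pos[of 0] sigma0 \<delta> by (simp_all add: a_def b_def)
    have "b \<le> (1 - (c\<alpha> + c\<beta>)) / \<sigma> 0"
      unfolding b_def using step_constants sigma0 by (intro divide_right_mono) auto
    then have "b * DY ys (y k) \<le> (1 - (c\<alpha> + c\<beta>)) / \<sigma> 0 * DY ys (y k)"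
      by (intro mult_right_mono DY_nonneg ys_dom)
    moreover have "b * ((norm (ys - y k))\<^sup>2 / 2) \<le> b * DY ys (y k)"
      using pos by (intro mult_left_mono DY_ge ys_dom) auto
    moreover have "a * ((norm (xs - x k))\<^sup>2 / 2) \<le> a * DX xs (x k)"
      using pos by (intro mult_left_mono DX_ge xs_dom) auto
    moreover have "0 \<le> b * ((norm (ys - y k))\<^sup>2 / 2)" "0 \<le> a * ((norm (xs - x k))\<^sup>2 / 2)"
      using pos by simp_all
    ultimately have "a * ((norm (xs - x k))\<^sup>2 / 2) \<le> V k xs ys" "b * ((norm (ys - y k))\<^sup>2 / 2) \<le> V k xs ys"
      using V_lower[OF ys_dom, of k xs] gam[of k] unfolding a_def by auto
    then have "(norm (xs - x k))\<^sup>2 \<le> 2 / a * V k xs ys" "(norm (ys - y k))\<^sup>2 \<le> 2 / b * V k xs ys"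
      using pos by (simp_all add: field_simps)
    then show "\<bar>(norm (x k - xs))\<^sup>2\<bar> \<le> 2 * \<sigma> 0 / \<gamma> 0 * V k xs ys"
      "\<bar>(norm (y k - ys))\<^sup>2\<bar> \<le> 2 * \<sigma> 0 / \<delta> * V k xs ys"
      by (simp_all add: norm_minus_commute a_def b_def)
  qed
  have sq_x: "(\<lambda>k. (norm (x k - xs))\<^sup>2) \<longlonglongrightarrow> 0"
    by (rule tendsto_zero_dominated[OF X tendsto_mult_right_zero[OF V0]])
  show "x \<longlonglongrightarrow> xs"
    by (rule LIM_zero_cancel[OF tendsto_norm_zero_cancel[OF tendsto_zero_of_square[OF sq_x]]])
  have sq_y: "(\<lambda>k. (norm (y k - ys))\<^sup>2) \<longlonglongrightarrow> 0"
    by (rule tendsto_zero_dominated[OF Y tendsto_mult_right_zero[OF V0]])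
  show "y \<longlonglongrightarrow> ys"
    by (rule LIM_zero_cancel[OF tendsto_norm_zero_cancel[OF tendsto_zero_of_square[OF sq_y]]])
qed

lemma saddle_gap_bounds:
  assumes "K \<ge> 1"
  shows "0 \<le> gap L t x y K xs ys \<and> gap L t x y K xs ys \<le> ereal (V 0 xs ys / weight_sum t K)"
  using saddle_gap_nonneg[OF assms] gap_le[OF assms, of xs ys]
  by (simp add: initial_dist_eq[OF xs_dom ys_dom])

lemma saddle_energy_bound_ereal:
  "ereal (\<gamma> K) * bregman \<phi>X xs (x K) + ereal (1 - (c\<alpha> + c\<beta>)) * bregman \<phi>Y ys (y K)
    \<le> ereal (\<sigma> 0) * initial_dist \<phi>X \<phi>Y (\<tau> 0) (\<sigma> 0) (x 0) (y 0) xs ys"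
  unfolding initial_dist_eq[OF xs_dom ys_dom] bregman_X[OF xs_dom] bregman_Y[OF ys_dom]
  using saddle_energy_bound[of K] by simp

end

section \<open>The two step-size regimes\<close>

context apd_energy
begin

abbreviation "\<Delta> \<equiv> initial_dist \<phi>X \<phi>Y (\<tau> 0) (\<sigma> 0) (x 0) (y 0)"

lemma apd_saddleI: "saddle_point L u v \<Longrightarrow> apd_saddle f h \<Phi> \<phi>X \<phi>Y \<mu> Lxx Lyx Lyy \<tau> \<sigma> \<gamma> \<theta> x y \<delta> c\<alpha> c\<beta> u v"
  by (intro apd_saddle.intro apd_saddle_axioms.intro apd_energy_axioms)

lemma weights_if_mu_0:
  assumes "\<mu> = 0"
  shows "t = (\<lambda>k. 1)"
proof
  fix k
  have "\<sigma> k = \<sigma> 0" using constant_steps[OF assms] by blast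
  then show "t k = 1" using sigma0 by (simp add: t_def)
qed

lemma merely_convex_convergence:
  assumes mu: "\<mu> = 0" and ex_saddle: "\<exists>u v. saddle_point L u v" and \<delta>: "\<delta> > 0"
  shows "\<exists>xs ys. saddle_point L xs ys \<and> (\<lambda>k. (x k, y k)) \<longlonglongrightarrow> (xs, ys) \<and>
     (\<exists>e \<in> O(\<lambda>K. 1 / real K). \<forall>K\<ge>1.
        0 \<le> gap L t x y K xs ys \<and> gap L t x y K xs ys \<le> ereal (e K)) \<and>
     (\<forall>K\<ge>1. ereal (\<gamma> 0) * bregman \<phi>X xs (x K) + ereal (1 - (c\<alpha> + c\<beta>)) * bregman \<phi>Y ys (y K)
        \<le> ereal (\<sigma> 0) * \<Delta> xs ys)"
proof -
  obtain u v where "saddle_point L u v" using ex_saddle by blast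
  then interpret uv: apd_saddle f h \<Phi> \<phi>X \<phi>Y \<mu> Lxx Lyx Lyy \<tau> \<sigma> \<gamma> \<theta> x y \<delta> c\<alpha> c\<beta> u v
    by (rule apd_saddleI)
  obtain B where "\<And>k. norm (v - y k) \<le> B" using uv.y_bounded[OF \<delta>] by blast
  then obtain xs ys r where r: "strict_mono r" "(\<lambda>n. x (r n)) \<longlonglongrightarrow> xs" "(\<lambda>n. y (r n)) \<longlonglongrightarrow> ys"
    by (rule uv.iterates_have_limit_point)
  then have s: "saddle_point L xs ys" by (rule uv.limit_point_saddle[OF \<delta>])
  then interpret s: apd_saddle f h \<Phi> \<phi>X \<phi>Y \<mu> Lxx Lyx Lyy \<tau> \<sigma> \<gamma> \<theta> x y \<delta> c\<alpha> c\<beta> xs ys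
    by (rule apd_saddleI)
  note t1 = weights_if_mu_0[OF mu]
  have rate: "(\<lambda>K. V 0 xs ys / weight_sum t K) \<in> O(\<lambda>K. 1 / real K)"
    by (rule bigoI[of _ "\<bar>V 0 xs ys\<bar>"]) (simp add: t1 weight_sum_def)
  have gaps: "\<forall>K\<ge>1. 0 \<le> gap L t x y K xs ys \<and>
      gap L t x y K xs ys \<le> ereal (V 0 xs ys / weight_sum t K)"
    using s.saddle_gap_bounds by blast
  from rate have rates: "\<exists>e \<in> O(\<lambda>K. 1 / real K). \<forall>K\<ge>1.
      0 \<le> gap L t x y K xs ys \<and> gap L t x y K xs ys \<le> ereal (e K)"
    by (rule bexI[rotated]) (rule gaps)
  have "\<gamma> K = \<gamma> 0" for K
    using constant_steps[OF mu, of K] gamma_eq[of K] gamma_eq[of 0] by simp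
  then have energy: "\<forall>K\<ge>1. ereal (\<gamma> 0) * bregman \<phi>X xs (x K) + ereal (1 - (c\<alpha> + c\<beta>)) * bregman \<phi>Y ys (y K)
        \<le> ereal (\<sigma> 0) * \<Delta> xs ys"
    using s.saddle_energy_bound_ereal by metis
  have lim: "(\<lambda>k. (x k, y k)) \<longlonglongrightarrow> (xs, ys)"
    using s.iterates_converge_if_mu_0[OF mu \<delta> r] by (rule tendsto_Pair)
  show ?thesis by (intro exI conjI) (rule s lim rates energy)+
qed

lemma weight_sum_bigtheta:
  assumes "\<mu> > 0"
  shows "weight_sum t \<in> \<Theta>(\<lambda>K. (real K)\<^sup>2)"
proof -
  obtain c C where c: "c > 0" "\<And>K. c * (real K)\<^sup>2 \<le> weight_sum (\<lambda>k. \<sigma> k / \<sigma> 0) K"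
    and C: "\<And>K. weight_sum (\<lambda>k. \<sigma> k / \<sigma> 0) K \<le> C * (real K)\<^sup>2"
    using weight_sum_bounds[OF assms] by blast
  have t: "t = (\<lambda>k. \<sigma> k / \<sigma> 0)" by (simp add: t_def fun_eq_iff)
  have nonneg: "0 \<le> weight_sum t K" for K
    unfolding weight_sum_def using less_imp_le[OF t_pos] by (rule sum_nonneg)
  show ?thesis
  proof (rule bigthetaI)
    show "weight_sum t \<in> O(\<lambda>K. (real K)\<^sup>2)"
      using C nonneg by (intro bigoI[of _ C] always_eventually) (simp add: t)
    show "weight_sum t \<in> \<Omega>(\<lambda>K. (real K)\<^sup>2)"
      using c nonneg by (intro landau_omega.bigI[of c] always_eventually) (simp_all add: t)
  qed
qed

lemma gamma_bigomega:
  assumes "\<mu> > 0"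
  shows "\<gamma> \<in> \<Omega>(\<lambda>K. (real K)\<^sup>2)"
proof -
  obtain c where c: "c > 0" "\<And>K. c * (real K)\<^sup>2 \<le> \<gamma> K" using gamma_lower[OF assms] by blast
  then show ?thesis
    using less_imp_le[OF gamma_pos] by (intro landau_omega.bigI[of c] always_eventually) simp_all
qed

text \<open>Applied to two saddle points, this shows that their \<open>x\<close>-coordinates agree.\<close>
lemma x_converges_to_saddle_point:
  assumes "\<mu> > 0" "saddle_point L u v"
  shows "x \<longlonglongrightarrow> u"
  by (rule apd_saddle.x_converges_if_mu_pos[OF apd_saddleI[OF assms(2)] assms(1)])

lemma strongly_convex_convergence:
  assumes mu: "\<mu> > 0" and Lyy: "Lyy = 0" and ex_saddle: "\<exists>u v. saddle_point L u v"
  shows "\<exists>xs. (\<forall>u v. saddle_point L u v \<longrightarrow> u = xs) \<and> x \<longlonglongrightarrow> xs"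
    and "\<exists>l. seq_limit_point y l"
    and "\<lbrakk>\<delta> > 0; seq_limit_point (\<lambda>k. (x k, y k)) (xs, ys)\<rbrakk> \<Longrightarrow> saddle_point L xs ys"
proof -
  obtain u v where uv: "saddle_point L u v" using ex_saddle by blast
  then interpret uv: apd_saddle f h \<Phi> \<phi>X \<phi>Y \<mu> Lxx Lyx Lyy \<tau> \<sigma> \<gamma> \<theta> x y \<delta> c\<alpha> c\<beta> u v
    by (rule apd_saddleI)
  have "x \<longlonglongrightarrow> u" by (rule x_converges_to_saddle_point[OF mu uv])
  moreover have "u' = u" if "saddle_point L u' v'" for u' v'
    using LIMSEQ_unique[OF x_converges_to_saddle_point[OF mu that] \<open>x \<longlonglongrightarrow> u\<close>] .
  ultimately show "\<exists>xs. (\<forall>u v. saddle_point L u v \<longrightarrow> u = xs) \<and> x \<longlonglongrightarrow> xs" by blast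
  obtain B where "\<And>k. norm (v - y k) \<le> B" using uv.y_bounded_if_Lyy_0[OF Lyy] by blast
  then obtain l m r where "strict_mono r" "(\<lambda>n. x (r n)) \<longlonglongrightarrow> l" "(\<lambda>n. y (r n)) \<longlonglongrightarrow> m"
    by (rule uv.iterates_have_limit_point)
  then show "\<exists>l. seq_limit_point y l" by (auto simp: seq_limit_point_def o_def)
  assume \<delta>: "\<delta> > 0" and lp: "seq_limit_point (\<lambda>k. (x k, y k)) (xs, ys)"
  then obtain r where r: "strict_mono r" "(\<lambda>n. (x (r n), y (r n))) \<longlonglongrightarrow> (xs, ys)"
    by (auto simp: seq_limit_point_def o_def)
  show "saddle_point L xs ys"
    using uv.limit_point_saddle[OF \<delta> r(1)] tendsto_fst[OF r(2)] tendsto_snd[OF r(2)] by simp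
qed

lemma strongly_convex_rates:
  assumes mu: "\<mu> > 0" and saddle: "saddle_point L xs ys"
  shows "\<exists>e \<in> O(\<lambda>K. 1 / (real K)\<^sup>2). \<forall>K\<ge>1.
       0 \<le> gap L t x y K xs ys \<and> gap L t x y K xs ys \<le> ereal (e K)"
    and "\<exists>e \<in> O(\<lambda>K. 1 / (real K)\<^sup>2). \<forall>K. bregman \<phi>X xs (x K) = ereal (e K)"
proof -
  interpret s: apd_saddle f h \<Phi> \<phi>X \<phi>Y \<mu> Lxx Lyx Lyy \<tau> \<sigma> \<gamma> \<theta> x y \<delta> c\<alpha> c\<beta> xs ys
    using saddle by (rule apd_saddleI)
  have V0: "0 \<le> V 0 xs ys" by (rule V_nonneg[OF s.xs_dom s.ys_dom])
  have bound: "\<bar>e\<bar> \<le> M / c * \<bar>1 / (real K)\<^sup>2\<bar>"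
    if "K \<ge> 1" "c > 0" "c * (real K)\<^sup>2 \<le> w" "0 \<le> e" "w * e \<le> M" for e :: real and K c w M
  proof -
    have "c * (real K)\<^sup>2 * e \<le> M"
      using mult_right_mono[OF that(3,4)] that(5) by linarith
    then show ?thesis using that by (simp add: field_simps)
  qed
  have ev: "\<forall>\<^sub>F K in sequentially. K \<ge> (1::nat)" by (rule eventually_ge_at_top)
  obtain c where c: "c > 0" "\<And>K. c * (real K)\<^sup>2 \<le> weight_sum (\<lambda>k. \<sigma> k / \<sigma> 0) K"
    by (rule weight_sum_bounds[OF mu]) blast
  have t: "t = (\<lambda>k. \<sigma> k / \<sigma> 0)" by (simp add: t_def fun_eq_iff)
  have "(\<lambda>K. V 0 xs ys / weight_sum t K) \<in> O(\<lambda>K. 1 / (real K)\<^sup>2)"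
  proof (rule bigoI[of _ "V 0 xs ys / c"], use ev in eventually_elim)
    case (elim K)
    then show ?case
      using bound[of K c "weight_sum t K" "V 0 xs ys / weight_sum t K" "V 0 xs ys"] c
        weight_sum_pos[of K] V0 by (simp add: t)
  qed
  then show "\<exists>e \<in> O(\<lambda>K. 1 / (real K)\<^sup>2). \<forall>K\<ge>1.
       0 \<le> gap L t x y K xs ys \<and> gap L t x y K xs ys \<le> ereal (e K)"
    by (rule bexI[rotated]) (intro allI impI s.saddle_gap_bounds)
  obtain g where g: "g > 0" "\<And>K. g * (real K)\<^sup>2 \<le> \<gamma> K" using gamma_lower[OF mu] by blast
  have "(\<lambda>K. DX xs (x K)) \<in> O(\<lambda>K. 1 / (real K)\<^sup>2)"
  proof (rule bigoI[of _ "\<sigma> 0 * V 0 xs ys / g"], use ev in eventually_elim)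
    case (elim K)
    then show ?case
      using bound[OF elim g(1) g(2)[of K] DX_nonneg[OF s.xs_dom] s.gamma_DX_bound[of K]] by simp
  qed
  then show "\<exists>e \<in> O(\<lambda>K. 1 / (real K)\<^sup>2). \<forall>K. bregman \<phi>X xs (x K) = ereal (e K)"
    by (rule bexI[rotated]) (intro allI bregman_X s.xs_dom)
qed

lemma merely_convex_case:
  assumes mu: "\<mu> = 0"
  shows "(\<forall>k. \<tau> k = \<tau> 0 \<and> \<sigma> k = \<sigma> 0 \<and> \<theta> k = 1) \<and>
    (\<forall>K\<ge>1. weight_sum (\<lambda>k. 1) K = real K) \<and>
    (\<forall>u v. \<forall>K\<ge>1. gap L (\<lambda>k. 1) x y K u v \<le> ereal (1 / weight_sum (\<lambda>k. 1) K) * \<Delta> u v) \<and>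
    ((\<exists>u v. saddle_point L u v) \<and> \<delta> > 0 \<longrightarrow>
       (\<exists>xs ys. saddle_point L xs ys \<and> (\<lambda>k. (x k, y k)) \<longlonglongrightarrow> (xs, ys) \<and>
          (\<exists>e \<in> O(\<lambda>K. 1 / real K). \<forall>K\<ge>1.
             0 \<le> gap L (\<lambda>k. 1) x y K xs ys \<and> gap L (\<lambda>k. 1) x y K xs ys \<le> ereal (e K)) \<and>
          (\<forall>K\<ge>1. ereal (\<gamma> 0) * bregman \<phi>X xs (x K) + ereal (1 - (c\<alpha> + c\<beta>)) * bregman \<phi>Y ys (y K)
             \<le> ereal (\<sigma> 0) * \<Delta> xs ys)))"
proof -
  note t1 = weights_if_mu_0[OF mu]
  have steps: "\<forall>k. \<tau> k = \<tau> 0 \<and> \<sigma> k = \<sigma> 0 \<and> \<theta> k = 1" using constant_steps[OF mu] by blast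
  have weights: "\<forall>K\<ge>1. weight_sum (\<lambda>k. 1) K = real K" by (simp add: weight_sum_def)
  note gaps = gap_le[unfolded t1]
  note conv = merely_convex_convergence[OF mu, unfolded t1]
  show ?thesis
    by (rule conjI, rule steps, rule conjI, rule weights, rule conjI, intro allI impI, rule gaps,
        assumption, rule impI, rule conv, erule conjunct1, erule conjunct2)
qed

lemma strongly_convex_case:
  assumes mu: "\<mu> > 0" and Lyy: "Lyy = 0"
  shows "(\<forall>k. \<sigma> k / \<sigma> 0 > 0) \<and>
    (\<forall>u v. \<forall>K\<ge>1. gap L (\<lambda>k. \<sigma> k / \<sigma> 0) x y K u v
       \<le> ereal (1 / weight_sum (\<lambda>k. \<sigma> k / \<sigma> 0) K) * \<Delta> u v) \<and>
    weight_sum (\<lambda>k. \<sigma> k / \<sigma> 0) \<in> \<Theta>(\<lambda>K. (real K)\<^sup>2) \<and>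
    ((\<exists>u v. saddle_point L u v) \<longrightarrow>
       (\<exists>xs. (\<forall>u v. saddle_point L u v \<longrightarrow> u = xs) \<and> x \<longlonglongrightarrow> xs) \<and>
       (\<exists>l. seq_limit_point y l) \<and>
       (\<delta> > 0 \<longrightarrow>
          (\<forall>xs ys. seq_limit_point (\<lambda>k. (x k, y k)) (xs, ys) \<longrightarrow>
             saddle_point L xs ys \<and>
             (\<exists>e \<in> O(\<lambda>K. 1 / (real K)\<^sup>2). \<forall>K\<ge>1.
                0 \<le> gap L (\<lambda>k. \<sigma> k / \<sigma> 0) x y K xs ys \<and>
                gap L (\<lambda>k. \<sigma> k / \<sigma> 0) x y K xs ys \<le> ereal (e K)) \<and>
             (\<forall>K\<ge>1. ereal (\<gamma> K) * bregman \<phi>X xs (x K) + ereal (1 - c\<alpha>) * bregman \<phi>Y ys (y K)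
                \<le> ereal (\<sigma> 0) * \<Delta> xs ys) \<and>
             \<gamma> \<in> \<Omega>(\<lambda>K. (real K)\<^sup>2) \<and>
             (\<exists>e \<in> O(\<lambda>K. 1 / (real K)\<^sup>2). \<forall>K. bregman \<phi>X xs (x K) = ereal (e K)))))"
proof -
  have t: "t = (\<lambda>k. \<sigma> k / \<sigma> 0)" by (simp add: t_def fun_eq_iff)
  have pos: "\<sigma> k / \<sigma> 0 > 0" for k by (simp add: sigma_pos)
  have c\<beta>: "c\<beta> = 0" using cond Lyy unfolding step_condition_def by blast
  have energy: "ereal (\<gamma> K) * bregman \<phi>X xs (x K) + ereal (1 - c\<alpha>) * bregman \<phi>Y ys (y K)
      \<le> ereal (\<sigma> 0) * \<Delta> xs ys" if "saddle_point L xs ys" for xs ys K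
    using apd_saddle.saddle_energy_bound_ereal[OF apd_saddleI[OF that], of K] by (simp add: c\<beta>)
  note gaps = gap_le[unfolded t] and weights = weight_sum_bigtheta[OF mu, unfolded t]
    and rates = strongly_convex_rates[OF mu, unfolded t]
    and conv = strongly_convex_convergence[OF mu Lyy]
  show ?thesis
    by (intro conjI allI impI, rule pos, rule gaps, assumption, rule weights,
        rule conv(1), assumption, rule conv(2), assumption,
        rule conv(3), assumption, assumption, assumption,
        rule rates(1), rule conv(3), assumption, assumption, assumption,
        rule energy, rule conv(3), assumption, assumption, assumption,
        rule gamma_bigomega[OF mu],
        rule rates(2), rule conv(3), assumption, assumption, assumption)
qed

end

theorem theorem2p2:
  fixes f :: "'a::real_normed_vector \<Rightarrow> ereal"
    and h :: "'b::real_normed_vector \<Rightarrow> ereal"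
    and \<Phi> :: "'a \<Rightarrow> 'b \<Rightarrow> real"
    and \<phi>X :: "'a \<Rightarrow> ereal" and \<phi>Y :: "'b \<Rightarrow> ereal"
    and \<mu> Lxx Lyx Lyy :: real
    and \<tau> \<sigma> \<gamma> \<theta> :: "nat \<Rightarrow> real"
    and x :: "nat \<Rightarrow> 'a" and y :: "nat \<Rightarrow> 'b"
    and L :: "'a \<Rightarrow> 'b \<Rightarrow> ereal"
    and \<Delta> :: "'a \<Rightarrow> 'b \<Rightarrow> ereal"
  assumes "saddle_setting f h \<Phi> \<phi>X \<phi>Y \<mu> Lxx Lyx Lyy"
    and "L = lagrangian f \<Phi> h"
    and "apd f h \<Phi> \<phi>X \<phi>Y \<mu> \<tau> \<sigma> \<gamma> \<theta> x y"
    and "x 0 \<in> edom f" and "y 0 \<in> edom h"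
    and "\<tau> 0 > 0" and "\<sigma> 0 > 0"
    and "\<Delta> = initial_dist \<phi>X \<phi>Y (\<tau> 0) (\<sigma> 0) (x 0) (y 0)"
  shows
    "(\<forall>k. \<theta> (Suc k) = 1 / sqrt (1 + \<mu> * \<tau> k) \<and>
          \<tau> (Suc k) = \<theta> (Suc k) * \<tau> k \<and>
          \<sigma> (Suc k) = \<sigma> k / \<theta> (Suc k)) \<and>
     (\<forall>\<delta> c\<alpha> c\<beta>. step_condition Lxx Lyx Lyy (\<tau> 0) (\<sigma> 0) \<delta> c\<alpha> c\<beta> \<longrightarrow>
        (\<mu> = 0 \<longrightarrow>
           (\<forall>k. \<tau> k = \<tau> 0 \<and> \<sigma> k = \<sigma> 0 \<and> \<theta> k = 1) \<and>
           (\<forall>K\<ge>1. weight_sum (\<lambda>k. 1) K = real K) \<and>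
           (\<forall>u v. \<forall>K\<ge>1. gap L (\<lambda>k. 1) x y K u v
                \<le> ereal (1 / weight_sum (\<lambda>k. 1) K) * \<Delta> u v) \<and>
           ((\<exists>u v. saddle_point L u v) \<and> \<delta> > 0 \<longrightarrow>
              (\<exists>xs ys. saddle_point L xs ys \<and> (\<lambda>k. (x k, y k)) \<longlonglongrightarrow> (xs, ys) \<and>
                 (\<exists>e \<in> O(\<lambda>K. 1 / real K). \<forall>K\<ge>1.
                    0 \<le> gap L (\<lambda>k. 1) x y K xs ys \<and>
                    gap L (\<lambda>k. 1) x y K xs ys \<le> ereal (e K)) \<and>
                 (\<forall>K\<ge>1. ereal (\<gamma> 0) * bregman \<phi>X xs (x K)
                        + ereal (1 - (c\<alpha> + c\<beta>)) * bregman \<phi>Y ys (y K)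
                      \<le> ereal (\<sigma> 0) * \<Delta> xs ys)))) \<and>
        (\<mu> > 0 \<and> Lyy = 0 \<longrightarrow>
           (\<forall>k. \<sigma> k / \<sigma> 0 > 0) \<and>
           (\<forall>u v. \<forall>K\<ge>1. gap L (\<lambda>k. \<sigma> k / \<sigma> 0) x y K u v
                \<le> ereal (1 / weight_sum (\<lambda>k. \<sigma> k / \<sigma> 0) K) * \<Delta> u v) \<and>
           weight_sum (\<lambda>k. \<sigma> k / \<sigma> 0) \<in> \<Theta>(\<lambda>K. (real K)\<^sup>2) \<and>
           ((\<exists>u v. saddle_point L u v) \<longrightarrow>
              (\<exists>xs. (\<forall>u v. saddle_point L u v \<longrightarrow> u = xs) \<and> x \<longlonglongrightarrow> xs) \<and>
              (\<exists>l. seq_limit_point y l) \<and>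
              (\<delta> > 0 \<longrightarrow>
                 (\<forall>xs ys. seq_limit_point (\<lambda>k. (x k, y k)) (xs, ys) \<longrightarrow>
                    saddle_point L xs ys \<and>
                    (\<exists>e \<in> O(\<lambda>K. 1 / (real K)\<^sup>2). \<forall>K\<ge>1.
                       0 \<le> gap L (\<lambda>k. \<sigma> k / \<sigma> 0) x y K xs ys \<and>
                       gap L (\<lambda>k. \<sigma> k / \<sigma> 0) x y K xs ys \<le> ereal (e K)) \<and>
                    (\<forall>K\<ge>1. ereal (\<gamma> K) * bregman \<phi>X xs (x K)
                           + ereal (1 - c\<alpha>) * bregman \<phi>Y ys (y K)
                         \<le> ereal (\<sigma> 0) * \<Delta> xs ys) \<and>
                    \<gamma> \<in> \<Omega>(\<lambda>K. (real K)\<^sup>2) \<and>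
                    (\<exists>e \<in> O(\<lambda>K. 1 / (real K)\<^sup>2). \<forall>K. bregman \<phi>X xs (x K) = ereal (e K)))))))"
proof -
  interpret run: apd_run f h \<Phi> \<phi>X \<phi>Y \<mu> Lxx Lyx Lyy \<tau> \<sigma> \<gamma> \<theta> x y
  proof (intro apd_run.intro step_sizes.intro apd_run_axioms.intro)
    show "saddle_setting f h \<Phi> \<phi>X \<phi>Y \<mu> Lxx Lyx Lyy" by fact
    then show "\<mu> \<ge> 0" by (rule saddle_setting.mu_nonneg)
    show "apd_step_sizes \<mu> \<tau> \<sigma> \<gamma> \<theta>"
      using \<open>apd f h \<Phi> \<phi>X \<phi>Y \<mu> \<tau> \<sigma> \<gamma> \<theta> x y\<close> unfolding apd_def by blast
  qed fact+
  have steps: "\<theta> (Suc k) = 1 / sqrt (1 + \<mu> * \<tau> k) \<and>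
      \<tau> (Suc k) = \<theta> (Suc k) * \<tau> k \<and> \<sigma> (Suc k) = \<sigma> k / \<theta> (Suc k)" for k
    by (simp add: run.theta_Suc_eq run.tau_Suc_eq run.sigma_Suc_eq)
  have energy: "apd_energy f h \<Phi> \<phi>X \<phi>Y \<mu> Lxx Lyx Lyy \<tau> \<sigma> \<gamma> \<theta> x y \<delta> c\<alpha> c\<beta>"
    if "step_condition Lxx Lyx Lyy (\<tau> 0) (\<sigma> 0) \<delta> c\<alpha> c\<beta>" "\<mu> = 0 \<or> Lyy = 0" for \<delta> c\<alpha> c\<beta>
    using run.apd_run_axioms that by (intro apd_energy.intro apd_energy_axioms.intro)
  note case_I = apd_energy.merely_convex_case[OF energy[OF _ disjI1]]
    and case_II = apd_energy.strongly_convex_case[OF energy[OF _ disjI2]]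
  show ?thesis
    unfolding \<open>L = lagrangian f \<Phi> h\<close> \<open>\<Delta> = initial_dist \<phi>X \<phi>Y (\<tau> 0) (\<sigma> 0) (x 0) (y 0)\<close>
    by (rule conjI, rule allI, rule steps, rule allI, rule allI, rule allI, rule impI, rule conjI,
        rule impI, rule case_I, assumption, assumption, assumption,
        rule impI, rule case_II, assumption, erule conjunct2, erule conjunct1, erule conjunct2)
qed

end
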